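(* Let $(S,\Sigma,\nu)$, $B(\cdot)$, $\sigma$, $\varphi(s,\cdot)$ and $\psi_s$ be as in the context, let $\mathcal{S}:=\{A\in\Sigma:\nu(A)<\infty\}$ and, for $A\in\mathcal{S}$, let $\phi_A(C):=\int_A\varphi(s,C)\,\nu(ds)$ for Borel sets $C\subset\mathbb{R}^m$. Then there exists an $\mathbb{R}^m$-valued independently scattered random measure $\mathbb{M}=\{M(A):A\in\mathcal{S}\}$ on $\mathcal{S}$ whose marginal distributions are uniquely determined by the requirement that, for every $A\in\mathcal{S}$, $M(A)$ is infinitely divisible with Lévy–Khintchine triplet $[0,0,\phi_A]$ (no shift, no Gaussian part, Lévy measure $\phi_A$); that is, the characteristic function of $M(A)$ is $$\mathbb{R}^m\ni u\mapsto \exp\Big(\int_{\mathbb{R}^m}(\cos\langle x,u\rangle-1)\,\phi_A(dx)\Big)=\exp\Big(\int_A\psi_s(u)\,\nu(ds)\Big).$$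
   Context: Notation: $m\ge 1$; $\mathrm{L}(\mathbb{R}^m)$ is the set of linear operators on $\mathbb{R}^m$ ($m\times m$ matrices); $\|\cdot\|$ is the Euclidean norm, $\langle\cdot,\cdot\rangle$ the inner product; $r^D=\exp((\ln r)D)$ for $r>0$. For $D\in \mathrm{L}(\mathbb{R}^m)$, $\lambda_D$ and $\Lambda_D$ are the minimum and maximum of the real parts of the eigenvalues of $D$; $Q(\mathbb{R}^m):=\{D:\lambda_D>0\}$. Setting: $(S,\Sigma,\nu)$ is a $\sigma$-finite measure space. For each $s\in S$, $B(s)\in Q(\mathbb{R}^m)$ is symmetric, $s\mapsto B(s)$ is measurable, and with $\lambda(s):=\lambda_{B(s)}$, $\Lambda(s):=\Lambda_{B(s)}$ one has $1/2<\inf_{s\in S}\lambda(s)\le\sup_{s\in S}\Lambda(s)<\infty$. $\sigma$ is a finite symmetric Borel measure on the Euclidean unit sphere $S^{m-1}$ whose support spans $\mathbb{R}^m$. For $s\in S$ and Borel $C\subset\mathbb{R}^m$, $$\varphi(s,C):=\int_0^\infty\int_{S^{m-1}}\mathbf 1_C(r^{B(s)}\theta)\,r^{-2}\,\sigma(d\theta)\,dr,\qquad \psi_s(u):=\int_{\mathbb{R}^m}(\cos\langle x,u\rangle-1)\,\varphi(s,dx),\ u\in\mathbb{R}^m.$$ Each $\varphi(s,\cdot)$ is a symmetric Lévy measure and $\exp(\psi_s)$ is the characteristic function of a full symmetric operator-stable law $\mu_s$ with exponent $B(s)$. An $\mathbb{R}^m$-valued independently scattered random measure (ISRM) on a $\delta$-ring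 $\mathcal{S}$ is a family $\{M(A):A\in\mathcal{S}\}$ of $\mathbb{R}^m$-valued random vectors on a common probability space such that for pairwise disjoint sets in $\mathcal{S}$ the corresponding random vectors are independent, and whenever $A_1,A_2,\dots\in\mathcal{S}$ are pairwise disjoint with $\bigcup_nA_n\in\mathcal{S}$, then $M(\bigcup_nA_n)=\sum_nM(A_n)$ almost surely. The ISRM of the theorem is called the multi operator-stable ISRM generated by $(\mu_s)_{s\in S}$ and $\nu$. *)

theory Defs
  imports "HOL-Probability.Probability"
begin

text \<open>Eigenvalues of a real matrix are its complex ones: \<open>A\<close> acts on complex vectors.\<close>

definition eigenvalues :: "real^'m^'m \<Rightarrow> complex set" where
  "eigenvalues A =
     {z. \<exists>v::complex^'m. v \<noteq> 0 \<and> (\<chi> i j. complex_of_real (A $ i $ j)) *v v = z *s v}"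

definition min_eig_Re :: "real^'m^'m \<Rightarrow> real" where
  "min_eig_Re A = Min (Re ` eigenvalues A)"

definition max_eig_Re :: "real^'m^'m \<Rightarrow> real" where
  "max_eig_Re A = Max (Re ` eigenvalues A)"

definition Q_ops :: "(real^'m^'m) set" where
  "Q_ops = {A. 0 < min_eig_Re A}"

text \<open>The product \<open>*\<close> and hence \<open>^\<close> and \<open>exp\<close> of the library are not those of the matrix
  algebra on \<open>real^'m^'m\<close>, so powers and the exponential series are spelled out with \<open>**\<close>.\<close>

definition mat_power :: "nat \<Rightarrow> real^'m^'m \<Rightarrow> real^'m^'m" where
  "mat_power n A = (((**) A) ^^ n) (mat 1)"

definition mat_exp :: "real^'m^'m \<Rightarrow> real^'m^'m" where
  "mat_exp A = (\<Sum>n. mat_power n A /\<^sub>R fact n)"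

definition op_powr :: "real \<Rightarrow> real^'m^'m \<Rightarrow> real^'m^'m" where
  "op_powr r D = mat_exp (ln r *\<^sub>R D)"

definition symmetric_measure :: "'a::real_vector measure \<Rightarrow> bool" where
  "symmetric_measure \<sigma> \<longleftrightarrow> (\<forall>C\<in>sets \<sigma>. emeasure \<sigma> (uminus ` C) = emeasure \<sigma> C)"

definition measure_support :: "'a::topological_space measure \<Rightarrow> 'a set" where
  "measure_support \<sigma> = {x \<in> space \<sigma>. \<forall>U. open U \<longrightarrow> x \<in> U \<longrightarrow> emeasure \<sigma> (U \<inter> space \<sigma>) > 0}"

definition char_fun :: "'a::real_inner measure \<Rightarrow> 'a \<Rightarrow> complex" where
  "char_fun \<mu> u = (CLINT x|\<mu>. iexp (x \<bullet> u))"

definition infinitely_divisible :: "(real^'m) measure \<Rightarrow> bool" where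
  "infinitely_divisible \<mu> \<longleftrightarrow> prob_space \<mu> \<and> sets \<mu> = sets borel \<and>
     (\<forall>n\<ge>1. \<exists>\<rho>. prob_space \<rho> \<and> sets \<rho> = sets borel \<and>
        \<mu> = ((\<lambda>\<tau>. \<rho> \<star> \<tau>) ^^ n) (return borel 0))"

definition levy_measure :: "(real^'m) measure \<Rightarrow> bool" where
  "levy_measure \<phi> \<longleftrightarrow> sets \<phi> = sets borel \<and> emeasure \<phi> {0} = 0 \<and>
     (\<integral>\<^sup>+x. ennreal (min 1 ((norm x)\<^sup>2)) \<partial>\<phi>) < \<infinity>"

text \<open>\<open>\<mu>\<close> is infinitely divisible with triplet \<open>[\<gamma>, Q, \<phi>]\<close>, with the
  centering function \<open>x / (1 + (norm x)\<^sup>2)\<close>.\<close>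

definition levy_khintchine ::
    "(real^'m) measure \<Rightarrow> real^'m \<Rightarrow> real^'m^'m \<Rightarrow> (real^'m) measure \<Rightarrow> bool" where
  "levy_khintchine \<mu> \<gamma> Q \<phi> \<longleftrightarrow>
     infinitely_divisible \<mu> \<and> levy_measure \<phi> \<and>
     transpose Q = Q \<and> (\<forall>u. 0 \<le> (Q *v u) \<bullet> u) \<and>
     (\<forall>u. char_fun \<mu> u =
        exp (\<i> * of_real (\<gamma> \<bullet> u) - of_real ((Q *v u) \<bullet> u / 2) +
             (CLINT x|\<phi>. iexp (x \<bullet> u) - 1 - \<i> * of_real ((x \<bullet> u) / (1 + (norm x)\<^sup>2)))))"

definition delta_ring :: "'s set \<Rightarrow> 's set set \<Rightarrow> bool" where
  "delta_ring \<Omega> R \<longleftrightarrow> ring_of_sets \<Omega> R \<and>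
     (\<forall>A::nat \<Rightarrow> 's set. range A \<subseteq> R \<longrightarrow> (\<Inter>n. A n) \<in> R)"

definition isrm ::
    "'w measure \<Rightarrow> 's set \<Rightarrow> 's set set \<Rightarrow> ('s set \<Rightarrow> 'w \<Rightarrow> real^'m) \<Rightarrow> bool" where
  "isrm P \<Omega> R M \<longleftrightarrow>
     prob_space P \<and> delta_ring \<Omega> R \<and>
     (\<forall>A\<in>R. M A \<in> borel_measurable P) \<and>
     (\<forall>(I::nat set) A. A ` I \<subseteq> R \<longrightarrow> disjoint_family_on A I \<longrightarrow>
        prob_space.indep_vars P (\<lambda>_. borel) (\<lambda>n. M (A n)) I) \<and>
     (\<forall>A::nat \<Rightarrow> 's set. range A \<subseteq> R \<longrightarrow> disjoint_family A \<longrightarrow> (\<Union>n. A n) \<in> R \<longrightarrow>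
        (AE w in P. (\<lambda>n. M (A n) w) sums M (\<Union>n. A n) w))"

definition phi :: "(real^'m) measure \<Rightarrow> ('s \<Rightarrow> real^'m^'m) \<Rightarrow> 's \<Rightarrow> (real^'m) measure" where
  "phi \<sigma> B s = measure_of UNIV (sets borel)
     (\<lambda>C. \<integral>\<^sup>+r\<in>{0<..}. (\<integral>\<^sup>+\<theta>. indicator C (op_powr r (B s) *v \<theta>) * ennreal (1 / r\<^sup>2) \<partial>\<sigma>) \<partial>lborel)"

definition psi :: "(real^'m) measure \<Rightarrow> ('s \<Rightarrow> real^'m^'m) \<Rightarrow> 's \<Rightarrow> real^'m \<Rightarrow> real" where
  "psi \<sigma> B s u = (\<integral>x. (cos (x \<bullet> u) - 1) \<partial>phi \<sigma> B s)"

definition fin_sets :: "'s measure \<Rightarrow> 's set set" where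
  "fin_sets \<nu> = {A \<in> sets \<nu>. emeasure \<nu> A < \<infinity>}"

definition phi_int ::
    "'s measure \<Rightarrow> (real^'m) measure \<Rightarrow> ('s \<Rightarrow> real^'m^'m) \<Rightarrow> 's set \<Rightarrow> (real^'m) measure" where
  "phi_int \<nu> \<sigma> B A = measure_of UNIV (sets borel)
     (\<lambda>C. \<integral>\<^sup>+s\<in>A. emeasure (phi \<sigma> B s) C \<partial>\<nu>)"

text \<open>Both set functions are countably additive, so that \<open>measure_of\<close> does not
  degenerate to the zero measure.\<close>

lemma sets_phi [simp, measurable_cong]: "sets (phi \<sigma> B s) = sets borel"
  unfolding phi_def using sets.sigma_sets_eq[of borel] by (simp add: sets_measure_of_conv)

lemma space_phi [simp]: "space (phi \<sigma> B s) = UNIV"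
  by (simp add: phi_def space_measure_of_conv)

lemma sets_phi_int [simp, measurable_cong]: "sets (phi_int \<nu> \<sigma> B A) = sets borel"
  unfolding phi_int_def using sets.sigma_sets_eq[of borel] by (simp add: sets_measure_of_conv)

lemma space_phi_int [simp]: "space (phi_int \<nu> \<sigma> B A) = UNIV"
  by (simp add: phi_int_def space_measure_of_conv)

lemma mat_power_measurable [measurable]:
  "mat_power n \<in> borel_measurable (borel :: (real^'m^'m) measure)"
proof -
  have "continuous_on UNIV (mat_power n :: real^'m^'m \<Rightarrow> _)"
  proof (induction n)
    case 0
    then show ?case by (simp add: mat_power_def)
  next
    case (Suc n)
    have "continuous_on UNIV (\<lambda>A::real^'m^'m. A ** mat_power n A)"
      unfolding matrix_matrix_mult_def by (intro continuous_intros continuous_on_vec_lambda Suc)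
    then show ?case by (simp add: mat_power_def)
  qed
  then show ?thesis by (rule borel_measurable_continuous_onI)
qed

lemma mat_exp_measurable [measurable]:
  "mat_exp \<in> borel_measurable (borel :: (real^'m^'m) measure)"
  unfolding mat_exp_def by measurable

lemma op_powr_measurable [measurable]:
  assumes [measurable]: "f \<in> borel_measurable N" "D \<in> borel_measurable N"
  shows "(\<lambda>x. op_powr (f x) (D x)) \<in> borel_measurable N"
  unfolding op_powr_def by measurable

lemma matrix_vector_mult_measurable [measurable (raw)]:
  fixes D :: "'a \<Rightarrow> real^'n^'m"
  assumes [measurable]: "D \<in> borel_measurable N" "x \<in> borel_measurable N"
  shows "(\<lambda>w. D w *v x w) \<in> borel_measurable N"
proof -
  have "continuous_on UNIV (\<lambda>p::(real^'n^'m) \<times> (real^'n). fst p *v snd p)"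
    unfolding matrix_vector_mult_def by (intro continuous_intros continuous_on_vec_lambda)
  then have [measurable]: "(\<lambda>p::(real^'n^'m) \<times> (real^'n). fst p *v snd p) \<in> borel_measurable borel"
    by (rule borel_measurable_continuous_onI)
  have "(\<lambda>w. (D w, x w)) \<in> N \<rightarrow>\<^sub>M borel" by measurable
  from measurable_compose[OF this \<open>_ \<in> borel_measurable borel\<close>] show ?thesis by simp
qed

lemma emeasure_phi:
  fixes \<sigma> :: "(real^'m) measure"
  assumes "finite_measure \<sigma>" and \<sigma>: "sets \<sigma> = sets (restrict_space borel (sphere 0 1))"
    and C: "C \<in> sets borel"
  shows "emeasure (phi \<sigma> B s) C =
    (\<integral>\<^sup>+r\<in>{0<..}. (\<integral>\<^sup>+\<theta>. indicator C (op_powr r (B s) *v \<theta>) * ennreal (1 / r\<^sup>2) \<partial>\<sigma>) \<partial>lborel)"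
proof -
  interpret finite_measure \<sigma> by fact
  have [measurable]: "(\<lambda>x. x) \<in> borel_measurable \<sigma>"
    unfolding measurable_cong_sets[OF \<sigma> refl] by (rule measurable_restrict_space1) simp
  let ?k = "\<lambda>C r. \<integral>\<^sup>+\<theta>. indicator C (op_powr r (B s) *v \<theta>) * ennreal (1 / r\<^sup>2) \<partial>\<sigma>"
  have [measurable]: "?k C \<in> borel_measurable borel" if [measurable]: "C \<in> sets borel" for C
    by measurable
  have "countably_additive (sets borel) (\<lambda>C. \<integral>\<^sup>+r\<in>{0<..}. ?k C r \<partial>lborel)"
  proof (rule countably_additiveI)
    fix A :: "nat \<Rightarrow> (real^'m) set"
    assume "range A \<subseteq> sets borel" and d: "disjoint_family A"
    then have [measurable]: "A i \<in> sets borel" for i by auto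
    have "(\<Sum>i. \<integral>\<^sup>+r\<in>{0<..}. ?k (A i) r \<partial>lborel) =
        (\<integral>\<^sup>+r. (\<Sum>i. ?k (A i) r * indicator {0<..} r) \<partial>lborel)"
      by (rule nn_integral_suminf[symmetric]) measurable
    also have "\<dots> = (\<integral>\<^sup>+r\<in>{0<..}. ?k (\<Union>i. A i) r \<partial>lborel)"
    proof (rule nn_integral_cong)
      fix r :: real
      have "(\<Sum>i. ?k (A i) r) =
          (\<integral>\<^sup>+\<theta>. (\<Sum>i. indicator (A i) (op_powr r (B s) *v \<theta>) * ennreal (1 / r\<^sup>2)) \<partial>\<sigma>)"
        by (rule nn_integral_suminf[symmetric]) measurable
      then show "(\<Sum>i. ?k (A i) r * indicator {0<..} r) = ?k (\<Union>i. A i) r * indicator {0<..} r"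
        by (simp add: suminf_indicator[OF d])
    qed
    finally show "(\<Sum>i. \<integral>\<^sup>+r\<in>{0<..}. ?k (A i) r \<partial>lborel) =
        (\<integral>\<^sup>+r\<in>{0<..}. ?k (\<Union>i. A i) r \<partial>lborel)" .
  qed
  then show ?thesis
    by (intro emeasure_measure_of[OF phi_def]) (use C in \<open>auto simp: positive_def\<close>)
qed

lemma emeasure_phi_measurable:
  fixes \<sigma> :: "(real^'m) measure"
  assumes "finite_measure \<sigma>" and \<sigma>: "sets \<sigma> = sets (restrict_space borel (sphere 0 1))"
    and [measurable]: "B \<in> borel_measurable \<nu>" "C \<in> sets borel"
  shows "(\<lambda>s. emeasure (phi \<sigma> B s) C) \<in> borel_measurable \<nu>"
proof -
  interpret finite_measure \<sigma> by fact
  have [measurable]: "(\<lambda>x. x) \<in> borel_measurable \<sigma>"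
    unfolding measurable_cong_sets[OF \<sigma> refl] by (rule measurable_restrict_space1) simp
  show ?thesis
    unfolding emeasure_phi[OF assms(1,2,4)] by measurable
qed

lemma emeasure_phi_int:
  fixes \<sigma> :: "(real^'m) measure"
  assumes \<sigma>: "finite_measure \<sigma>" "sets \<sigma> = sets (restrict_space borel (sphere 0 1))"
    and B: "B \<in> borel_measurable \<nu>" and [measurable]: "A \<in> sets \<nu>" and C: "C \<in> sets borel"
  shows "emeasure (phi_int \<nu> \<sigma> B A) C = (\<integral>\<^sup>+s\<in>A. emeasure (phi \<sigma> B s) C \<partial>\<nu>)"
proof -
  note [measurable] = emeasure_phi_measurable[OF \<sigma> B]
  have "countably_additive (sets borel) (\<lambda>C. \<integral>\<^sup>+s\<in>A. emeasure (phi \<sigma> B s) C \<partial>\<nu>)"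
  proof (rule countably_additiveI)
    fix X :: "nat \<Rightarrow> (real^'m) set"
    assume X: "range X \<subseteq> sets borel" and d: "disjoint_family X"
    then have [measurable]: "X i \<in> sets borel" for i by auto
    have "(\<Sum>i. \<integral>\<^sup>+s\<in>A. emeasure (phi \<sigma> B s) (X i) \<partial>\<nu>) =
        (\<integral>\<^sup>+s. (\<Sum>i. emeasure (phi \<sigma> B s) (X i) * indicator A s) \<partial>\<nu>)"
      by (rule nn_integral_suminf[symmetric]) measurable
    also have "\<dots> = (\<integral>\<^sup>+s\<in>A. emeasure (phi \<sigma> B s) (\<Union>i. X i) \<partial>\<nu>)"
      using X d by (intro nn_integral_cong) (simp add: suminf_emeasure)
    finally show "(\<Sum>i. \<integral>\<^sup>+s\<in>A. emeasure (phi \<sigma> B s) (X i) \<partial>\<nu>) =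
        (\<integral>\<^sup>+s\<in>A. emeasure (phi \<sigma> B s) (\<Union>i. X i) \<partial>\<nu>)" .
  qed
  then show ?thesis
    by (intro emeasure_measure_of[OF phi_int_def]) (use C in \<open>auto simp: positive_def\<close>)
qed

end

theory Submission
  imports Defs
begin

text \<open>
In polar coordinates the measure \<open>\<phi>\<^sub>A\<close> is the image of the \<open>\<sigma>\<close>-finite intensity
\<open>\<nu>(ds) r\<^sup>-\<^sup>2 dr \<sigma>(d\<theta>)\<close>, restricted to \<open>s \<in> A\<close>, under the jump map \<open>(s, r, \<theta>) \<mapsto> r\<^bsup>B(s)\<^esup>\<theta>\<close>
(\<open>phi_int_eq\<close>). Scatter points by a Poisson process with this intensity, give every point an
independent fair sign, and let \<open>M(A)\<close> be the signed sum of the jumps of the points with \<open>s \<in> A\<close>.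
Disjoint sets see disjoint sets of points, so the \<open>M(A)\<close> are additive and independent, and
Campbell's formula gives \<open>E exp(i\<langle>M(A), u\<rangle>) = exp(\<integral>(cos\<langle>x, u\<rangle> - 1) d\<phi>\<^sub>A)\<close>. Since the Levy
measure is symmetric, the signs do not alter the law; they make all exponents real and replace the
compensation of small jumps.

The small jumps are in general not absolutely summable, so the signed sum has to be given a meaning.
The intensity is cut into pieces of finite mass, each carrying a finite compound Poisson sum
(\<open>finite_poisson_functional\<close>), and these independent sums are added up. They converge almost surely
for every integrand \<open>h\<close> with \<open>\<integral>min(1, h\<^sup>2) < \<infinity>\<close> (\<open>symmetric_poisson_exists\<close>): the characteristic
function bounds the tail probabilities (\<open>prob_gt_le_of_char\<close>), and Ottaviani's inequality upgrades
convergence in probability to almost sure convergence (\<open>indep_series_summable\<close>). The same two facts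
give the countable additivity (\<open>M_countably_additive\<close>).

The integrability condition is where \<open>1/2 < inf \<lambda>(s)\<close> enters: by the spectral theorem
\<open>norm (r\<^bsup>B(s)\<^esup>\<theta>) \<le> r\<^sup>a\<close> for \<open>r \<le> 1\<close> with a fixed \<open>a > 1/2\<close> (\<open>op_powr_norm_le\<close>), and
\<open>\<integral>\<^sub>0\<^sup>1 r\<^bsup>2a - 2\<^esup> dr\<close> is finite.

Independence and uniqueness are read off characteristic functions; the uniqueness theorem in several
dimensions is reduced to the one on the real line by replacing one coordinate at a time by an
indicator (\<open>joint_char_determines\<close>). Infinite divisibility holds because dividing the intensity by
\<open>n\<close> divides the exponent by \<open>n\<close> (\<open>poisson_law_infinitely_divisible\<close>).
\<close>

section \<open>Characteristic functions determine joint laws\<close>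

lemma (in finite_measure) integrable_iexp_weight:
  fixes f g :: "'a \<Rightarrow> real"
  assumes [measurable]: "f \<in> borel_measurable M" "g \<in> borel_measurable M"
    and b: "\<And>x. \<bar>g x\<bar> \<le> K"
  shows "integrable M (\<lambda>x. g x * iexp (f x))"
  by (rule integrable_const_bound[of _ K]) (use b in \<open>auto simp: norm_mult\<close>)

text \<open>Levy's uniqueness theorem for the laws of \<open>Y\<close> and \<open>Y'\<close> under the probabilities with densities
proportional to \<open>W\<close> and \<open>W'\<close>. The value at \<open>t = 0\<close> shows that both have the same normalising
constant; if it vanishes both sides are zero.\<close>

lemma weighted_char_determines:
  fixes Y :: "'a \<Rightarrow> real" and Y' :: "'b \<Rightarrow> real" and W :: "'a \<Rightarrow> real" and W' :: "'b \<Rightarrow> real"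
  assumes P: "finite_measure P" and Q: "finite_measure Q"
    and Y[measurable]: "Y \<in> borel_measurable P" and Y'[measurable]: "Y' \<in> borel_measurable Q"
    and [measurable]: "W \<in> borel_measurable P" "W' \<in> borel_measurable Q"
    and W: "\<And>x. 0 \<le> W x" "\<And>x. W x \<le> K" and W': "\<And>x. 0 \<le> W' x" "\<And>x. W' x \<le> K"
    and eq: "\<And>t. (CLINT x|P. W x * iexp (t * Y x)) = (CLINT x|Q. W' x * iexp (t * Y' x))"
    and A[measurable]: "A \<in> sets borel"
  shows "(LINT x|P. W x * indicator A (Y x)) = (LINT x|Q. W' x * indicator A (Y' x))"
proof -
  interpret P: finite_measure P by fact
  interpret Q: finite_measure Q by fact
  have iW: "integrable P W"
    by (rule P.integrable_const_bound[of _ K]) (use W in auto)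
  have iW': "integrable Q W'"
    by (rule Q.integrable_const_bound[of _ K]) (use W' in auto)
  define c where "c = (LINT x|P. W x)"
  have c': "c = (LINT x|Q. W' x)"
  proof -
    have "complex_of_real (LINT x|P. W x) = complex_of_real (LINT x|Q. W' x)"
      using eq[of 0] by simp
    then show ?thesis unfolding c_def using of_real_eq_iff by blast
  qed
  have c0: "0 \<le> c" unfolding c_def using W by (intro integral_nonneg_AE) auto
  show ?thesis
  proof (cases "c = 0")
    case True
    have "AE x in P. W x = 0"
      using integral_nonneg_eq_0_iff_AE[OF iW] W True c_def by auto
    then have "(LINT x|P. W x * indicator A (Y x)) = (LINT x|P. 0)"
      by (intro integral_cong_AE) auto
    moreover have "AE x in Q. W' x = 0"
      using integral_nonneg_eq_0_iff_AE[OF iW'] W' True c' by auto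
    then have "(LINT x|Q. W' x * indicator A (Y' x)) = (LINT x|Q. 0)"
      by (intro integral_cong_AE) auto
    ultimately show ?thesis by simp
  next
    case False
    with c0 have c: "0 < c" by simp
    define D where "D = distr (density P (\<lambda>x. ennreal (W x / c))) borel Y"
    define D' where "D' = distr (density Q (\<lambda>x. ennreal (W' x / c))) borel Y'"
    have "emeasure (density P (\<lambda>x. ennreal (W x / c))) (space P) = 1"
      using iW W c by (subst emeasure_density)
        (auto simp: nn_integral_eq_integral c_def cong: nn_integral_cong_simp)
    then have "prob_space D"
      unfolding D_def by (intro prob_space.prob_space_distr prob_spaceI) auto
    then have D: "real_distribution D"
      by (auto simp: real_distribution_def real_distribution_axioms_def D_def)
    have "emeasure (density Q (\<lambda>x. ennreal (W' x / c))) (space Q) = 1"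
      using iW' W' c by (subst emeasure_density)
        (auto simp: nn_integral_eq_integral c' cong: nn_integral_cong_simp)
    then have "prob_space D'"
      unfolding D'_def by (intro prob_space.prob_space_distr prob_spaceI) auto
    then have D': "real_distribution D'"
      by (auto simp: real_distribution_def real_distribution_axioms_def D'_def)
    have "char D t = char D' t" for t
    proof -
      have "char D t = (CLINT x|P. (W x / c) *\<^sub>R iexp (t * Y x))"
        unfolding char_def D_def using W c
        by (simp add: integral_distr integral_density)
      also have "\<dots> = (CLINT x|P. complex_of_real (1/c) * (W x * iexp (t * Y x)))"
        by (intro Bochner_Integration.integral_cong) (auto simp: scaleR_conv_of_real)
      also have "\<dots> = (CLINT x|Q. complex_of_real (1/c) * (W' x * iexp (t * Y' x)))"
        using eq[of t] by (simp add: integral_mult_right_zero)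
      also have "\<dots> = (CLINT x|Q. (W' x / c) *\<^sub>R iexp (t * Y' x))"
        by (intro Bochner_Integration.integral_cong) (auto simp: scaleR_conv_of_real)
      also have "\<dots> = char D' t"
        unfolding char_def D'_def using W' c
        by (simp add: integral_distr integral_density)
      finally show ?thesis .
    qed
    then have "D = D'" by (intro Levy_uniqueness D D' ext)
    then have "(LINT y|D. indicator A y) = (LINT y|D'. indicator A y :: real)" by simp
    moreover have "(LINT y|D. indicator A y) = (LINT x|P. (1/c) * (W x * indicator A (Y x)))"
      unfolding D_def using W c by (subst integral_distr, simp, simp, subst integral_real_density) (simp_all add: field_simps)
    moreover have "(LINT y|D'. indicator A y) = (LINT x|Q. (1/c) * (W' x * indicator A (Y' x)))"
      unfolding D'_def using W' c by (subst integral_distr, simp, simp, subst integral_real_density) (simp_all add: field_simps)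
    ultimately show ?thesis using c by simp
  qed
qed

lemma integral_lincomb3:
  fixes f1 f2 f3 :: "'c \<Rightarrow> complex"
  assumes "integrable M f1" "integrable M f2" "integrable M f3"
  shows "(CLINT x|M. f1 x + a * f2 x + b * f3 x) =
    (CLINT x|M. f1 x) + a * (CLINT x|M. f2 x) + b * (CLINT x|M. f3 x)"
  using assms by simp

text \<open>By induction on the set \<open>K\<close> of coordinates that already carry indicators instead of exponentials.
To treat one more coordinate \<open>Y\<^sub>k\<close>, write \<open>G\<close> for the product of indicators and \<open>S\<close> for the phase
of the remaining coordinates. The weight \<open>G exp(i S)\<close> is complex, but it is a combination of the
nonnegative weights \<open>G (1 + cos S)\<close>, \<open>G (1 + sin S)\<close> and \<open>G\<close>, to each of which the one-dimensional
theorem applies.\<close>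

lemma joint_char_determines:
  fixes Y :: "'i \<Rightarrow> 'a \<Rightarrow> real" and Y' :: "'i \<Rightarrow> 'b \<Rightarrow> real"
  assumes P: "finite_measure P" and Q: "finite_measure Q" and J: "finite J"
    and Y: "\<And>j. j \<in> J \<Longrightarrow> Y j \<in> borel_measurable P"
    and Y': "\<And>j. j \<in> J \<Longrightarrow> Y' j \<in> borel_measurable Q"
    and eq: "\<And>c. (CLINT x|P. iexp (\<Sum>j\<in>J. c j * Y j x)) = (CLINT x|Q. iexp (\<Sum>j\<in>J. c j * Y' j x))"
    and A: "\<And>j. j \<in> J \<Longrightarrow> A j \<in> sets borel"
  shows "measure P {x \<in> space P. \<forall>j\<in>J. Y j x \<in> A j} = measure Q {x \<in> space Q. \<forall>j\<in>J. Y' j x \<in> A j}"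
proof -
  interpret P: finite_measure P by fact
  interpret Q: finite_measure Q by fact
  define G where "G K x = (\<Prod>k\<in>K. indicator (A k) (Y k x) :: real)" for K x
  define G' where "G' K x = (\<Prod>k\<in>K. indicator (A k) (Y' k x) :: real)" for K x
  define S where "S K c x = (\<Sum>j\<in>J-K. c j * Y j x)" for K c x
  define S' where "S' K c x = (\<Sum>j\<in>J-K. c j * Y' j x)" for K c x
  have Gb: "0 \<le> G K x" "G K x \<le> 1" for K x
    by (auto simp: G_def intro!: prod_nonneg prod_le_1)
  have G'b: "0 \<le> G' K x" "G' K x \<le> 1" for K x
    by (auto simp: G'_def intro!: prod_nonneg prod_le_1)
  have Gm: "G K \<in> borel_measurable P" and G'm: "G' K \<in> borel_measurable Q"
    if "K \<subseteq> J" for K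
  proof -
    have "(\<lambda>x. indicator (A k) (Y k x) :: real) \<in> borel_measurable P"
      "(\<lambda>x. indicator (A k) (Y' k x) :: real) \<in> borel_measurable Q" if "k \<in> J" for k
    proof -
      note [measurable] = A[OF that] Y[OF that] Y'[OF that]
      show "(\<lambda>x. indicator (A k) (Y k x) :: real) \<in> borel_measurable P"
        "(\<lambda>x. indicator (A k) (Y' k x) :: real) \<in> borel_measurable Q" by measurable
    qed
    with that show "G K \<in> borel_measurable P" "G' K \<in> borel_measurable Q"
      unfolding G_def[abs_def] G'_def[abs_def] by (auto intro!: borel_measurable_prod)
  qed
  have Sm: "S K c \<in> borel_measurable P" and S'm: "S' K c \<in> borel_measurable Q" for K c
    unfolding S_def S'_def using Y Y' by auto
  have "(CLINT x|P. G K x * iexp (S K c x)) = (CLINT x|Q. G' K x * iexp (S' K c x))"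
    if "K \<subseteq> J" for K c
    using finite_subset[OF that J] that
  proof (induction K arbitrary: c rule: finite_induct)
    case empty
    then show ?case using eq[of c] by (simp add: G_def G'_def S_def S'_def)
  next
    case (insert k K)
    note [measurable] = Gm[of K] G'm[of K] Sm S'm Y[of k] Y'[of k] A[of k]
    have k: "k \<in> J" "k \<notin> K" "K \<subseteq> J" using insert by auto
    let ?s = "S (insert k K) c" and ?s' = "S' (insert k K) c"
    have JK: "J - K = insert k (J - insert k K)" using k by auto
    have neg: "S (insert k K) (\<lambda>j. - c j) x = - ?s x" "S' (insert k K) (\<lambda>j. - c j) y = - ?s' y" for x y
      by (simp_all add: S_def S'_def sum_negf)
    have step: "S K (c(k := t)) x = t * Y k x + S (insert k K) c x"
         "S' K (c(k := t)) y = t * Y' k y + S' (insert k K) c y" for c t x y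
      unfolding S_def S'_def JK using J k(2) by (auto intro!: sum.cong)
    have base: "(CLINT x|P. G K x * iexp (t * Y k x + S (insert k K) d x)) =
        (CLINT x|Q. G' K x * iexp (t * Y' k x + S' (insert k K) d x))" for t d
      using insert.IH[OF k(3), of "d(k := t)"] by (simp only: step)
    have b0: "(CLINT x|P. G K x * iexp (t * Y k x)) = (CLINT x|Q. G' K x * iexp (t * Y' k x))" for t
      using base[of t "\<lambda>_. 0"] by (simp add: S_def S'_def)
    note bp = base[of _ c]
    have bm: "(CLINT x|P. G K x * iexp (t * Y k x - ?s x)) =
        (CLINT x|Q. G' K x * iexp (t * Y' k x - ?s' x))" for t
      using base[of t "\<lambda>j. - c j"] by (simp only: neg diff_conv_add_uminus)
    have int: "integrable P (\<lambda>x. G K x * iexp (f x))" if "f \<in> borel_measurable P" for f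
      using that k by (intro P.integrable_iexp_weight[of _ _ 1]) (use Gb in auto)
    have int': "integrable Q (\<lambda>x. G' K x * iexp (f x))" if "f \<in> borel_measurable Q" for f
      using that k by (intro Q.integrable_iexp_weight[of _ _ 1]) (use G'b in auto)
    have mi: "integrable P (\<lambda>x. G K x * iexp (t * Y k x))" "integrable P (\<lambda>x. G K x * iexp (t * Y k x + ?s x))"
      "integrable P (\<lambda>x. G K x * iexp (t * Y k x - ?s x))" "integrable Q (\<lambda>x. G' K x * iexp (t * Y' k x))"
      "integrable Q (\<lambda>x. G' K x * iexp (t * Y' k x + ?s' x))" "integrable Q (\<lambda>x. G' K x * iexp (t * Y' k x - ?s' x))" for t
      by (use k in \<open>intro int int'; measurable\<close>)+
    \<comment> \<open>The weighted exponentials are combinations of those with phases \<open>y\<close> and \<open>y \<plusminus> s\<close>, which agree by induction.\<close>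
    have ecos: "complex_of_real (g * (1 + cos s)) * iexp y =
        g * iexp y + (1/2) * (g * iexp (y + s)) + (1/2) * (g * iexp (y - s))" for g s y :: real
      by (simp add: exp_of_real cos_exp_eq exp_add exp_diff exp_minus field_simps flip: cos_of_real)
    have esin: "complex_of_real (g * (1 + sin s)) * iexp y =
        g * iexp y + (-\<i>/2) * (g * iexp (y + s)) + (\<i>/2) * (g * iexp (y - s))" for g s y :: real
      by (simp add: exp_of_real sin_exp_eq exp_add exp_diff exp_minus field_simps flip: sin_of_real)
    have bnd0: "0 \<le> g * (1 + h)" "g * (1 + h) \<le> 2" if "0 \<le> g" "g \<le> 1" "- 1 \<le> h" "h \<le> 1" for g h :: real
      using that mult_mono[of g 1 "1 + h" 2] by auto
    have bnd: "0 \<le> G K x * (1 + cos a)" "G K x * (1 + cos a) \<le> 2" "0 \<le> G K x * (1 + sin a)" "G K x * (1 + sin a) \<le> 2"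
      "0 \<le> G' K y * (1 + cos a)" "G' K y * (1 + cos a) \<le> 2" "0 \<le> G' K y * (1 + sin a)" "G' K y * (1 + sin a) \<le> 2"
      for x y a
      using Gb[of K] G'b[of K] by (auto intro!: bnd0)
    have I0: "(LINT x|P. G K x * indicator (A k) (Y k x)) = (LINT x|Q. G' K x * indicator (A k) (Y' k x))"
      by (rule weighted_char_determines[OF P Q _ _ _ _ Gb G'b b0]) (use k in measurable)
    have Ic: "(LINT x|P. (G K x * (1 + cos (?s x))) * indicator (A k) (Y k x)) =
        (LINT x|Q. (G' K x * (1 + cos (?s' x))) * indicator (A k) (Y' k x))"
    proof (rule weighted_char_determines[OF P Q])
      show "(CLINT x|P. complex_of_real (G K x * (1 + cos (?s x))) * iexp (t * Y k x)) =
         (CLINT x|Q. complex_of_real (G' K x * (1 + cos (?s' x))) * iexp (t * Y' k x))" for t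
        unfolding ecos by (simp only: integral_lincomb3[OF mi(1-3)] integral_lincomb3[OF mi(4-6)] b0 bp bm)
    qed (use k bnd in measurable)
    have Is: "(LINT x|P. (G K x * (1 + sin (?s x))) * indicator (A k) (Y k x)) =
        (LINT x|Q. (G' K x * (1 + sin (?s' x))) * indicator (A k) (Y' k x))"
    proof (rule weighted_char_determines[OF P Q])
      show "(CLINT x|P. complex_of_real (G K x * (1 + sin (?s x))) * iexp (t * Y k x)) =
         (CLINT x|Q. complex_of_real (G' K x * (1 + sin (?s' x))) * iexp (t * Y' k x))" for t
        unfolding esin by (simp only: integral_lincomb3[OF mi(1-3)] integral_lincomb3[OF mi(4-6)] b0 bp bm)
    qed (use k bnd in measurable)
    let ?D = "\<lambda>g a s. complex_of_real ((g * (1 + cos s)) * a) + \<i> * complex_of_real ((g * (1 + sin s)) * a)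
          - (1 + \<i>) * complex_of_real (g * a)"
    have split: "complex_of_real (a * g) * iexp s = ?D g a s" for a g s :: real
      by (simp add: exp_Euler algebra_simps flip: cos_of_real sin_of_real)
    have i1: "integrable P (\<lambda>x. complex_of_real ((G K x * f x) * indicator (A k) (Y k x)))"
      if [measurable]: "f \<in> borel_measurable P" and "\<And>x. \<bar>G K x * f x\<bar> \<le> 2" for f
      using k that by (intro P.integrable_const_bound[of _ 2]) (auto simp: indicator_def norm_mult abs_mult)
    have i2: "integrable Q (\<lambda>x. complex_of_real ((G' K x * f x) * indicator (A k) (Y' k x)))"
      if [measurable]: "f \<in> borel_measurable Q" and "\<And>x. \<bar>G' K x * f x\<bar> \<le> 2" for f
      using k that by (intro Q.integrable_const_bound[of _ 2]) (auto simp: indicator_def norm_mult abs_mult)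
    have "(CLINT x|P. G (insert k K) x * iexp (?s x)) = (CLINT x|P. ?D (G K x) (indicator (A k) (Y k x)) (?s x))"
      unfolding G_def using k insert.hyps by (simp only: prod.insert split[symmetric]) 
    also have "\<dots> = complex_of_real (LINT x|P. (G K x * (1 + cos (?s x))) * indicator (A k) (Y k x))
        + \<i> * complex_of_real (LINT x|P. (G K x * (1 + sin (?s x))) * indicator (A k) (Y k x))
        - (1 + \<i>) * complex_of_real (LINT x|P. G K x * indicator (A k) (Y k x))"
      using i1[of "\<lambda>x. 1 + cos (?s x)"] i1[of "\<lambda>x. 1 + sin (?s x)"] i1[of "\<lambda>x. 1"] bnd
        order_trans[OF Gb(2), of 2] Gb(1)
      by (simp only: integral_complex_of_real[symmetric] Bochner_Integration.integral_add Bochner_Integration.integral_diff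
         integral_mult_right_zero[symmetric] integrable_mult_right Bochner_Integration.integrable_add) simp
    also have "\<dots> = complex_of_real (LINT x|Q. (G' K x * (1 + cos (?s' x))) * indicator (A k) (Y' k x))
        + \<i> * complex_of_real (LINT x|Q. (G' K x * (1 + sin (?s' x))) * indicator (A k) (Y' k x))
        - (1 + \<i>) * complex_of_real (LINT x|Q. G' K x * indicator (A k) (Y' k x))"
      by (simp only: I0 Ic Is)
    also have "\<dots> = (CLINT x|Q. ?D (G' K x) (indicator (A k) (Y' k x)) (?s' x))"
      using i2[of "\<lambda>x. 1 + cos (?s' x)"] i2[of "\<lambda>x. 1 + sin (?s' x)"] i2[of "\<lambda>x. 1"] bnd
        order_trans[OF G'b(2), of 2] G'b(1)
      by (simp only: integral_complex_of_real[symmetric] Bochner_Integration.integral_add Bochner_Integration.integral_diff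
         integral_mult_right_zero[symmetric] integrable_mult_right Bochner_Integration.integrable_add) simp
    also have "\<dots> = (CLINT x|Q. G' (insert k K) x * iexp (?s' x))"
      unfolding G'_def using k insert.hyps by (simp only: prod.insert split[symmetric]) 
    finally show ?case .
  qed
  from this[of J "\<lambda>_. 0"] have "(LINT x|P. G J x) = (LINT x|Q. G' J x)"
    by (simp add: S_def S'_def) 
  moreover have "(LINT x|P. G J x) = measure P {x \<in> space P. \<forall>j\<in>J. Y j x \<in> A j}"
  proof -
    have "(LINT x|P. G J x) = (LINT x|P. indicator {x \<in> space P. \<forall>j\<in>J. Y j x \<in> A j} x)"
      using J by (intro Bochner_Integration.integral_cong) (auto simp: G_def indicator_def prod_zero_iff)
    then show ?thesis by (simp add: Int_def conj_commute)
  qed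
  moreover have "(LINT x|Q. G' J x) = measure Q {x \<in> space Q. \<forall>j\<in>J. Y' j x \<in> A j}"
  proof -
    have "(LINT x|Q. G' J x) = (LINT x|Q. indicator {x \<in> space Q. \<forall>j\<in>J. Y' j x \<in> A j} x)"
      using J by (intro Bochner_Integration.integral_cong) (auto simp: G'_def indicator_def prod_zero_iff)
    then show ?thesis by (simp add: Int_def conj_commute)
  qed
  ultimately show ?thesis by simp
qed

text \<open>An intersection-stable generator of the Borel sets that contains the whole space and whose members
are exactly the events compared in the previous lemma.\<close>

definition cylinders :: "'b::euclidean_space set set" where
  "cylinders = {{x. \<forall>b\<in>Basis. x \<bullet> b \<in> A b} | A. \<forall>b\<in>Basis. A b \<in> sets (borel :: real measure)}"

lemma Int_stable_cylinders: "Int_stable (cylinders :: 'b::euclidean_space set set)"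
proof (rule Int_stableI)
  fix X Y :: "'b set" assume "X \<in> cylinders" "Y \<in> cylinders"
  then obtain A A' :: "'b \<Rightarrow> real set" where A: "X = {x. \<forall>b\<in>Basis. x \<bullet> b \<in> A b}" "\<forall>b\<in>Basis. A b \<in> sets borel"
     and A': "Y = {x. \<forall>b\<in>Basis. x \<bullet> b \<in> A' b}" "\<forall>b\<in>Basis. A' b \<in> sets borel"
    unfolding cylinders_def by auto
  then show "X \<inter> Y \<in> cylinders"
    unfolding cylinders_def by (intro CollectI exI[of _ "\<lambda>b. A b \<inter> A' b"]) auto
qed

lemma cylinders_sub_borel: "cylinders \<subseteq> (sets borel :: 'b::euclidean_space set set)"
proof
  fix X :: "'b set" assume "X \<in> cylinders"
  then obtain A :: "'b \<Rightarrow> real set" where A: "X = {x. \<forall>b\<in>Basis. x \<bullet> b \<in> A b}" "\<forall>b\<in>Basis. A b \<in> sets borel"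
    unfolding cylinders_def by auto
  have "X = (\<Inter>b\<in>Basis. (\<lambda>x. x \<bullet> b) -` A b \<inter> space borel)" using A by auto
  also have "\<dots> \<in> sets borel"
  proof (intro sets.finite_INT)
    fix b :: 'b assume "b \<in> Basis"
    then have [measurable]: "A b \<in> sets borel" using A(2) by auto
    show "(\<lambda>x. x \<bullet> b) -` A b \<inter> space borel \<in> sets borel" by measurable
  qed auto
  finally show "X \<in> sets borel" .
qed

lemma sigma_cylinders: "sigma_sets UNIV (cylinders :: 'b::euclidean_space set set) = sets borel"
proof
  show "sigma_sets UNIV (cylinders :: 'b set set) \<subseteq> sets borel"
    using sets.sigma_sets_subset[OF cylinders_sub_borel[where 'b='b]] by simp
  have "sets (borel :: 'b measure) = sigma_sets UNIV (range (\<lambda>(a, b). box a b))"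
    unfolding borel_eq_box by (simp add: sets_measure_of)
  also have "\<dots> \<subseteq> sigma_sets UNIV cylinders"
  proof (rule sigma_sets_mono', safe)
    fix a b :: 'b
    show "box a b \<in> cylinders"
      unfolding cylinders_def
      by (intro CollectI exI[of _ "\<lambda>i. {a \<bullet> i <..< b \<bullet> i}"]) (auto simp: box_def)
  qed
  finally show "sets borel \<subseteq> sigma_sets UNIV (cylinders :: 'b set set)" .
qed

lemma char_fun_determines:
  fixes \<mu> \<mu>' :: "'b::euclidean_space measure"
  assumes \<mu>: "prob_space \<mu>" "sets \<mu> = sets borel" and \<mu>': "prob_space \<mu>'" "sets \<mu>' = sets borel"
    and eq: "\<And>u. char_fun \<mu> u = char_fun \<mu>' u"
  shows "\<mu> = \<mu>'"
proof -
  interpret \<mu>: prob_space \<mu> by fact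
  interpret \<mu>': prob_space \<mu>' by fact
  note [measurable_cong] = \<mu>(2) \<mu>'(2)
  have sp: "space \<mu> = UNIV" "space \<mu>' = UNIV" using \<mu>(2) \<mu>'(2) by (auto dest: sets_eq_imp_space_eq)
  show ?thesis
  proof (rule measure_eqI_generator_eq[where A="\<lambda>_. UNIV" and \<Omega>=UNIV, OF Int_stable_cylinders])
    fix X :: "'b set" assume "X \<in> cylinders"
    then obtain A where A: "X = {x. \<forall>b\<in>Basis. x \<bullet> b \<in> A b}" "\<forall>b\<in>Basis. A b \<in> sets borel"
      unfolding cylinders_def by auto
    have s: "(\<Sum>j\<in>Basis. c j * (x \<bullet> j)) = x \<bullet> (\<Sum>j\<in>Basis. c j *\<^sub>R j)" for c and x :: 'b
      by (simp add: inner_sum_right)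
    have "measure \<mu> {x \<in> space \<mu>. \<forall>j\<in>Basis. x \<bullet> j \<in> A j} = measure \<mu>' {x \<in> space \<mu>'. \<forall>j\<in>Basis. x \<bullet> j \<in> A j}"
      by (rule joint_char_determines) (use A eq \<mu>.finite_measure_axioms \<mu>'.finite_measure_axioms in \<open>auto simp: s char_fun_def\<close>)
    then show "emeasure \<mu> X = emeasure \<mu>' X"
      by (simp add: \<mu>.emeasure_eq_measure \<mu>'.emeasure_eq_measure A sp)
  next
    show "range (\<lambda>_. UNIV) \<subseteq> (cylinders :: 'b set set)"
      unfolding cylinders_def by (auto intro!: exI[of _ "\<lambda>_. UNIV"])
  qed (use \<mu> \<mu>' in \<open>auto simp: sigma_cylinders\<close>)
qed

text \<open>The joint law is compared with the product of the marginals, whose characteristic function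
factorises; by the preceding lemmas both agree on products of cylinders.\<close>

lemma (in prob_space) indep_vars_of_joint_char:
  fixes V :: "'i \<Rightarrow> 'a \<Rightarrow> 'b::euclidean_space"
  assumes V: "\<And>i. i \<in> I \<Longrightarrow> V i \<in> borel_measurable M"
    and eq: "\<And>J u. J \<subseteq> I \<Longrightarrow> finite J \<Longrightarrow>
      (CLINT x|M. iexp (\<Sum>i\<in>J. V i x \<bullet> u i)) = (\<Prod>i\<in>J. CLINT x|M. iexp (V i x \<bullet> u i))"
  shows "indep_vars (\<lambda>_. borel) V I"
proof -
  let ?F = "\<lambda>i. {V i -` A \<inter> space M | A. A \<in> cylinders}"
  have "indep_sets ?F I"
    unfolding indep_sets_def
  proof (intro conjI ballI allI impI)
    fix i assume "i \<in> I"
    then show "?F i \<subseteq> events" using cylinders_sub_borel by (auto intro!: measurable_sets[OF V])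
  next
    fix J X assume J: "J \<subseteq> I" "J \<noteq> {}" "finite J" and X: "X \<in> Pi J ?F"
    have "\<forall>j\<in>J. \<exists>A. (\<forall>b\<in>Basis. A b \<in> sets borel) \<and> X j = V j -` {x. \<forall>b\<in>Basis. x \<bullet> b \<in> A b} \<inter> space M"
      using X unfolding Pi_def cylinders_def by blast
    from bchoice[OF this] obtain A where "\<forall>j\<in>J. (\<forall>b\<in>Basis. A j b \<in> sets borel) \<and>
        X j = V j -` {x. \<forall>b\<in>Basis. x \<bullet> b \<in> A j b} \<inter> space M" ..
    then have A: "\<And>j b. j \<in> J \<Longrightarrow> b \<in> Basis \<Longrightarrow> A j b \<in> sets borel"
      and XA: "\<And>j. j \<in> J \<Longrightarrow> X j = V j -` {x. \<forall>b\<in>Basis. x \<bullet> b \<in> A j b} \<inter> space M"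
      by blast+
    have cyl: "{x. \<forall>b\<in>Basis. x \<bullet> b \<in> A j b} \<in> sets borel" if "j \<in> J" for j
      by (rule subsetD[OF cylinders_sub_borel], unfold cylinders_def, intro CollectI exI[of _ "A j"]) (use A that in auto)
    have VJ: "V j \<in> borel_measurable M" if "j \<in> J" for j using V J that by auto
    define N where "N j = (if j \<in> J then distr M borel (V j) else return borel 0)" for j
    have N: "prob_space (N j)" for j
      using VJ by (auto simp: N_def intro!: prob_space_distr prob_space_return)
    have sN[measurable_cong, simp]: "sets (N j) = sets borel" for j by (simp add: N_def)
    have spN[simp]: "space (N j) = UNIV" for j by (simp add: N_def)
    interpret N: product_prob_space N J by (rule product_prob_spaceI) (rule N)
    interpret N: finite_product_prob_space N J by standard fact
    let ?Q = "PiM J N"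
    have pg: "(\<Sum>p\<in>J \<times> Basis. c p * (w (fst p) \<bullet> snd p)) = (\<Sum>j\<in>J. w j \<bullet> (\<Sum>b\<in>Basis. c (j, b) *\<^sub>R b))"
      for c and w :: "'i \<Rightarrow> 'b"
      by (simp add: sum.cartesian_product' inner_sum_right)
    have "prob {x \<in> space M. \<forall>p\<in>J \<times> Basis. V (fst p) x \<bullet> snd p \<in> A (fst p) (snd p)} =
        measure ?Q {w \<in> space ?Q. \<forall>p\<in>J \<times> Basis. w (fst p) \<bullet> snd p \<in> A (fst p) (snd p)}"
    proof (rule joint_char_determines)
      fix c :: "'i \<times> 'b \<Rightarrow> real"
      define u where "u j = (\<Sum>b\<in>Basis. c (j, b) *\<^sub>R b)" for j
      have ie: "integrable (N j) (\<lambda>x. iexp (x \<bullet> u j))" for j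
        by (rule finite_measure.integrable_const_bound[of _ _ 1])
           (auto simp: prob_space.finite_measure N)
      have "(CLINT w|?Q. iexp (\<Sum>j\<in>J. w j \<bullet> u j)) = (CLINT w|?Q. (\<Prod>j\<in>J. iexp (w j \<bullet> u j)))"
        by (simp add: sum_distrib_left exp_sum J)
      also have "\<dots> = (\<Prod>j\<in>J. CLINT x|N j. iexp (x \<bullet> u j))"
        by (rule N.product_integral_prod) (use J ie in auto)
      also have "\<dots> = (\<Prod>j\<in>J. CLINT x|M. iexp (V j x \<bullet> u j))"
        by (rule prod.cong) (auto simp: N_def integral_distr VJ)
      also have "\<dots> = (CLINT x|M. iexp (\<Sum>i\<in>J. V i x \<bullet> u i))"
        using eq[OF J(1,3)] by simp
      finally show "(CLINT x|M. iexp (\<Sum>p\<in>J \<times> Basis. c p * (V (fst p) x \<bullet> snd p))) =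
        (CLINT w|?Q. iexp (\<Sum>p\<in>J \<times> Basis. c p * (w (fst p) \<bullet> snd p)))"
        unfolding pg pg[of c "\<lambda>j. V j x" for x] u_def[symmetric] by (rule sym)
    qed (use J A VJ N.finite_measure_axioms finite_measure_axioms in auto)
    also have "{w \<in> space ?Q. \<forall>p\<in>J \<times> Basis. w (fst p) \<bullet> snd p \<in> A (fst p) (snd p)} = Pi\<^sub>E J (\<lambda>j. {x. \<forall>b\<in>Basis. x \<bullet> b \<in> A j b})"
      by (auto simp: space_PiM PiE_def Pi_def)
    also have "measure ?Q \<dots> = (\<Prod>j\<in>J. measure (N j) {x. \<forall>b\<in>Basis. x \<bullet> b \<in> A j b})"
      using cyl by (intro N.finite_measure_PiM_emb) simp
    also have "\<dots> = (\<Prod>j\<in>J. prob (X j))"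
    proof (rule prod.cong)
      fix j assume j: "j \<in> J"
      have "{x. \<forall>b\<in>Basis. x \<bullet> b \<in> A j b} \<in> sets borel"
        by (rule cyl) fact
      then show "measure (N j) {x. \<forall>b\<in>Basis. x \<bullet> b \<in> A j b} = prob (X j)"
        using j by (simp add: N_def XA measure_distr VJ)
    qed simp
    also have "{x \<in> space M. \<forall>p\<in>J \<times> Basis. V (fst p) x \<bullet> snd p \<in> A (fst p) (snd p)} = (\<Inter>j\<in>J. X j)"
      using XA J(2) by auto
    finally show "prob (\<Inter>j\<in>J. X j) = (\<Prod>j\<in>J. prob (X j))" .
  qed
  then have *: "indep_sets (\<lambda>i. sigma_sets (space M) (?F i)) I"
  proof (rule indep_sets_sigma)
    fix i
    show "Int_stable (?F i)"
    proof (rule Int_stableI)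
      fix a b assume "a \<in> ?F i" "b \<in> ?F i"
      then obtain A A' where "a = V i -` A \<inter> space M" "b = V i -` A' \<inter> space M" "A \<in> cylinders" "A' \<in> cylinders" by auto
      then show "a \<inter> b \<in> ?F i"
        using Int_stableD[OF Int_stable_cylinders, of A A'] by (intro CollectI exI[of _ "A \<inter> A'"]) auto
    qed
  qed
  have "{V i -` A \<inter> space M | A. A \<in> sets borel} = sigma_sets (space M) (?F i)" for i
    using sigma_sets_vimage_commute[of "V i" "space M" UNIV cylinders]
    unfolding sigma_cylinders by auto
  with * V show ?thesis unfolding indep_vars_def2 by simp
qed

section \<open>Convergence of series of independent random variables\<close>

text \<open>Stop at the first \<open>n\<close> where the partial sum exceeds \<open>2\<epsilon>\<close>. The rest of the sum is independent of
this event and at most \<open>\<epsilon>\<close> with probability at least one half; when it is, the full sum still exceeds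
\<open>\<epsilon>\<close>.\<close>

lemma (in prob_space) ottaviani:
  fixes X :: "nat \<Rightarrow> 'a \<Rightarrow> real"
  assumes ind: "indep_vars (\<lambda>_. borel) X UNIV" and "N \<le> K"
    and half: "\<And>n. n \<in> {N..K} \<Longrightarrow> prob {w \<in> space M. \<bar>\<Sum>k\<in>{n..<K}. X k w\<bar> > \<epsilon>} \<le> 1/2"
  shows "prob {w \<in> space M. \<exists>n\<in>{N..K}. \<bar>\<Sum>k\<in>{N..<n}. X k w\<bar> > 2 * \<epsilon>} \<le>
      2 * prob {w \<in> space M. \<bar>\<Sum>k\<in>{N..<K}. X k w\<bar> > \<epsilon>}"
proof -
  have [measurable]: "X k \<in> borel_measurable M" for k using ind by (auto simp: indep_vars_def)
  define S where "S n w = (\<Sum>k\<in>{N..<n}. X k w)" for n w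
  have [measurable]: "S n \<in> borel_measurable M" for n unfolding S_def[abs_def] by measurable
  define T where "T n = {w \<in> space M. \<bar>S n w\<bar> > 2 * \<epsilon> \<and> (\<forall>j\<in>{N..<n}. \<bar>S j w\<bar> \<le> 2 * \<epsilon>)}" for n
  define R where "R n = {w \<in> space M. \<bar>\<Sum>k\<in>{n..<K}. X k w\<bar> \<le> \<epsilon>}" for n
  have [measurable]: "T n \<in> events" "R n \<in> events" for n unfolding T_def R_def by measurable
  have indTR: "prob (T n \<inter> R n) = prob (T n) * prob (R n)" for n
  proof -
    let ?A = "{N..<n}" and ?B = "{n..<K}"
    let ?s = "\<lambda>j (f::nat \<Rightarrow> real). \<Sum>k\<in>{N..<j}. f k"
    \<comment> \<open>The event is an indicator, hence a measurable function of the variables before \<open>n\<close>.\<close>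
    define Y1 :: "(nat \<Rightarrow> real) \<Rightarrow> real" where
      "Y1 f = indicator {x. \<bar>x\<bar> > 2 * \<epsilon>} (?s n f) * (\<Prod>j\<in>{N..<n}. indicator {x. \<bar>x\<bar> \<le> 2 * \<epsilon>} (?s j f))" for f
    define Y2 :: "(nat \<Rightarrow> real) \<Rightarrow> real" where "Y2 f = \<bar>\<Sum>k\<in>?B. f k\<bar>" for f
    have sm: "?s j \<in> borel_measurable (PiM ?A (\<lambda>_. borel))" if "j \<le> n" for j
      using that by (intro borel_measurable_sum measurable_component_singleton) auto
    have im: "(\<lambda>f. indicator B (?s j f) :: real) \<in> borel_measurable (PiM ?A (\<lambda>_. borel))"
      if "j \<le> n" "B \<in> sets borel" for j and B :: "real set"
      using measurable_compose[OF sm[OF that(1)] borel_measurable_indicator[OF that(2)]] .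
    have m1: "Y1 \<in> borel_measurable (PiM ?A (\<lambda>_. borel))"
      unfolding Y1_def[abs_def] by (intro borel_measurable_times borel_measurable_prod im) auto
    have m2: "Y2 \<in> borel_measurable (PiM ?B (\<lambda>_. borel))"
      unfolding Y2_def[abs_def] by (intro borel_measurable_abs borel_measurable_sum measurable_component_singleton)
    have "indep_var (PiM ?A (\<lambda>_. borel)) (\<lambda>w. restrict (\<lambda>i. X i w) ?A) (PiM ?B (\<lambda>_. borel)) (\<lambda>w. restrict (\<lambda>i. X i w) ?B)"
      by (rule indep_var_restrict[OF ind]) auto
    from indep_var_compose[OF this m1 m2]
    have iv: "indep_var borel (\<lambda>w. Y1 (restrict (\<lambda>i. X i w) ?A)) borel (\<lambda>w. Y2 (restrict (\<lambda>i. X i w) ?B))"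
      by (simp add: comp_def)
    have e1: "Y1 (restrict (\<lambda>i. X i w) ?A) = (if \<bar>S n w\<bar> > 2 * \<epsilon> \<and> (\<forall>j\<in>{N..<n}. \<bar>S j w\<bar> \<le> 2 * \<epsilon>) then 1 else 0)" for w
    proof -
      have "?s j (restrict (\<lambda>i. X i w) ?A) = S j w" if "j \<le> n" for j
        unfolding S_def using that by (intro sum.cong) auto
      then show ?thesis unfolding Y1_def by (auto simp: indicator_def prod_zero_iff)
    qed
    have e2: "Y2 (restrict (\<lambda>i. X i w) ?B) = \<bar>\<Sum>k\<in>?B. X k w\<bar>" for w
      unfolding Y2_def by (intro arg_cong[where f=abs] sum.cong) auto
    have "T n \<inter> R n = {w \<in> space M. Y1 (restrict (\<lambda>i. X i w) ?A) \<in> {1} \<and> Y2 (restrict (\<lambda>i. X i w) ?B) \<in> {..\<epsilon>}}"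
      by (auto simp: T_def R_def e1 e2 split: if_splits)
    moreover have "T n = {w \<in> space M. Y1 (restrict (\<lambda>i. X i w) ?A) \<in> {1}}"
      by (auto simp: T_def e1 split: if_splits)
    moreover have "R n = {w \<in> space M. Y2 (restrict (\<lambda>i. X i w) ?B) \<in> {..\<epsilon>}}"
      by (auto simp: R_def e2)
    ultimately show ?thesis
      using prob_indep_random_variable[OF iv, of "{1}" "{..\<epsilon>}"] by simp
  qed
  have halfR: "1/2 \<le> prob (R n)" if "n \<in> {N..K}" for n
  proof -
    have "R n = space M - {w \<in> space M. \<bar>\<Sum>k\<in>{n..<K}. X k w\<bar> > \<epsilon>}" by (auto simp: R_def)
    then have "prob (R n) = 1 - prob {w \<in> space M. \<bar>\<Sum>k\<in>{n..<K}. X k w\<bar> > \<epsilon>}"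
      by (simp add: prob_compl)
    with half[OF that] show ?thesis by simp
  qed
  have disj: "disjoint_family_on T {N..K}"
    unfolding disjoint_family_on_def
  proof (intro ballI impI)
    fix m n assume mn: "m \<in> {N..K}" "n \<in> {N..K}" "m \<noteq> n"
    then consider "m < n" | "n < m" by linarith
    moreover have "T m \<inter> T n = {}" if "m < n" "N \<le> m" for m n
      using that by (auto simp: T_def dest!: bspec[of _ _ m])
    ultimately show "T m \<inter> T n = {}" using mn by (metis atLeastAtMost_iff inf_commute)
  qed
  have "{w \<in> space M. \<exists>n\<in>{N..K}. \<bar>S n w\<bar> > 2 * \<epsilon>} \<subseteq> (\<Union>n\<in>{N..K}. T n)"
  proof safe
    fix w n assume w: "w \<in> space M" and n: "n \<in> {N..K}" "\<bar>S n w\<bar> > 2 * \<epsilon>"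
    define n0 where "n0 = (LEAST n. n \<ge> N \<and> \<bar>S n w\<bar> > 2 * \<epsilon>)"
    have n0: "n0 \<ge> N \<and> \<bar>S n0 w\<bar> > 2 * \<epsilon>" unfolding n0_def by (rule LeastI[of _ n]) (use n in auto)
    have "n0 \<le> n" unfolding n0_def by (rule Least_le) (use n in auto)
    have "\<bar>S j w\<bar> \<le> 2 * \<epsilon>" if "j \<in> {N..<n0}" for j
      using that not_less_Least[of j "\<lambda>n. n \<ge> N \<and> \<bar>S n w\<bar> > 2 * \<epsilon>"] unfolding n0_def[symmetric] by auto
    then have "w \<in> T n0" using w n0 by (auto simp: T_def)
    then show "w \<in> (\<Union>n\<in>{N..K}. T n)" using n n0 \<open>n0 \<le> n\<close> by auto
  qed
  then have "prob {w \<in> space M. \<exists>n\<in>{N..K}. \<bar>S n w\<bar> > 2 * \<epsilon>} \<le> prob (\<Union>n\<in>{N..K}. T n)"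
    by (intro finite_measure_mono) auto
  also have "\<dots> = (\<Sum>n\<in>{N..K}. prob (T n))"
    by (rule finite_measure_finite_Union) (use disj in auto)
  also have "\<dots> \<le> (\<Sum>n\<in>{N..K}. 2 * prob (T n \<inter> R n))"
  proof (rule sum_mono)
    fix n assume "n \<in> {N..K}"
    then have "prob (T n) * (1/2) \<le> prob (T n) * prob (R n)" by (intro mult_left_mono halfR) auto
    then show "prob (T n) \<le> 2 * prob (T n \<inter> R n)" by (simp add: indTR)
  qed
  also have "\<dots> = 2 * prob (\<Union>n\<in>{N..K}. T n \<inter> R n)"
    by (subst finite_measure_finite_Union)
      (use disj in \<open>auto simp: sum_distrib_left disjoint_family_on_def\<close>)
  also have "\<dots> \<le> 2 * prob {w \<in> space M. \<bar>S K w\<bar> > \<epsilon>}"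
  proof -
    have "(\<Union>n\<in>{N..K}. T n \<inter> R n) \<subseteq> {w \<in> space M. \<bar>S K w\<bar> > \<epsilon>}"
    proof safe
      fix w n assume n: "n \<in> {N..K}" and w: "w \<in> T n" "w \<in> R n"
      have "S K w = S n w + (\<Sum>k\<in>{n..<K}. X k w)"
        unfolding S_def using n by (simp add: sum.atLeastLessThan_concat)
      then show "\<bar>S K w\<bar> > \<epsilon>" using w unfolding T_def R_def by auto
    qed (auto simp: T_def)
    then show ?thesis by (intro mult_left_mono finite_measure_mono) auto
  qed
  finally show ?thesis unfolding S_def .
qed

text \<open>Ottaviani's inequality turns the Cauchy criterion in probability into one for the maxima of the
partial sums over arbitrarily long blocks.\<close>

lemma (in prob_space) indep_series_summable:
  fixes X :: "nat \<Rightarrow> 'a \<Rightarrow> real"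
  assumes ind: "indep_vars (\<lambda>_. borel) X UNIV"
    and cau: "\<And>\<epsilon> \<delta>. 0 < \<epsilon> \<Longrightarrow> 0 < \<delta> \<Longrightarrow>
      \<exists>N. \<forall>n\<ge>N. \<forall>K\<ge>n. prob {w \<in> space M. \<bar>\<Sum>k\<in>{n..<K}. X k w\<bar> > \<epsilon>} \<le> \<delta>"
  shows "AE w in M. summable (\<lambda>k. X k w)"
proof -
  have [measurable]: "X k \<in> borel_measurable M" for k using ind by (auto simp: indep_vars_def)
  have tail: "AE w in M. \<exists>N. \<forall>n\<ge>N. \<bar>\<Sum>k\<in>{N..<n}. X k w\<bar> \<le> 2 * \<epsilon>" if "0 < \<epsilon>" for \<epsilon>
  proof -
    define E where "E N K = {w \<in> space M. \<exists>n\<in>{N..K}. \<bar>\<Sum>k\<in>{N..<n}. X k w\<bar> > 2 * \<epsilon>}" for N K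
    have [measurable]: "E N K \<in> events" for N K unfolding E_def by measurable
    let ?Z = "{w \<in> space M. \<forall>N. \<exists>n\<ge>N. \<bar>\<Sum>k\<in>{N..<n}. X k w\<bar> > 2 * \<epsilon>}"
    have "prob ?Z \<le> \<delta>" if d: "0 < \<delta>" for \<delta>
    proof -
      obtain N where N: "\<And>n K. n \<ge> N \<Longrightarrow> K \<ge> n \<Longrightarrow>
          prob {w \<in> space M. \<bar>\<Sum>k\<in>{n..<K}. X k w\<bar> > \<epsilon>} \<le> min (1/2) (\<delta>/2)"
        using cau[OF \<open>0 < \<epsilon>\<close>, of "min (1/2) (\<delta>/2)"] d by auto
      have E: "prob (E N K) \<le> \<delta>" for K
      proof (cases "N \<le> K")
        case True
        have "prob (E N K) \<le> 2 * prob {w \<in> space M. \<bar>\<Sum>k\<in>{N..<K}. X k w\<bar> > \<epsilon>}"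
          unfolding E_def using N by (intro ottaviani[OF ind True]) (auto intro: order_trans)
        also have "\<dots> \<le> \<delta>" using N[of N K] True by auto
        finally show ?thesis .
      qed (use d in \<open>auto simp: E_def\<close>)
      have "incseq (E N)" unfolding incseq_def E_def by fastforce
      then have "(\<lambda>K. prob (E N K)) \<longlonglongrightarrow> prob (\<Union>K. E N K)"
        by (intro finite_Lim_measure_incseq) auto
      then have "prob (\<Union>K. E N K) \<le> \<delta>" by (rule LIMSEQ_le_const2) (use E in auto)
      moreover have "prob ?Z \<le> prob (\<Union>K. E N K)"
      proof (rule finite_measure_mono)
        show "?Z \<subseteq> (\<Union>K. E N K)"
        proof safe
          fix w assume w: "w \<in> space M" "\<forall>N. \<exists>n\<ge>N. \<bar>\<Sum>k\<in>{N..<n}. X k w\<bar> > 2 * \<epsilon>"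
          then obtain n where "n \<ge> N" "\<bar>\<Sum>k\<in>{N..<n}. X k w\<bar> > 2 * \<epsilon>" by blast
          then have "w \<in> E N n" using w(1) by (auto simp: E_def)
          then show "w \<in> (\<Union>K. E N K)" by blast
        qed
      qed measurable
      ultimately show ?thesis by linarith
    qed
    then have "prob ?Z \<le> 0" by (rule field_le_epsilon[of _ 0, simplified]) 
    then have "prob ?Z = 0" using measure_nonneg[of M ?Z] by linarith
    then have "?Z \<in> null_sets M" by (auto simp: null_sets_def emeasure_eq_measure)
    then show ?thesis by (rule AE_I') (auto simp: not_le)
  qed
  have "AE w in M. \<forall>m::nat. \<exists>N. \<forall>n\<ge>N. \<bar>\<Sum>k\<in>{N..<n}. X k w\<bar> \<le> 1 / (2 * real (Suc m))"
    
  proof (intro AE_all_countable[THEN iffD2] allI)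
    fix m :: nat
    show "AE w in M. \<exists>N. \<forall>n\<ge>N. \<bar>\<Sum>k\<in>{N..<n}. X k w\<bar> \<le> 1 / (2 * real (Suc m))"
      using tail[of "1 / (4 * real (Suc m))"] by (simp add: field_simps del: of_nat_Suc)
  qed
  then show ?thesis
  proof eventually_elim
    case (elim w)
    show ?case
      unfolding summable_Cauchy
    proof (intro allI impI)
      fix e :: real assume e: "0 < e"
      obtain m where m: "1 / Suc m < e" by (rule nat_approx_posE[OF e])
      obtain N where N: "\<And>n. n \<ge> N \<Longrightarrow> \<bar>\<Sum>k\<in>{N..<n}. X k w\<bar> \<le> 1 / (2 * real (Suc m))"
        using elim by blast
      have "norm (\<Sum>k\<in>{a..<b}. X k w) < e" if "a \<ge> N" for a b
      proof (cases "a \<le> b")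
        case True
        then have "(\<Sum>k\<in>{N..<b}. X k w) = (\<Sum>k\<in>{N..<a}. X k w) + (\<Sum>k\<in>{a..<b}. X k w)"
          using that by (simp add: sum.atLeastLessThan_concat)
        then have "\<bar>\<Sum>k\<in>{a..<b}. X k w\<bar> \<le> 1 / (2 * real (Suc m)) + 1 / (2 * real (Suc m))"
          using N[of a] N[of b] that True by linarith
        also have "\<dots> = 1 / Suc m" by (simp add: field_simps del: of_nat_Suc)
        finally show ?thesis using m by simp
      qed (use e in simp)
      then show "\<exists>N. \<forall>a\<ge>N. \<forall>b. norm (\<Sum>k\<in>{a..<b}. X k w) < e" by blast
    qed
  qed
qed

section \<open>Compound Poisson integrals with random signs\<close>

lemma indep_vars_PiM_coordinate:
  assumes M: "\<And>i. i \<in> I \<Longrightarrow> prob_space (M i)"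
  shows "prob_space.indep_vars (PiM I M) M (\<lambda>i w. w i) I"
proof -
  interpret P: prob_space "PiM I M" by (rule prob_space_PiM) fact
  show ?thesis
  proof (cases "I = {}")
    case True
    show ?thesis
      unfolding P.indep_vars_def2 P.indep_sets_def using True by auto
  next
    case False
    have "distr (PiM I M) (PiM I M) (\<lambda>x. \<lambda>i\<in>I. x i) = distr (PiM I M) (PiM I M) (\<lambda>x. x)"
      by (rule distr_cong) (auto simp: space_PiM PiE_def extensional_restrict)
    also have "\<dots> = PiM I M" by (simp add: distr_id)
    also have "\<dots> = PiM I (\<lambda>i. distr (PiM I M) (M i) (\<lambda>w. w i))"
      by (intro PiM_cong) (auto simp: distr_PiM_component M)
    finally show ?thesis
      by (subst P.indep_vars_iff_distr_eq_PiM'[OF False]) auto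
  qed
qed

lemma poisson_power_expectation:
  fixes a c :: real
  assumes c: "0 < c" and a: "\<bar>a\<bar> \<le> 1"
  shows "(LINT n|measure_pmf (poisson_pmf c). a ^ n) = exp (c * (a - 1))"
proof -
  have s: "(\<lambda>n. pmf (poisson_pmf c) n * a ^ n) sums (exp (- c) * exp (c * a))"
    using sums_mult[OF exp_converges[of "c * a"], of "exp (- c)"] c
    by (simp add: field_simps power_mult_distrib)
  have "integrable (measure_pmf (poisson_pmf c)) (\<lambda>n. a ^ n)"
    by (rule measure_pmf.integrable_const_bound[of _ 1]) (use a in \<open>auto simp: power_abs power_le_one\<close>)
  then have i: "integrable (count_space UNIV) (\<lambda>n. pmf (poisson_pmf c) n *\<^sub>R a ^ n)"
    unfolding measure_pmf_eq_density by (subst (asm) integrable_density) auto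
  have "(LINT n|measure_pmf (poisson_pmf c). a ^ n) = (LINT n|count_space UNIV. pmf (poisson_pmf c) n *\<^sub>R a ^ n)"
    unfolding measure_pmf_eq_density by (subst integral_density) auto
  also have "\<dots> = (\<Sum>n. pmf (poisson_pmf c) n *\<^sub>R a ^ n)"
    by (rule integral_count_space_nat[OF i])
  also have "\<dots> = exp (- c) * exp (c * a)"
    using sums_unique[OF s] by simp
  finally show ?thesis by (simp add: exp_add[symmetric] algebra_simps)
qed

lemma (in prob_space) integrable_iexp_real:
  "f \<in> borel_measurable M \<Longrightarrow> integrable M (\<lambda>x. iexp (f x))"
  by (rule integrable_const_bound[of _ 1]) auto

text \<open>A compound Poisson sum: a Poisson number of points drawn independently from the normalised measure,
each with a fair sign. A measure of mass zero is treated apart, because it has no normalisation and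
its space may even be empty; then the zero functional does.\<close>

lemma finite_poisson_functional:
  fixes \<mu> :: "'z measure"
  assumes "finite_measure \<mu>"
  obtains \<Omega> :: "(nat \<times> (nat \<Rightarrow> 'z \<times> real)) measure" and I :: "('z \<Rightarrow> real) \<Rightarrow> _ \<Rightarrow> real"
  where "prob_space \<Omega>" "\<And>h. h \<in> borel_measurable \<mu> \<Longrightarrow> I h \<in> borel_measurable \<Omega>"
    "\<And>h g w. I (\<lambda>z. h z + g z) w = I h w + I g w" "\<And>h c w. I (\<lambda>z. c * h z) w = c * I h w"
    "\<And>h. h \<in> borel_measurable \<mu> \<Longrightarrow>
       (CLINT w|\<Omega>. iexp (I h w)) = exp (complex_of_real (LINT z|\<mu>. cos (h z) - 1))"
proof -
  interpret \<mu>: finite_measure \<mu> by fact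
  define c where "c = measure \<mu> (space \<mu>)"
  show thesis
  proof (cases "c = 0")
    case True
    then have "space \<mu> \<in> null_sets \<mu>" by (auto simp: c_def null_sets_def \<mu>.emeasure_eq_measure)
    then have "AE z in \<mu>. False" by (rule AE_I') auto
    then have "(LINT z|\<mu>. cos (h z) - 1) = 0" for h :: "'z \<Rightarrow> real"
      by (intro integral_eq_zero_AE) auto
    then show thesis
      by (intro that[of "return (count_space UNIV) undefined" "\<lambda>h w. 0"])
         (auto intro!: prob_space_return simp: measure_return)
  next
    case False
    then have c: "0 < c" by (simp add: c_def zero_less_measure_iff measure_le_0_iff less_le)
    define D where "D = density \<mu> (\<lambda>_. ennreal (1 / c))"
    define Sg where "Sg = measure_pmf (pmf_of_set {-1, 1::real})"
    have "prob_space D"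
      using c by (intro prob_spaceI) (simp add: D_def emeasure_density \<mu>.emeasure_eq_measure ennreal_mult'[symmetric]
         flip: c_def)
    then interpret D: prob_space D .
    interpret Sg: prob_space Sg unfolding Sg_def by (rule prob_space_measure_pmf)
    interpret DS: pair_prob_space D Sg ..
    define \<Omega>2 where "\<Omega>2 = PiM (UNIV :: nat set) (\<lambda>_. D \<Otimes>\<^sub>M Sg)"
    interpret \<Omega>2: prob_space \<Omega>2 unfolding \<Omega>2_def by (intro prob_space_PiM DS.prob_space_axioms)
    define N where "N = measure_pmf (poisson_pmf c)"
    interpret N: prob_space N unfolding N_def by (rule prob_space_measure_pmf)
    interpret \<Omega>: pair_prob_space N \<Omega>2 ..
    define I where "I h w = (\<Sum>j<fst w. snd (snd w j) * h (fst (snd w j)))"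
      for h :: "'z \<Rightarrow> real" and w :: "nat \<times> (nat \<Rightarrow> 'z \<times> real)"
    have mh: "h \<in> borel_measurable D" if "h \<in> borel_measurable \<mu>" for h :: "'z \<Rightarrow> real"
      using that by (simp add: D_def)
    have comp: "(\<lambda>w. w j) \<in> \<Omega>2 \<rightarrow>\<^sub>M D \<Otimes>\<^sub>M Sg" for j unfolding \<Omega>2_def by measurable
    have g: "(\<lambda>p. snd p * h (fst p)) \<in> borel_measurable (D \<Otimes>\<^sub>M Sg)" if "h \<in> borel_measurable \<mu>" for h :: "'z \<Rightarrow> real"
    proof -
      have "(\<lambda>s. s) \<in> borel_measurable Sg" by (simp add: Sg_def)
      then show ?thesis using mh[OF that] by measurable
    qed
    have gj: "(\<lambda>w. snd (w j) * h (fst (w j))) \<in> borel_measurable \<Omega>2" if "h \<in> borel_measurable \<mu>" for h :: "'z \<Rightarrow> real" and j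
      using measurable_compose[OF comp g[OF that]] .
    show thesis
    proof (rule that[of "N \<Otimes>\<^sub>M \<Omega>2" I])
      show "prob_space (N \<Otimes>\<^sub>M \<Omega>2)" by (rule \<Omega>.prob_space_axioms)
      show "I (\<lambda>z. h z + g z) w = I h w + I g w" for h g w
        by (simp add: I_def sum.distrib algebra_simps)
      show "I (\<lambda>z. c * h z) w = c * I h w" for h c w
        by (simp add: I_def sum_distrib_left algebra_simps)
      fix h :: "'z \<Rightarrow> real" assume h[measurable]: "h \<in> borel_measurable \<mu>"
      show Im[measurable]: "I h \<in> borel_measurable (N \<Otimes>\<^sub>M \<Omega>2)"
        unfolding I_def[abs_def]
      proof (rule measurable_compose_countable[where g=fst])
        show "(\<lambda>w. \<Sum>j<n. snd (snd w j) * h (fst (snd w j))) \<in> borel_measurable (N \<Otimes>\<^sub>M \<Omega>2)" for n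
          by (intro borel_measurable_sum measurable_compose[OF measurable_snd gj[OF h]])
        have "fst \<in> N \<Otimes>\<^sub>M \<Omega>2 \<rightarrow>\<^sub>M N" by measurable
        then show "fst \<in> N \<Otimes>\<^sub>M \<Omega>2 \<rightarrow>\<^sub>M count_space UNIV" by (simp add: N_def)
      qed
      have [measurable]: "h \<in> borel_measurable D" by (rule mh) fact
      \<comment> \<open>One signed point has characteristic function \<open>E cos h\<close>: averaging over the sign removes the sine.\<close>
      define a where "a = (LINT z|D. cos (h z))"
      have a1: "\<bar>a\<bar> \<le> 1"
      proof -
        have "norm a \<le> (LINT z|D. norm (cos (h z)))" unfolding a_def by (rule integral_norm_bound)
        also have "\<dots> \<le> (LINT z|D. 1)"
          by (intro integral_mono D.integrable_const_bound[of _ 1]) auto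
        finally show ?thesis by (simp add: D.prob_space)
      qed
      have int: "integrable (D \<Otimes>\<^sub>M Sg) (\<lambda>p. iexp (snd p * h (fst p)))"
        by (rule DS.integrable_iexp_real) (rule g[OF h])
      have E1: "(CLINT p|D \<Otimes>\<^sub>M Sg. iexp (snd p * h (fst p))) = complex_of_real a"
      proof -
        have "(CLINT p|D \<Otimes>\<^sub>M Sg. iexp (snd p * h (fst p))) = (CLINT z|D. CLINT s|Sg. iexp (s * h z))"
          using DS.integral_fst'[OF int] by simp
        also have "\<dots> = (CLINT z|D. complex_of_real (cos (h z)))"
        proof (rule Bochner_Integration.integral_cong)
          fix z
          have "(CLINT s|Sg. iexp (s * h z)) = (\<Sum>s\<in>{-1,1}. pmf (pmf_of_set {-1,1::real}) s *\<^sub>R iexp (s * h z))"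
            unfolding Sg_def by (rule integral_measure_pmf) auto
          also have "\<dots> = complex_of_real (cos (h z))"
            by (simp add: cos_of_real[symmetric] cos_exp_eq scaleR_conv_of_real field_simps)
          finally show "(CLINT s|Sg. iexp (s * h z)) = complex_of_real (cos (h z))" .
        qed simp
        finally show ?thesis by (simp add: a_def)
      qed
      have En: "(CLINT w|\<Omega>2. iexp (\<Sum>j<n. snd (w j) * h (fst (w j)))) = complex_of_real a ^ n" for n
      proof -
        have "\<Omega>2.indep_vars (\<lambda>_. D \<Otimes>\<^sub>M Sg) (\<lambda>i w. w i) UNIV"
          unfolding \<Omega>2_def by (rule indep_vars_PiM_coordinate) (rule DS.prob_space_axioms)
        then have "\<Omega>2.indep_vars (\<lambda>_. D \<Otimes>\<^sub>M Sg) (\<lambda>i w. w i) {..<n}"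
          by (rule \<Omega>2.indep_vars_subset) simp
        then have iv: "\<Omega>2.indep_vars (\<lambda>_. borel) (\<lambda>i w. iexp (snd (w i) * h (fst (w i)))) {..<n}"
          by (rule \<Omega>2.indep_vars_compose2[where Y="\<lambda>_ p. iexp (snd p * h (fst p))"]) (intro measurable_compose[OF g[OF h]], simp)
        have e: "(CLINT w|\<Omega>2. iexp (snd (w j) * h (fst (w j)))) = complex_of_real a" for j
        proof -
          have "distr \<Omega>2 (D \<Otimes>\<^sub>M Sg) (\<lambda>w. w j) = D \<Otimes>\<^sub>M Sg"
            unfolding \<Omega>2_def by (rule distr_PiM_component) (auto intro: DS.prob_space_axioms)
          then have "complex_of_real a = (CLINT p|distr \<Omega>2 (D \<Otimes>\<^sub>M Sg) (\<lambda>w. w j). iexp (snd p * h (fst p)))"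
            using E1 by simp
          also have "\<dots> = (CLINT w|\<Omega>2. iexp (snd (w j) * h (fst (w j))))"
            by (intro integral_distr comp measurable_compose[OF g[OF h]]) simp
          finally show ?thesis by simp
        qed
        have "(CLINT w|\<Omega>2. iexp (\<Sum>j<n. snd (w j) * h (fst (w j)))) = (CLINT w|\<Omega>2. \<Prod>j<n. iexp (snd (w j) * h (fst (w j))))"
          by (simp add: sum_distrib_left exp_sum)
        also have "\<dots> = (\<Prod>j<n. CLINT w|\<Omega>2. iexp (snd (w j) * h (fst (w j))))"
          by (intro \<Omega>2.indep_vars_lebesgue_integral iv \<Omega>2.integrable_iexp_real gj[OF h]) simp
        also have "\<dots> = complex_of_real a ^ n" unfolding e by simp
        finally show ?thesis .
      qed
      have "integrable (N \<Otimes>\<^sub>M \<Omega>2) (\<lambda>w. iexp (I h w))"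
        by (rule \<Omega>.integrable_iexp_real) measurable
      from \<Omega>.integral_fst'[OF this]
      have "(CLINT w|N \<Otimes>\<^sub>M \<Omega>2. iexp (I h w)) = (CLINT n|N. CLINT w|\<Omega>2. iexp (I h (n, w)))" by simp
      also have "\<dots> = (CLINT n|N. complex_of_real (a ^ n))"
        using En by (simp add: I_def)
      also have "\<dots> = complex_of_real (exp (c * (a - 1)))"
        unfolding integral_complex_of_real N_def by (simp only: poisson_power_expectation[OF c a1])
      also have "c * (a - 1) = (LINT z|\<mu>. cos (h z) - 1)"
      proof -
        have "a = (LINT z|\<mu>. cos (h z)) / c"
          unfolding a_def D_def using c by (subst integral_real_density) auto
        moreover have "(LINT z|\<mu>. cos (h z) - 1) = (LINT z|\<mu>. cos (h z)) - c"
          by (subst Bochner_Integration.integral_diff) (auto simp: c_def intro!: \<mu>.integrable_const_bound[of _ 1])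
        ultimately show ?thesis using c by (simp add: field_simps)
      qed
      finally show "(CLINT w|N \<Otimes>\<^sub>M \<Omega>2. iexp (I h w)) = exp (complex_of_real (LINT z|\<mu>. cos (h z) - 1))"
        by (simp add: exp_of_real)
    qed
  qed
qed

section \<open>Tail bounds and integrands of a Levy measure\<close>

text \<open>Integrating the characteristic function of \<open>Y / \<epsilon>\<close> against the standard normal law yields
\<open>E exp(-Y\<^sup>2 / 2\<epsilon>\<^sup>2)\<close>, and \<open>1 - exp(-y\<^sup>2 / 2\<epsilon>\<^sup>2)\<close> is at least \<open>1/3\<close> as soon as \<open>\<bar>y\<bar> > \<epsilon>\<close>.\<close>

lemma (in prob_space) prob_gt_le_of_char:
  assumes [measurable]: "Y \<in> borel_measurable M"
    and K: "\<And>t. 1 - K * (1 + t\<^sup>2) \<le> Re (CLINT w|M. iexp (t * Y w))"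
    and \<epsilon>: "0 < \<epsilon>"
  shows "prob {w \<in> space M. \<bar>Y w\<bar> > \<epsilon>} \<le> 3 * K * (1 + 1 / \<epsilon>\<^sup>2)"
proof -
  let ?N = std_normal_distribution
  interpret N: real_distribution ?N by (rule real_dist_normal_dist)
  interpret MN: pair_prob_space M ?N ..
  have gauss: "(LINT t|?N. cos (t * y)) = exp (- y\<^sup>2 / 2)" for y
  proof -
    have "complex_of_real (exp (- y\<^sup>2 / 2)) = (CLINT t|?N. iexp (y * t))"
      unfolding fun_cong[OF char_std_normal_distribution, symmetric] char_def ..
    then have "exp (- y\<^sup>2 / 2) = Re (CLINT t|?N. iexp (y * t))" by (metis Re_complex_of_real)
    also have "\<dots> = (LINT t|?N. Re (iexp (y * t)))"
      by (rule integral_Re[symmetric], rule N.integrable_iexp_real) simp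
    also have "\<dots> = (LINT t|?N. cos (t * y))" by (simp add: Re_exp mult.commute)
    finally show ?thesis by simp
  qed
  have cos_int: "integrable (M \<Otimes>\<^sub>M ?N) (\<lambda>(w, t). cos (t * (Y w / \<epsilon>)))"
    by (rule MN.integrable_const_bound[of _ 1]) auto
  have Re_char: "Re (CLINT w|M. iexp (t * Y w)) = expectation (\<lambda>w. cos (t * Y w))" for t
  proof -
    have "Re (CLINT w|M. iexp (t * Y w)) = expectation (\<lambda>w. Re (iexp (t * Y w)))"
      by (rule integral_Re[symmetric], rule integrable_iexp_real) simp
    then show ?thesis by (simp add: Re_exp)
  qed
  have i2: "integrable ?N (\<lambda>t. 1 - K * (1 + (t / \<epsilon>)\<^sup>2))"
    using integrable_std_normal_distribution_moment[of 2]
    by (auto simp: power_divide intro!: Bochner_Integration.integrable_diff integrable_mult_right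
        Bochner_Integration.integrable_add Bochner_Integration.integrable_divide)
  have m2: "(LINT t|?N. t\<^sup>2) = 1"
    using std_normal_distribution_even_moments(1)[of 1] by simp
  have "1 - K * (1 + 1 / \<epsilon>\<^sup>2) = (LINT t|?N. 1 - K * (1 + (t / \<epsilon>)\<^sup>2))"
    using integrable_std_normal_distribution_moment[of 2] m2 N.prob_space
    by (simp add: power_divide)
  also have "\<dots> \<le> (LINT t|?N. expectation (\<lambda>w. cos (t * (Y w / \<epsilon>))))"
  proof (rule integral_mono[OF i2])
    show "integrable ?N (\<lambda>t. expectation (\<lambda>w. cos (t * (Y w / \<epsilon>))))"
      by (rule MN.integrable_snd[OF cos_int])
    show "1 - K * (1 + (t / \<epsilon>)\<^sup>2) \<le> expectation (\<lambda>w. cos (t * (Y w / \<epsilon>)))" for t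
      using K[of "t / \<epsilon>"] Re_char[of "t / \<epsilon>"] by simp
  qed
  also have "\<dots> = expectation (\<lambda>w. LINT t|?N. cos (t * (Y w / \<epsilon>)))"
    by (rule MN.Fubini_integral[OF cos_int])
  also have "\<dots> = expectation (\<lambda>w. exp (- (Y w / \<epsilon>)\<^sup>2 / 2))" by (simp only: gauss)
  also have "\<dots> \<le> expectation (\<lambda>w. 1 - (1/3) * indicat_real {w \<in> space M. \<bar>Y w\<bar> > \<epsilon>} w)"
  proof (rule integral_mono)
    show "integrable M (\<lambda>w. exp (- (Y w / \<epsilon>)\<^sup>2 / 2))"
      by (rule integrable_const_bound[of _ 1]) auto
    show "integrable M (\<lambda>w. 1 - (1/3) * indicat_real {w \<in> space M. \<bar>Y w\<bar> > \<epsilon>} w)"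
      by (rule integrable_const_bound[of _ 1]) (auto simp: indicator_def)
    fix w assume w: "w \<in> space M"
    show "exp (- (Y w / \<epsilon>)\<^sup>2 / 2) \<le> 1 - (1/3) * indicat_real {w \<in> space M. \<bar>Y w\<bar> > \<epsilon>} w"
    proof (cases "\<bar>Y w\<bar> > \<epsilon>")
      case True
      have "1 \<le> (Y w / \<epsilon>)\<^sup>2"
        using True \<epsilon> by (subst abs_le_square_iff[of 1, simplified, symmetric]) (simp add: abs_divide)
      then have "exp (- (Y w / \<epsilon>)\<^sup>2 / 2) \<le> exp (- (1/2))" by simp
      also have "\<dots> = 1 / exp (1/2)" by (simp add: exp_minus field_simps)
      also have "\<dots> \<le> 1 / (3/2)"
        using exp_ge_add_one_self[of "1/2"] by (intro divide_left_mono) auto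
      finally show ?thesis using True w by simp
    qed auto
  qed
  also have "\<dots> = 1 - (1/3) * prob {w \<in> space M. \<bar>Y w\<bar> > \<epsilon>}"
    by (subst Bochner_Integration.integral_diff)
      (auto simp: prob_space emeasure_eq_measure)
  finally show ?thesis by (simp add: algebra_simps)
qed

lemma (in prob_space) AE_eq_of_limits:
  fixes f :: "nat \<Rightarrow> 'a \<Rightarrow> real"
  assumes [measurable]: "\<And>n. f n \<in> borel_measurable M" "L \<in> borel_measurable M" "Y \<in> borel_measurable M"
    and ae: "AE w in M. (\<lambda>n. f n w) \<longlonglongrightarrow> L w"
    and pr: "\<And>\<epsilon>. 0 < \<epsilon> \<Longrightarrow> (\<lambda>n. prob {w \<in> space M. \<bar>f n w - Y w\<bar> > \<epsilon>}) \<longlonglongrightarrow> 0"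
  shows "AE w in M. L w = Y w"
proof -
  let ?d = "\<lambda>x y. min 1 \<bar>x - y\<bar> :: real"
  have int: "integrable M (\<lambda>w. ?d (a w) (b w))"
    if [measurable]: "a \<in> borel_measurable M" "b \<in> borel_measurable M" for a b
    by (rule integrable_const_bound[of _ 1]) auto
  have lim: "(\<lambda>n. expectation (\<lambda>w. ?d (f n w) (Y w))) \<longlonglongrightarrow> expectation (\<lambda>w. ?d (L w) (Y w))"
  proof (rule integral_dominated_convergence[where w="\<lambda>_. 1"])
    show "AE w in M. (\<lambda>n. ?d (f n w) (Y w)) \<longlonglongrightarrow> ?d (L w) (Y w)"
      using ae by eventually_elim (intro tendsto_intros)
  qed auto
  have "expectation (\<lambda>w. ?d (L w) (Y w)) \<le> 0 + \<epsilon>" if \<epsilon>: "0 < \<epsilon>" for \<epsilon>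
  proof (rule LIMSEQ_le[OF lim])
    show "(\<lambda>n. prob {w \<in> space M. \<bar>f n w - Y w\<bar> > \<epsilon>} + \<epsilon>) \<longlonglongrightarrow> 0 + \<epsilon>"
      by (intro tendsto_intros pr \<epsilon>)
    have "expectation (\<lambda>w. ?d (f n w) (Y w)) \<le> prob {w \<in> space M. \<bar>f n w - Y w\<bar> > \<epsilon>} + \<epsilon>" for n
    proof -
      have "expectation (\<lambda>w. ?d (f n w) (Y w)) \<le>
          expectation (\<lambda>w. indicator {w \<in> space M. \<bar>f n w - Y w\<bar> > \<epsilon>} w + \<epsilon>)"
      proof (rule integral_mono)
        show "integrable M (\<lambda>w. indicator {w \<in> space M. \<bar>f n w - Y w\<bar> > \<epsilon>} w + \<epsilon>)"
          using \<epsilon> by (intro integrable_const_bound[of _ "1 + \<epsilon>"]) (auto simp: indicator_def)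
      qed (use \<epsilon> in \<open>auto simp: indicator_def intro!: int\<close>)
      also have "\<dots> = prob {w \<in> space M. \<bar>f n w - Y w\<bar> > \<epsilon>} + \<epsilon>"
        by (subst Bochner_Integration.integral_add) (auto simp: prob_space intro!: integrable_const_bound[of _ 1])
      finally show ?thesis .
    qed
    then show "\<exists>N. \<forall>n\<ge>N. expectation (\<lambda>w. ?d (f n w) (Y w)) \<le> prob {w \<in> space M. \<bar>f n w - Y w\<bar> > \<epsilon>} + \<epsilon>"
      by auto
  qed
  then have "expectation (\<lambda>w. ?d (L w) (Y w)) \<le> 0" by (rule field_le_epsilon)
  moreover have "0 \<le> expectation (\<lambda>w. ?d (L w) (Y w))" by (rule Bochner_Integration.integral_nonneg) auto
  ultimately have "expectation (\<lambda>w. ?d (L w) (Y w)) = 0" by linarith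
  then have "AE w in M. ?d (L w) (Y w) = 0"
    by (subst (asm) integral_nonneg_eq_0_iff_AE) (auto intro!: int)
  then show ?thesis by eventually_elim (auto simp: min_def split: if_splits)
qed

text \<open>The functions whose sum over a symmetrised Poisson process converges: \<open>h\<close> maps the intensity to a
measure that satisfies the integrability condition of a Levy measure.\<close>

definition levy_integrands :: "'z measure \<Rightarrow> ('z \<Rightarrow> real) set" where
  "levy_integrands \<kappa> = {h \<in> borel_measurable \<kappa>. integrable \<kappa> (\<lambda>z. min 1 ((h z)\<^sup>2))}"

lemma levy_integrandsD [measurable_dest]: "h \<in> levy_integrands \<kappa> \<Longrightarrow> h \<in> borel_measurable \<kappa>"
  by (simp add: levy_integrands_def)

lemma levy_integrandsI:
  assumes "h \<in> borel_measurable \<kappa>" "integrable \<kappa> g" "\<And>z. z \<in> space \<kappa> \<Longrightarrow> min 1 ((h z)\<^sup>2) \<le> g z"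
  shows "h \<in> levy_integrands \<kappa>"
  unfolding levy_integrands_def
  using assms by (auto intro!: Bochner_Integration.integrable_bound[OF assms(2)])
    (smt (verit) AE_I2 zero_le_power2)

lemma levy_integrands_add:
  assumes h: "h \<in> levy_integrands \<kappa>" and g: "g \<in> levy_integrands \<kappa>"
  shows "(\<lambda>z. h z + g z) \<in> levy_integrands \<kappa>"
proof (rule levy_integrandsI)
  show "(\<lambda>z. h z + g z) \<in> borel_measurable \<kappa>" using h g by measurable
  show "integrable \<kappa> (\<lambda>z. 2 * (min 1 ((h z)\<^sup>2) + min 1 ((g z)\<^sup>2)))"
    using h g by (auto simp: levy_integrands_def)
  have "(a + b)\<^sup>2 \<le> 2 * a\<^sup>2 + 2 * b\<^sup>2" for a b :: real
    using zero_le_power2[of "a - b"] by (simp add: power2_eq_square algebra_simps)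
  then show "min 1 ((h z + g z)\<^sup>2) \<le> 2 * (min 1 ((h z)\<^sup>2) + min 1 ((g z)\<^sup>2))" for z
    by (smt (verit) zero_le_power2)
qed

lemma min_square_mult_le: "min 1 ((c * x)\<^sup>2) \<le> (1 + c\<^sup>2) * min 1 (x\<^sup>2)" for c x :: real
proof (cases "x\<^sup>2 \<le> 1")
  case True
  have "(c * x)\<^sup>2 \<le> (1 + c\<^sup>2) * x\<^sup>2" by (simp add: power_mult_distrib algebra_simps)
  with True show ?thesis by (simp add: min.coboundedI2)
next
  case False
  then show ?thesis by (simp add: min.coboundedI1)
qed

lemma levy_integrands_scale:
  assumes h: "h \<in> levy_integrands \<kappa>"
  shows "(\<lambda>z. c * h z) \<in> levy_integrands \<kappa>"
  by (rule levy_integrandsI[where g="\<lambda>z. (1 + c\<^sup>2) * min 1 ((h z)\<^sup>2)"])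
    (use h min_square_mult_le in \<open>auto simp: levy_integrands_def\<close>)

lemma levy_integrands_sum:
  assumes "\<And>i. i \<in> J \<Longrightarrow> h i \<in> levy_integrands \<kappa>"
  shows "(\<lambda>z. \<Sum>i\<in>J. h i z) \<in> levy_integrands \<kappa>"
  using assms
proof (induction J rule: infinite_finite_induct)
  case (insert i J)
  then show ?case using levy_integrands_add[of "h i" \<kappa> "\<lambda>z. \<Sum>i\<in>J. h i z"] by simp
qed (simp_all add: levy_integrands_def)

lemma one_minus_cos_le: "1 - cos x \<le> x\<^sup>2 / 2" for x :: real
proof -
  have "cos x = 1 - 2 * (sin (x/2))\<^sup>2" using cos_double_sin[of "x/2"] by simp
  moreover have "(sin (x/2))\<^sup>2 \<le> (x/2)\<^sup>2" using abs_sin_le_one abs_le_square_iff abs_sin_x_le_abs_x by blast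
  ultimately show ?thesis by (simp add: power_divide)
qed

lemma one_minus_cos_mult_le: "1 - cos (t * x) \<le> 2 * (1 + t\<^sup>2) * min 1 (x\<^sup>2)" for t x :: real
proof (cases "x\<^sup>2 \<le> 1")
  case True
  have "1 - cos (t * x) \<le> t\<^sup>2 * x\<^sup>2 / 2" using one_minus_cos_le[of "t * x"] by (simp add: power_mult_distrib)
  also have "\<dots> \<le> 2 * (1 + t\<^sup>2) * x\<^sup>2" by (simp add: algebra_simps)
  finally show ?thesis using True by simp
next
  case False
  then show ?thesis using cos_ge_minus_one[of "t * x"] by (smt (verit) min_def mult_cancel_left2 zero_le_power2)
qed

lemma integrable_cos_levy:
  assumes "h \<in> levy_integrands \<kappa>"
  shows "integrable \<kappa> (\<lambda>z. cos (h z) - 1)"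
proof (rule Bochner_Integration.integrable_bound)
  show "integrable \<kappa> (\<lambda>z. 4 * min 1 ((h z)\<^sup>2))" using assms by (simp add: levy_integrands_def)
  show "(\<lambda>z. cos (h z) - 1) \<in> borel_measurable \<kappa>" using assms by measurable
  have "norm (cos x - 1) \<le> norm (4 * min 1 (x\<^sup>2))" for x :: real
    using one_minus_cos_mult_le[of 1 x] cos_le_one[of x] by simp
  then show "AE z in \<kappa>. norm (cos (h z) - 1) \<le> norm (4 * min 1 ((h z)\<^sup>2))" by blast
qed

lemma levy_exponent_lower:
  assumes h: "h \<in> levy_integrands \<kappa>"
  shows "1 - 2 * (LINT z|\<kappa>. min 1 ((h z)\<^sup>2)) * (1 + t\<^sup>2) \<le> exp (LINT z|\<kappa>. cos (t * h z) - 1)"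
proof -
  have "- (2 * (1 + t\<^sup>2) * (LINT z|\<kappa>. min 1 ((h z)\<^sup>2))) = (LINT z|\<kappa>. - (2 * (1 + t\<^sup>2) * min 1 ((h z)\<^sup>2)))"
    by simp
  also have "\<dots> \<le> (LINT z|\<kappa>. cos (t * h z) - 1)"
  proof (rule integral_mono)
    show "integrable \<kappa> (\<lambda>z. - (2 * (1 + t\<^sup>2) * min 1 ((h z)\<^sup>2)))" using h by (simp add: levy_integrands_def)
    show "integrable \<kappa> (\<lambda>z. cos (t * h z) - 1)" by (rule integrable_cos_levy[OF levy_integrands_scale[OF h]])
    show "- (2 * (1 + t\<^sup>2) * min 1 ((h z)\<^sup>2)) \<le> cos (t * h z) - 1" for z
      using one_minus_cos_mult_le[of t "h z"] by simp
  qed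
  finally have "- (2 * (LINT z|\<kappa>. min 1 ((h z)\<^sup>2)) * (1 + t\<^sup>2)) \<le> (LINT z|\<kappa>. cos (t * h z) - 1)"
    by (simp only: mult.commute mult.left_commute)
  then show ?thesis using exp_ge_add_one_self[of "LINT z|\<kappa>. cos (t * h z) - 1"] by linarith
qed

text \<open>\<open>I h\<close> plays the role of the sum of \<open>\<plusminus>h\<close> over the points of a Poisson process with intensity
\<open>\<kappa>\<close>. It is linear only almost surely, since the exceptional set of the convergence depends on \<open>h\<close>.\<close>

locale symmetric_poisson = prob_space \<Omega> for \<Omega> :: "'w measure" +
  fixes \<kappa> :: "'z measure" and I :: "('z \<Rightarrow> real) \<Rightarrow> 'w \<Rightarrow> real"
  assumes I_measurable: "h \<in> levy_integrands \<kappa> \<Longrightarrow> I h \<in> borel_measurable \<Omega>"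
    and I_add: "h \<in> levy_integrands \<kappa> \<Longrightarrow> g \<in> levy_integrands \<kappa> \<Longrightarrow>
        AE w in \<Omega>. I (\<lambda>z. h z + g z) w = I h w + I g w"
    and I_scale: "h \<in> levy_integrands \<kappa> \<Longrightarrow> AE w in \<Omega>. I (\<lambda>z. c * h z) w = c * I h w"
    and I_char: "h \<in> levy_integrands \<kappa> \<Longrightarrow>
        (CLINT w|\<Omega>. iexp (I h w)) = exp (complex_of_real (LINT z|\<kappa>. cos (h z) - 1))"

section \<open>The symmetric Poisson integral over a sigma-finite space\<close>

lemma disjoint_Union_integral_sums:
  fixes f :: "'z \<Rightarrow> real"
  assumes A: "range A \<subseteq> sets \<kappa>" "disjoint_family (A :: nat \<Rightarrow> _)"
    and f: "integrable \<kappa> f"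
  shows "(\<lambda>k. LINT z|\<kappa>. indicator (A k) z * f z) sums (LINT z|\<kappa>. indicator (\<Union>k. A k) z * f z)"
proof -
  have [measurable]: "A k \<in> sets \<kappa>" for k using A by auto
  have [measurable]: "f \<in> borel_measurable \<kappa>" using f by auto
  have i: "integrable \<kappa> (\<lambda>z. indicator (A k) z * f z)" for k
    using integrable_mult_indicator[OF _ f, of "A k"] by simp
  have part: "(\<Sum>k<n. indicator (A k) z * f z) = indicator (\<Union>k<n. A k) z * f z" for n z
    using A(2) by (subst indicator_UN_disjoint)
      (auto simp: sum_distrib_right disjoint_family_on_def)
  have "(\<lambda>n. LINT z|\<kappa>. (\<Sum>k<n. indicator (A k) z * f z)) \<longlonglongrightarrow> (LINT z|\<kappa>. indicator (\<Union>k. A k) z * f z)"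
  proof (rule integral_dominated_convergence[where w="\<lambda>z. norm (f z)"])
    show "AE z in \<kappa>. (\<lambda>n. \<Sum>k<n. indicator (A k) z * f z) \<longlonglongrightarrow> indicator (\<Union>k. A k) z * f z"
    proof (rule AE_I2)
      fix z
      show "(\<lambda>n. \<Sum>k<n. indicator (A k) z * f z) \<longlonglongrightarrow> indicator (\<Union>k. A k) z * f z"
      proof (cases "z \<in> (\<Union>k. A k)")
        case True
        then obtain k where "z \<in> A k" by blast
        then have "\<forall>n\<ge>Suc k. (\<Sum>k<n. indicator (A k) z * f z) = indicator (\<Union>k. A k) z * f z"
          unfolding part by (auto simp: indicator_def Suc_le_eq)
        then show ?thesis
          by (intro tendsto_eventually eventually_sequentiallyI[of "Suc k"]) auto
      qed auto
    qed
    show "AE z in \<kappa>. norm (\<Sum>k<n. indicator (A k) z * f z) \<le> norm (f z)" for n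
      unfolding part by (auto simp: indicator_def)
  qed (use f in auto)
  then show ?thesis unfolding sums_def by (subst (asm) Bochner_Integration.integral_sum) (rule i)
qed

lemma disjoint_cover_integral_sums:
  fixes f :: "'z \<Rightarrow> real"
  assumes A: "range A \<subseteq> sets \<kappa>" "(\<Union>k::nat. A k) = space \<kappa>" "disjoint_family A"
    and f: "integrable \<kappa> f"
  shows "(\<lambda>k. LINT z|\<kappa>. indicator (A k) z * f z) sums (LINT z|\<kappa>. f z)"
proof -
  have "(LINT z|\<kappa>. indicator (\<Union>k. A k) z * f z) = (LINT z|\<kappa>. f z)"
    by (rule Bochner_Integration.integral_cong) (simp_all add: A(2))
  then show ?thesis using disjoint_Union_integral_sums[OF A(1,3) f] by simp
qed

text \<open>The summands \<open>X h k\<close> live on independent pieces of finite mass, so that by the tail bound a block of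
them is small in probability as soon as \<open>\<integral>min(1, h\<^sup>2)\<close> over the corresponding pieces is small.\<close>

theorem symmetric_poisson_exists:
  fixes \<kappa> :: "'z measure"
  assumes "sigma_finite_measure \<kappa>"
  shows "\<exists>(\<Omega> :: (nat \<Rightarrow> nat \<times> (nat \<Rightarrow> 'z \<times> real)) measure) I. symmetric_poisson \<Omega> \<kappa> I"
proof -
  interpret \<kappa>: sigma_finite_measure \<kappa> by fact
  obtain A :: "nat \<Rightarrow> 'z set" where A: "range A \<subseteq> sets \<kappa>" "(\<Union>k. A k) = space \<kappa>"
    "\<And>k. emeasure \<kappa> (A k) \<noteq> \<infinity>" "disjoint_family A"
    by (rule \<kappa>.sigma_finite_disjoint) blast
  have [measurable]: "A k \<in> sets \<kappa>" for k using A by auto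
  define \<mu> where "\<mu> k = density \<kappa> (indicator (A k))" for k
  have fin: "finite_measure (\<mu> k)" for k
    by (rule finite_measureI) (use A(3)[of k] sets.sets_into_space[of "A k" \<kappa>] in \<open>auto simp: \<mu>_def emeasure_density Int_absorb2\<close>)
  have \<mu>_meas: "borel_measurable (\<mu> k) = (borel_measurable \<kappa> :: ('z \<Rightarrow> real) set)" for k
    by (rule measurable_cong_sets) (simp_all add: \<mu>_def)
  have \<mu>_int: "(LINT z|\<mu> k. f z) = (LINT z|\<kappa>. indicator (A k) z * f z)"
    if "f \<in> borel_measurable \<kappa>" for f :: "'z \<Rightarrow> real" and k
  proof -
    have "\<mu> k = density \<kappa> (\<lambda>z. ennreal (indicator (A k) z))" by (simp add: \<mu>_def ennreal_indicator)
    then show ?thesis using that by (simp add: integral_density)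
  qed
  define Q :: "nat \<Rightarrow> (nat \<times> (nat \<Rightarrow> 'z \<times> real)) measure \<Rightarrow> (('z \<Rightarrow> real) \<Rightarrow> (nat \<times> (nat \<Rightarrow> 'z \<times> real)) \<Rightarrow> real) \<Rightarrow> bool"
    where "Q k W F \<longleftrightarrow> prob_space W \<and> (\<forall>h\<in>borel_measurable \<kappa>. F h \<in> borel_measurable W) \<and>
      (\<forall>h g w. F (\<lambda>z. h z + g z) w = F h w + F g w) \<and> (\<forall>h c w. F (\<lambda>z. c * h z) w = c * F h w) \<and>
      (\<forall>h\<in>borel_measurable \<kappa>. (CLINT w|W. iexp (F h w)) = exp (complex_of_real (LINT z|\<mu> k. cos (h z) - 1)))"
    for k W F
  have "\<exists>W F. Q k W F" for k
    unfolding Q_def by (rule finite_poisson_functional[OF fin[of k]], unfold \<mu>_meas) blast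
  then obtain W F where Q: "\<And>k. Q k (W k) (F k)" by metis
  have W: "prob_space (W k)" for k using Q[of k] by (simp add: Q_def)
  define \<Omega> where "\<Omega> = PiM UNIV W"
  interpret \<Omega>: prob_space \<Omega> unfolding \<Omega>_def by (intro prob_space_PiM W)
  define X where "X h k w = F k h (w k)" for h k w
  have comp: "(\<lambda>w. w k) \<in> \<Omega> \<rightarrow>\<^sub>M W k" for k unfolding \<Omega>_def by measurable
  have Fm: "F k h \<in> borel_measurable (W k)" if "h \<in> borel_measurable \<kappa>" for h k
    using Q[of k] that by (simp add: Q_def)
  have Xm: "X h k \<in> borel_measurable \<Omega>" if "h \<in> borel_measurable \<kappa>" for h k
    unfolding X_def[abs_def] by (rule measurable_compose[OF comp Fm[OF that]])
  have X_add: "X (\<lambda>z. h z + g z) k w = X h k w + X g k w" for h g k w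
    using Q[of k] unfolding Q_def X_def by blast
  have X_scale: "X (\<lambda>z. c * h z) k w = c * X h k w" for c h k w
    using Q[of k] unfolding Q_def X_def by blast
  have X_char: "(CLINT w|\<Omega>. iexp (X h k w)) = exp (complex_of_real (LINT z|\<kappa>. indicator (A k) z * (cos (h z) - 1)))"
    if h[measurable]: "h \<in> borel_measurable \<kappa>" for h k
  proof -
    have "W k = distr \<Omega> (W k) (\<lambda>w. w k)"
      unfolding \<Omega>_def by (rule distr_PiM_component[symmetric]) (auto intro: W)
    then have "(CLINT w|W k. iexp (F k h w)) = (CLINT w|distr \<Omega> (W k) (\<lambda>w. w k). iexp (F k h w))" by simp
    also have "\<dots> = (CLINT w|\<Omega>. iexp (X h k w))"
      unfolding X_def by (rule integral_distr[OF comp]) (intro measurable_compose[OF Fm[OF h]], simp)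
    finally show ?thesis using Q[of k] \<mu>_int[of "\<lambda>z. cos (h z) - 1" k] by (simp add: Q_def)
  qed
  have X_indep: "\<Omega>.indep_vars (\<lambda>_. borel) (X h) UNIV" if "h \<in> borel_measurable \<kappa>" for h
    unfolding X_def[abs_def]
  proof (rule \<Omega>.indep_vars_compose2[where M'=W and X="\<lambda>i w. w i" and Y="\<lambda>k. F k h"])
    show "\<Omega>.indep_vars W (\<lambda>i w. w i) UNIV" unfolding \<Omega>_def by (rule indep_vars_PiM_coordinate) (rule W)
  qed (rule Fm[OF that])
  have sum_char: "(CLINT w|\<Omega>. iexp (\<Sum>k\<in>K. X h k w)) =
      exp (complex_of_real (\<Sum>k\<in>K. LINT z|\<kappa>. indicator (A k) z * (cos (h z) - 1)))"
    if h: "h \<in> borel_measurable \<kappa>" and K: "finite K" for h K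
  proof -
    have iv: "\<Omega>.indep_vars (\<lambda>_. borel) (\<lambda>k w. iexp (X h k w)) K"
      by (rule \<Omega>.indep_vars_compose2[where Y="\<lambda>_. iexp", OF \<Omega>.indep_vars_subset[OF X_indep[OF h]]]) auto
    have "(CLINT w|\<Omega>. iexp (\<Sum>k\<in>K. X h k w)) = (CLINT w|\<Omega>. \<Prod>k\<in>K. iexp (X h k w))"
      using K by (simp add: sum_distrib_left exp_sum)
    also have "\<dots> = (\<Prod>k\<in>K. CLINT w|\<Omega>. iexp (X h k w))"
      by (intro \<Omega>.indep_vars_lebesgue_integral K iv \<Omega>.integrable_iexp_real Xm[OF h])
    also have "\<dots> = exp (complex_of_real (\<Sum>k\<in>K. LINT z|\<kappa>. indicator (A k) z * (cos (h z) - 1)))"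
      using K by (simp add: X_char[OF h] exp_sum)
    finally show ?thesis .
  qed
  have X_summable: "AE w in \<Omega>. summable (\<lambda>k. X h k w)" if hl: "h \<in> levy_integrands \<kappa>" for h
  proof (rule \<Omega>.indep_series_summable)
    have h[measurable]: "h \<in> borel_measurable \<kappa>" by (rule levy_integrandsD[OF hl])
    show "\<Omega>.indep_vars (\<lambda>_. borel) (X h) UNIV" by (rule X_indep[OF h])
    fix \<epsilon> \<delta> :: real assume \<epsilon>: "0 < \<epsilon>" and \<delta>: "0 < \<delta>"
    define j where "j k = (LINT z|\<kappa>. indicator (A k) z * min 1 ((h z)\<^sup>2))" for k
    have low: "- (2 * (1 + t\<^sup>2)) * j k \<le> (LINT z|\<kappa>. indicator (A k) z * (cos (t * h z) - 1))" for t k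
    proof -
      have "(LINT z|\<kappa>. - (2 * (1 + t\<^sup>2) * (indicator (A k) z * min 1 ((h z)\<^sup>2)))) \<le>
          (LINT z|\<kappa>. indicator (A k) z * (cos (t * h z) - 1))"
      proof (rule integral_mono)
        show "integrable \<kappa> (\<lambda>z. - (2 * (1 + t\<^sup>2) * (indicator (A k) z * min 1 ((h z)\<^sup>2))))"
          using integrable_mult_indicator[of "A k" \<kappa> "\<lambda>z. min 1 ((h z)\<^sup>2)"] hl by (simp add: levy_integrands_def)
        show "integrable \<kappa> (\<lambda>z. indicator (A k) z * (cos (t * h z) - 1))"
          using integrable_mult_indicator[of "A k" \<kappa> "\<lambda>z. cos (t * h z) - 1"]
            integrable_cos_levy[OF levy_integrands_scale[OF hl]] by simp
        show "- (2 * (1 + t\<^sup>2) * (indicator (A k) z * min 1 ((h z)\<^sup>2))) \<le> indicator (A k) z * (cos (t * h z) - 1)" for z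
          using one_minus_cos_mult_le[of t "h z"] by (simp add: indicator_def)
      qed
      then show ?thesis
        unfolding j_def minus_mult_left[symmetric] by (simp only: Bochner_Integration.integral_minus integral_mult_right_zero)
    qed
    have tail: "\<Omega>.prob {w \<in> space \<Omega>. \<bar>\<Sum>k\<in>{n..<m}. X h k w\<bar> > \<epsilon>} \<le> 3 * (2 * (\<Sum>k\<in>{n..<m}. j k)) * (1 + 1 / \<epsilon>\<^sup>2)" for n m
    proof (rule \<Omega>.prob_gt_le_of_char[OF _ _ \<epsilon>])
      show "(\<lambda>w. \<Sum>k = n..<m. X h k w) \<in> borel_measurable \<Omega>" using Xm[OF h] by measurable
      fix t
      let ?S = "\<Sum>k\<in>{n..<m}. LINT z|\<kappa>. indicator (A k) z * (cos (t * h z) - 1)"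
      have "(CLINT w|\<Omega>. iexp (t * (\<Sum>k = n..<m. X h k w))) = exp (complex_of_real ?S)"
        using sum_char[of "\<lambda>z. t * h z" "{n..<m}"] by (simp add: X_scale sum_distrib_left)
      then have "Re (CLINT w|\<Omega>. iexp (t * (\<Sum>k = n..<m. X h k w))) = exp ?S"
        by (simp only: exp_of_real Re_complex_of_real)
      moreover have "- (2 * (1 + t\<^sup>2)) * (\<Sum>k\<in>{n..<m}. j k) \<le> ?S"
        unfolding sum_distrib_left by (intro sum_mono low)
      moreover have "1 + ?S \<le> exp ?S" by (rule exp_ge_add_one_self)
      moreover have "2 * (\<Sum>k\<in>{n..<m}. j k) * (1 + t\<^sup>2) = 2 * (1 + t\<^sup>2) * (\<Sum>k\<in>{n..<m}. j k)" by simp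
      ultimately show "1 - 2 * (\<Sum>k\<in>{n..<m}. j k) * (1 + t\<^sup>2) \<le> Re (CLINT w|\<Omega>. iexp (t * (\<Sum>k = n..<m. X h k w)))"
        by linarith
    qed
    have "summable j"
      unfolding j_def using disjoint_cover_integral_sums[OF A(1,2,4), of "\<lambda>z. min 1 ((h z)\<^sup>2)"] hl
      by (auto simp: levy_integrands_def summable_def)
    moreover define C where "C = 6 * (1 + 1 / \<epsilon>\<^sup>2)"
    moreover have C: "0 < C" unfolding C_def by (simp add: add_pos_nonneg)
    ultimately obtain N where N: "\<And>n m. n \<ge> N \<Longrightarrow> norm (\<Sum>k\<in>{n..<m}. j k) < \<delta> / C"
      using \<delta> unfolding summable_Cauchy by (meson divide_pos_pos)
    have "\<Omega>.prob {w \<in> space \<Omega>. \<bar>\<Sum>k\<in>{n..<m}. X h k w\<bar> > \<epsilon>} \<le> \<delta>" if "n \<ge> N" for n m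
    proof -
      have "(\<Sum>k\<in>{n..<m}. j k) * C \<le> \<delta>"
        using N[OF that, of m] C by (simp add: field_simps abs_less_iff)
      then show ?thesis using tail[of n m] by (simp add: C_def algebra_simps)
    qed
    then show "\<exists>N. \<forall>n\<ge>N. \<forall>m\<ge>n. \<Omega>.prob {w \<in> space \<Omega>. \<bar>\<Sum>k\<in>{n..<m}. X h k w\<bar> > \<epsilon>} \<le> \<delta>" by blast
  qed
  define I where "I h w = (\<Sum>k. X h k w)" for h w
  have "symmetric_poisson \<Omega> \<kappa> I"
  proof unfold_locales
    fix h :: "'z \<Rightarrow> real" assume hl: "h \<in> levy_integrands \<kappa>"
    have h[measurable]: "h \<in> borel_measurable \<kappa>" by (rule levy_integrandsD[OF hl])
    show Im[measurable]: "I h \<in> borel_measurable \<Omega>"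
      unfolding I_def[abs_def] using Xm[OF h] by measurable
    show "AE w in \<Omega>. I (\<lambda>z. c * h z) w = c * I h w" for c
      using X_summable[OF hl] by eventually_elim (simp add: I_def X_scale suminf_mult)
    show "AE w in \<Omega>. I (\<lambda>z. h z + g z) w = I h w + I g w" if "g \<in> levy_integrands \<kappa>" for g
      using X_summable[OF hl] X_summable[OF that] by eventually_elim (simp add: I_def X_add suminf_add)
    have "(\<lambda>n. CLINT w|\<Omega>. iexp (\<Sum>k<n. X h k w)) \<longlonglongrightarrow> (CLINT w|\<Omega>. iexp (I h w))"
    proof (rule integral_dominated_convergence[where w="\<lambda>_. 1"])
      show "AE w in \<Omega>. (\<lambda>n. iexp (\<Sum>k<n. X h k w)) \<longlonglongrightarrow> iexp (I h w)"
        using X_summable[OF hl] unfolding I_def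
        by eventually_elim (intro tendsto_intros summable_LIMSEQ)
      show "(\<lambda>w. iexp (\<Sum>k<n. X h k w)) \<in> borel_measurable \<Omega>" for n using Xm[OF h] by measurable
    qed auto
    moreover have "(\<lambda>n. CLINT w|\<Omega>. iexp (\<Sum>k<n. X h k w)) \<longlonglongrightarrow> exp (complex_of_real (LINT z|\<kappa>. cos (h z) - 1))"
    proof -
      have "(\<lambda>n. \<Sum>k<n. LINT z|\<kappa>. indicator (A k) z * (cos (h z) - 1)) \<longlonglongrightarrow> (LINT z|\<kappa>. cos (h z) - 1)"
        using disjoint_cover_integral_sums[OF A(1,2,4) integrable_cos_levy[OF hl]] unfolding sums_def .
      then show ?thesis unfolding sum_char[OF h finite_lessThan] by (intro tendsto_intros)
    qed
    ultimately show "(CLINT w|\<Omega>. iexp (I h w)) = exp (complex_of_real (LINT z|\<kappa>. cos (h z) - 1))"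
      by (rule LIMSEQ_unique)
  qed
  then show ?thesis by blast
qed

section \<open>The random measure of the signed jumps\<close>

lemma sum_indicator_disjoint:
  fixes a :: "'i \<Rightarrow> real"
  assumes K: "finite K" and d: "disjoint_family_on E K" and f: "f 0 = (0::real)"
  shows "f (\<Sum>k\<in>K. indicator (E k) z * a k) = (\<Sum>k\<in>K. indicator (E k) z * f (a k))"
proof (cases "\<exists>j\<in>K. z \<in> E j")
  case True
  then obtain j where j: "j \<in> K" "z \<in> E j" by blast
  then have "indicator (E k) z = (0::real)" if "k \<in> K - {j}" for k
    using d that by (auto simp: disjoint_family_on_def indicator_def)
  then have "(\<Sum>k\<in>K. indicator (E k) z * b k) = b j" for b :: "'i \<Rightarrow> real"
    using j K by (simp add: sum.remove[OF K j(1)])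
  then show ?thesis by simp
next
  case False
  then show ?thesis by (simp add: f)
qed

context symmetric_poisson
begin

lemma I_lincomb:
  assumes "finite J" "\<And>i. i \<in> J \<Longrightarrow> h i \<in> levy_integrands \<kappa>"
  shows "AE w in \<Omega>. I (\<lambda>z. \<Sum>i\<in>J. c i * h i z) w = (\<Sum>i\<in>J. c i * I (h i) w)"
  using assms
proof (induction J rule: finite_induct)
  case empty
  have "(\<lambda>_. 0) \<in> levy_integrands \<kappa>" by (simp add: levy_integrands_def)
  from I_scale[OF this, of 0] show ?case by simp
next
  case (insert i J)
  have "AE w in \<Omega>. I (\<lambda>z. \<Sum>i\<in>J. c i * h i z) w = (\<Sum>i\<in>J. c i * I (h i) w)"
    using insert by auto
  moreover have "AE w in \<Omega>. I (\<lambda>z. c i * h i z + (\<Sum>i\<in>J. c i * h i z)) w =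
      I (\<lambda>z. c i * h i z) w + I (\<lambda>z. \<Sum>i\<in>J. c i * h i z) w"
    using insert by (intro I_add levy_integrands_sum levy_integrands_scale) auto
  moreover have "AE w in \<Omega>. I (\<lambda>z. c i * h i z) w = c i * I (h i) w"
    using insert by (intro I_scale) auto
  ultimately show ?case
    by eventually_elim (use insert in simp)
qed

text \<open>In particular \<open>I\<close> is continuous in probability at \<open>0\<close>.\<close>

lemma I_prob_gt_le:
  assumes h: "h \<in> levy_integrands \<kappa>" and \<epsilon>: "0 < \<epsilon>"
  shows "prob {w \<in> space \<Omega>. \<bar>I h w\<bar> > \<epsilon>} \<le> 6 * (1 + 1 / \<epsilon>\<^sup>2) * (LINT z|\<kappa>. min 1 ((h z)\<^sup>2))"
proof -
  have [measurable]: "I h \<in> borel_measurable \<Omega>" by (rule I_measurable[OF h])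
  have "prob {w \<in> space \<Omega>. \<bar>I h w\<bar> > \<epsilon>} \<le> 3 * (2 * (LINT z|\<kappa>. min 1 ((h z)\<^sup>2))) * (1 + 1 / \<epsilon>\<^sup>2)"
  proof (rule prob_gt_le_of_char[OF _ _ \<epsilon>])
    fix t
    have [measurable]: "I (\<lambda>z. t * h z) \<in> borel_measurable \<Omega>"
      by (rule I_measurable[OF levy_integrands_scale[OF h]])
    have "(CLINT w|\<Omega>. iexp (t * I h w)) = (CLINT w|\<Omega>. iexp (I (\<lambda>z. t * h z) w))"
      by (rule integral_cong_AE) (use I_scale[OF h, of t] in \<open>auto elim: eventually_mono\<close>)
    also have "\<dots> = exp (complex_of_real (LINT z|\<kappa>. cos (t * h z) - 1))"
      by (rule I_char[OF levy_integrands_scale[OF h]])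
    finally have "Re (CLINT w|\<Omega>. iexp (t * I h w)) = exp (LINT z|\<kappa>. cos (t * h z) - 1)"
      by (simp only: exp_of_real Re_complex_of_real)
    then show "1 - 2 * (LINT z|\<kappa>. min 1 ((h z)\<^sup>2)) * (1 + t\<^sup>2) \<le> Re (CLINT w|\<Omega>. iexp (t * I h w))"
      using levy_exponent_lower[OF h, of t] by simp
  qed simp
  then show ?thesis by (simp add: algebra_simps)
qed

end

locale poisson_jumps = symmetric_poisson \<Omega> \<kappa> I
  for \<Omega> :: "'w measure" and \<kappa> :: "'z measure" and I +
  fixes X :: "'z \<Rightarrow> 'b::euclidean_space"
  assumes X[measurable]: "X \<in> borel_measurable \<kappa>"
begin

text \<open>The sets over which the jumps can be summed: restricted to them, the jump sizes satisfy the
integrability condition of a Levy measure.\<close>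

definition small_sets :: "'z set set" where
  "small_sets = {E \<in> sets \<kappa>. integrable \<kappa> (\<lambda>z. indicator E z * min 1 ((norm (X z))\<^sup>2))}"

definition M :: "'z set \<Rightarrow> 'w \<Rightarrow> 'b" where
  "M E w = (\<Sum>b\<in>Basis. I (\<lambda>z. indicator E z * (X z \<bullet> b)) w *\<^sub>R b)"

lemma small_setsD: "E \<in> small_sets \<Longrightarrow> E \<in> sets \<kappa>"
  by (simp add: small_sets_def)

lemma inner_levy_integrand:
  assumes E: "E \<in> small_sets"
  shows "(\<lambda>z. indicator E z * (X z \<bullet> u)) \<in> levy_integrands \<kappa>"
proof (rule levy_integrandsI)
  have [measurable]: "E \<in> sets \<kappa>" by (rule small_setsD[OF E])
  show "(\<lambda>z. indicator E z * (X z \<bullet> u)) \<in> borel_measurable \<kappa>" by measurable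
  show "integrable \<kappa> (\<lambda>z. (1 + (norm u)\<^sup>2) * (indicator E z * min 1 ((norm (X z))\<^sup>2)))"
    using E unfolding small_sets_def by (intro integrable_mult_right) auto
  have "(X z \<bullet> u)\<^sup>2 \<le> (norm u * norm (X z))\<^sup>2" for z
    using Cauchy_Schwarz_ineq2[of "X z" u] by (simp add: abs_le_square_iff[symmetric] abs_mult mult.commute)
  then have "min 1 ((X z \<bullet> u)\<^sup>2) \<le> (1 + (norm u)\<^sup>2) * min 1 ((norm (X z))\<^sup>2)" for z
    using min_square_mult_le[of "norm u" "norm (X z)"] by (smt (verit))
  then show "min 1 ((indicator E z * (X z \<bullet> u))\<^sup>2) \<le> (1 + (norm u)\<^sup>2) * (indicator E z * min 1 ((norm (X z))\<^sup>2))" for z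
    by (simp add: indicator_def)
qed

lemma M_measurable: "E \<in> small_sets \<Longrightarrow> M E \<in> borel_measurable \<Omega>"
  unfolding M_def[abs_def]
  by (intro borel_measurable_sum borel_measurable_scaleR I_measurable inner_levy_integrand) auto

lemma M_inner_Basis: "b \<in> Basis \<Longrightarrow> M E w \<bullet> b = I (\<lambda>z. indicator E z * (X z \<bullet> b)) w"
  by (simp add: M_def inner_sum_left inner_Basis if_distrib[where f="\<lambda>x. _ * x"] sum.delta' cong: if_cong)

lemma M_inner:
  assumes E: "E \<in> small_sets"
  shows "AE w in \<Omega>. M E w \<bullet> u = I (\<lambda>z. indicator E z * (X z \<bullet> u)) w"
proof -
  have "AE w in \<Omega>. I (\<lambda>z. \<Sum>b\<in>Basis. (b \<bullet> u) * (indicator E z * (X z \<bullet> b))) w =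
      (\<Sum>b\<in>Basis. (b \<bullet> u) * I (\<lambda>z. indicator E z * (X z \<bullet> b)) w)"
    by (rule I_lincomb) (auto intro: inner_levy_integrand[OF E])
  moreover have "(\<Sum>b\<in>Basis. (b \<bullet> u) * (indicator E z * (X z \<bullet> b))) = indicator E z * (X z \<bullet> u)" for z
    by (subst euclidean_inner[of "X z" u]) (simp add: sum_distrib_left inner_commute algebra_simps)
  moreover have "M E w \<bullet> u = (\<Sum>b\<in>Basis. (b \<bullet> u) * I (\<lambda>z. indicator E z * (X z \<bullet> b)) w)" for w
    by (simp add: M_def inner_sum_left mult.commute)
  ultimately show ?thesis by (auto elim!: eventually_mono)
qed

text \<open>Since the sets are disjoint, at every point of the space at most one term of the integrand is
nonzero, and the exponent splits into a sum. This contains both the characteristic function of a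
single value and the independence of several.\<close>

lemma M_joint_char:
  assumes J: "finite J" and E: "\<And>i. i \<in> J \<Longrightarrow> E i \<in> small_sets" and d: "disjoint_family_on E J"
  shows "(CLINT w|\<Omega>. iexp (\<Sum>i\<in>J. M (E i) w \<bullet> u i)) =
    exp (complex_of_real (\<Sum>i\<in>J. LINT z|\<kappa>. indicator (E i) z * (cos (X z \<bullet> u i) - 1)))"
proof -
  let ?h = "\<lambda>i z. indicator (E i) z * (X z \<bullet> u i)"
  have h: "?h i \<in> levy_integrands \<kappa>" if "i \<in> J" for i by (rule inner_levy_integrand[OF E[OF that]])
  have hs: "(\<lambda>z. \<Sum>i\<in>J. ?h i z) \<in> levy_integrands \<kappa>" using h by (rule levy_integrands_sum)
  have "AE w in \<Omega>. \<forall>i\<in>J. M (E i) w \<bullet> u i = I (?h i) w"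
    using J M_inner[OF E] by (intro AE_finite_allI) auto
  moreover have "AE w in \<Omega>. I (\<lambda>z. \<Sum>i\<in>J. 1 * ?h i z) w = (\<Sum>i\<in>J. 1 * I (?h i) w)"
    by (rule I_lincomb[OF J h])
  ultimately have "AE w in \<Omega>. (\<Sum>i\<in>J. M (E i) w \<bullet> u i) = I (\<lambda>z. \<Sum>i\<in>J. ?h i z) w"
    by eventually_elim simp
  then have "(CLINT w|\<Omega>. iexp (\<Sum>i\<in>J. M (E i) w \<bullet> u i)) = (CLINT w|\<Omega>. iexp (I (\<lambda>z. \<Sum>i\<in>J. ?h i z) w))"
    using M_measurable[OF E] I_measurable[OF hs]
    by (intro integral_cong_AE) (auto elim!: eventually_mono simp del: of_real_sum)
  also have "\<dots> = exp (complex_of_real (LINT z|\<kappa>. cos (\<Sum>i\<in>J. ?h i z) - 1))"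
    by (rule I_char[OF hs])
  also have "(LINT z|\<kappa>. cos (\<Sum>i\<in>J. ?h i z) - 1) = (LINT z|\<kappa>. (\<Sum>i\<in>J. indicator (E i) z * (cos (X z \<bullet> u i) - 1)))"
    using sum_indicator_disjoint[OF J d, of "\<lambda>x. cos x - 1"] by (intro Bochner_Integration.integral_cong) auto
  also have "\<dots> = (\<Sum>i\<in>J. LINT z|\<kappa>. indicator (E i) z * (cos (X z \<bullet> u i) - 1))"
  proof (rule Bochner_Integration.integral_sum)
    fix i assume i: "i \<in> J"
    have "(\<lambda>z. cos (?h i z) - 1) = (\<lambda>z. indicator (E i) z * (cos (X z \<bullet> u i) - 1))"
      by (auto simp: indicator_def)
    then show "integrable \<kappa> (\<lambda>z. indicator (E i) z * (cos (X z \<bullet> u i) - 1))"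
      using integrable_cos_levy[OF h[OF i]] by simp
  qed
  finally show ?thesis .
qed

lemma M_char:
  assumes "E \<in> small_sets"
  shows "(CLINT w|\<Omega>. iexp (M E w \<bullet> u)) = exp (complex_of_real (LINT z|\<kappa>. indicator E z * (cos (X z \<bullet> u) - 1)))"
  using M_joint_char[of "{()}" "\<lambda>_. E" "\<lambda>_. u"] assms by (simp add: disjoint_family_on_def)

lemma M_indep:
  assumes E: "\<And>i. i \<in> J \<Longrightarrow> E i \<in> small_sets" and d: "disjoint_family_on E J"
  shows "indep_vars (\<lambda>_. borel) (\<lambda>i. M (E i)) J"
proof (rule indep_vars_of_joint_char)
  show "M (E i) \<in> borel_measurable \<Omega>" if "i \<in> J" for i by (rule M_measurable[OF E[OF that]])
  fix K u assume K: "K \<subseteq> J" "finite K"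
  have EK: "E i \<in> small_sets" if "i \<in> K" for i using K E that by auto
  have dK: "disjoint_family_on E K" using d K by (auto simp: disjoint_family_on_def)
  have "(CLINT w|\<Omega>. iexp (\<Sum>i\<in>K. M (E i) w \<bullet> u i)) =
      exp (complex_of_real (\<Sum>i\<in>K. LINT z|\<kappa>. indicator (E i) z * (cos (X z \<bullet> u i) - 1)))"
    by (rule M_joint_char[OF K(2) EK dK])
  also have "\<dots> = (\<Prod>i\<in>K. CLINT w|\<Omega>. iexp (M (E i) w \<bullet> u i))"
    using K(2) EK by (simp add: exp_sum M_char cong: prod.cong)
  finally show "(CLINT w|\<Omega>. iexp (\<Sum>i\<in>K. M (E i) w \<bullet> u i)) = (\<Prod>i\<in>K. CLINT w|\<Omega>. iexp (M (E i) w \<bullet> u i))" .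
qed

text \<open>Coordinate by coordinate, the values on the sets \<open>E n\<close> are independent and their series satisfies
the Cauchy criterion in probability, so it converges almost surely. Its limit is identified because
the difference to the partial sums is the functional of the tail, which tends to zero in probability.\<close>

lemma M_countably_additive:
  fixes E :: "nat \<Rightarrow> 'z set"
  assumes E: "\<And>n. E n \<in> small_sets" and d: "disjoint_family E" and UE: "(\<Union>n. E n) \<in> small_sets"
  shows "AE w in \<Omega>. (\<lambda>n. M (E n) w) sums M (\<Union>n. E n) w"
proof -
  let ?F = "\<Union>n. E n"
  have [measurable]: "E n \<in> sets \<kappa>" for n by (rule small_setsD[OF E])
  have coord: "AE w in \<Omega>. (\<lambda>n. M (E n) w \<bullet> b) sums (M ?F w \<bullet> b)" if b: "b \<in> Basis" for b
  proof -
    define x where "x z = X z \<bullet> b" for z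
    have [measurable]: "x \<in> borel_measurable \<kappa>" unfolding x_def[abs_def] by measurable
    define h where "h n = (\<lambda>z. indicator (E n) z * x z)" for n
    have h: "h n \<in> levy_integrands \<kappa>" for n unfolding h_def x_def by (rule inner_levy_integrand[OF E])
    define H where "H = (\<lambda>z. indicator ?F z * x z)"
    have H: "H \<in> levy_integrands \<kappa>" unfolding H_def x_def by (rule inner_levy_integrand[OF UE])
    define g where "g z = indicator ?F z * min 1 ((x z)\<^sup>2)" for z
    have gH: "g = (\<lambda>z. min 1 ((H z)\<^sup>2))" by (auto simp: g_def H_def indicator_def)
    have g: "integrable \<kappa> g" using H unfolding gH by (simp add: levy_integrands_def)
    define j where "j n = (LINT z|\<kappa>. indicator (E n) z * g z)" for n
    have ig: "integrable \<kappa> (\<lambda>z. indicator (E n) z * g z)" for n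
      using integrable_mult_indicator[OF _ g, of "E n"] by simp
    have j_sums: "j sums (LINT z|\<kappa>. g z)"
    proof -
      have "j sums (LINT z|\<kappa>. indicator ?F z * g z)"
        unfolding j_def by (rule disjoint_Union_integral_sums) (use d g in auto)
      moreover have "indicator ?F z * g z = g z" for z
        by (cases "z \<in> ?F") (simp_all only: g_def indicator_simps, simp_all)
      ultimately show ?thesis by simp
    qed
    have dK: "disjoint_family_on E K" for K using d by (auto simp: disjoint_family_on_def)
    have gE: "indicator (E k) z * min 1 ((x z)\<^sup>2) = indicator (E k) z * g z" for k z
      by (simp add: g_def indicator_def) blast
    have Jsum: "(LINT z|\<kappa>. min 1 ((\<Sum>k\<in>K. h k z)\<^sup>2)) = (\<Sum>k\<in>K. j k)" if "finite K" for K
    proof -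
      have "min 1 ((\<Sum>k\<in>K. h k z)\<^sup>2) = (\<Sum>k\<in>K. indicator (E k) z * g z)" for z
        unfolding h_def using sum_indicator_disjoint[OF that dK, of "\<lambda>y. min 1 (y\<^sup>2)" z "\<lambda>_. x z"] by (simp add: gE)
      then show ?thesis unfolding j_def using ig by (simp add: Bochner_Integration.integral_sum)
    qed
    have hK: "(\<lambda>z. \<Sum>k\<in>K. h k z) \<in> levy_integrands \<kappa>" for K by (rule levy_integrands_sum) (rule h)
    have IK: "AE w in \<Omega>. I (\<lambda>z. \<Sum>k\<in>K. h k z) w = (\<Sum>k\<in>K. I (h k) w)" if "finite K" for K
      using I_lincomb[OF that h, of "\<lambda>_. 1"] by simp
    have Ihm[measurable]: "I (h k) \<in> borel_measurable \<Omega>" for k by (rule I_measurable[OF h])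
    have IHm[measurable]: "I H \<in> borel_measurable \<Omega>" by (rule I_measurable[OF H])
    have Mh: "M (E k) w \<bullet> b = I (h k) w" for k w unfolding h_def x_def by (rule M_inner_Basis[OF b])
    have MH: "M ?F w \<bullet> b = I H w" for w unfolding H_def x_def by (rule M_inner_Basis[OF b])
    have ind: "indep_vars (\<lambda>_. borel) (\<lambda>k. I (h k)) UNIV"
      unfolding Mh[symmetric]
      by (rule indep_vars_compose2[where Y="\<lambda>_ v. v \<bullet> b", OF M_indep[of UNIV E]]) (use E d in auto)
    have prob_cong: "prob {w \<in> space \<Omega>. \<bar>f w\<bar> > \<epsilon>} = prob {w \<in> space \<Omega>. \<bar>f' w\<bar> > \<epsilon>}"
      if [measurable]: "f \<in> borel_measurable \<Omega>" "f' \<in> borel_measurable \<Omega>" and "AE w in \<Omega>. f w = f' w" for f f' :: "'w \<Rightarrow> real" and \<epsilon> :: real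
      using that(3) by (intro finite_measure_eq_AE) (auto elim: eventually_mono)
    have summ: "AE w in \<Omega>. summable (\<lambda>k. I (h k) w)"
    proof (rule indep_series_summable[OF ind])
      fix \<epsilon> \<delta> :: real assume \<epsilon>: "0 < \<epsilon>" and \<delta>: "0 < \<delta>"
      define C where "C = 6 * (1 + 1 / \<epsilon>\<^sup>2)"
      have C: "0 < C" unfolding C_def by (simp add: add_pos_nonneg)
      have "summable j" using j_sums by (rule sums_summable)
      then obtain N where N: "\<And>n m. n \<ge> N \<Longrightarrow> norm (\<Sum>k\<in>{n..<m}. j k) < \<delta> / C"
        using \<delta> C unfolding summable_Cauchy by (meson divide_pos_pos)
      have "prob {w \<in> space \<Omega>. \<bar>\<Sum>k\<in>{n..<m}. I (h k) w\<bar> > \<epsilon>} \<le> \<delta>" if "n \<ge> N" for n m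
      proof -
        have "prob {w \<in> space \<Omega>. \<bar>\<Sum>k\<in>{n..<m}. I (h k) w\<bar> > \<epsilon>} =
            prob {w \<in> space \<Omega>. \<bar>I (\<lambda>z. \<Sum>k\<in>{n..<m}. h k z) w\<bar> > \<epsilon>}"
          using IK[of "{n..<m}"] I_measurable[OF hK] by (intro prob_cong) (auto elim: eventually_mono)
        also have "\<dots> \<le> C * (\<Sum>k\<in>{n..<m}. j k)"
          unfolding C_def using I_prob_gt_le[OF hK \<epsilon>, of "{n..<m}"] by (simp only: Jsum[OF finite_atLeastLessThan])
        also have "\<dots> \<le> \<delta>" using N[OF that, of m] C by (simp add: field_simps abs_less_iff)
        finally show ?thesis .
      qed
      then show "\<exists>N. \<forall>n\<ge>N. \<forall>m\<ge>n. prob {w \<in> space \<Omega>. \<bar>\<Sum>k\<in>{n..<m}. I (h k) w\<bar> > \<epsilon>} \<le> \<delta>" by blast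
    qed
    have lim: "AE w in \<Omega>. (\<Sum>k. I (h k) w) = I H w"
    proof (rule AE_eq_of_limits[where f="\<lambda>n w. \<Sum>k<n. I (h k) w"])
      show "AE w in \<Omega>. (\<lambda>n. \<Sum>k<n. I (h k) w) \<longlonglongrightarrow> (\<Sum>k. I (h k) w)"
        using summ by eventually_elim (rule summable_LIMSEQ)
      fix \<epsilon> :: real assume \<epsilon>: "0 < \<epsilon>"
      define r where "r n = (\<lambda>z. H z + - 1 * (\<Sum>k<n. h k z))" for n
      have r: "r n \<in> levy_integrands \<kappa>" for n
        unfolding r_def by (rule levy_integrands_add[OF H levy_integrands_scale[OF hK]])
      have rJ: "(LINT z|\<kappa>. min 1 ((r n z)\<^sup>2)) = (LINT z|\<kappa>. g z) - (\<Sum>k<n. j k)" for n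
      proof -
        have part: "(\<Sum>k<n. indicator (E k) z * a) = indicator (\<Union>k<n. E k) z * a" for z and a :: real
          using dK[of "{..<n}"] by (subst indicator_UN_disjoint) (auto simp: sum_distrib_right)
        have "min 1 ((r n z)\<^sup>2) = g z - (\<Sum>k<n. indicator (E k) z * g z)" for z
          unfolding r_def H_def h_def part by (auto simp: g_def indicator_def)
        then have "(LINT z|\<kappa>. min 1 ((r n z)\<^sup>2)) = (LINT z|\<kappa>. g z - (\<Sum>k<n. indicator (E k) z * g z))"
          by (simp only:)
        also have "\<dots> = (LINT z|\<kappa>. g z) - (\<Sum>k<n. j k)"
          unfolding j_def
          by (subst Bochner_Integration.integral_diff[OF g Bochner_Integration.integrable_sum[OF ig]])
            (simp only: Bochner_Integration.integral_sum[OF ig])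
        finally show ?thesis .
      qed
      have ae: "AE w in \<Omega>. I (r n) w = I H w - (\<Sum>k<n. I (h k) w)" for n
        using I_add[OF H levy_integrands_scale[where c="-1", OF hK[of "{..<n}"]]] I_scale[where c="-1", OF hK, of "{..<n}"] IK[OF finite_lessThan[of n]]
        unfolding r_def by eventually_elim simp
      have "prob {w \<in> space \<Omega>. \<bar>(\<Sum>k<n. I (h k) w) - I H w\<bar> > \<epsilon>} = prob {w \<in> space \<Omega>. \<bar>I (r n) w\<bar> > \<epsilon>}" for n
        using I_measurable[OF r, of n] ae[of n]
        by (intro finite_measure_eq_AE) (auto elim!: eventually_mono simp: abs_minus_commute)
      then have le: "prob {w \<in> space \<Omega>. \<bar>(\<Sum>k<n. I (h k) w) - I H w\<bar> > \<epsilon>} \<le>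
          6 * (1 + 1 / \<epsilon>\<^sup>2) * ((LINT z|\<kappa>. g z) - (\<Sum>k<n. j k))" for n
        using I_prob_gt_le[OF r \<epsilon>, of n] by (simp add: rJ)
      have "(\<lambda>n. 6 * (1 + 1 / \<epsilon>\<^sup>2) * ((LINT z|\<kappa>. g z) - (\<Sum>k<n. j k))) \<longlonglongrightarrow>
          6 * (1 + 1 / \<epsilon>\<^sup>2) * ((LINT z|\<kappa>. g z) - (LINT z|\<kappa>. g z))"
        using j_sums unfolding sums_def by (intro tendsto_intros)
      then have to0: "(\<lambda>n. 6 * (1 + 1 / \<epsilon>\<^sup>2) * ((LINT z|\<kappa>. g z) - (\<Sum>k<n. j k))) \<longlonglongrightarrow> 0" by simp
      show "(\<lambda>n. prob {w \<in> space \<Omega>. \<bar>(\<Sum>k<n. I (h k) w) - I H w\<bar> > \<epsilon>}) \<longlonglongrightarrow> 0"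
        by (rule tendsto_sandwich[OF _ _ tendsto_const to0]) (use le in auto)
    qed auto
    from summ lim show ?thesis
      unfolding Mh MH by eventually_elim (metis summable_sums)
  qed
  have "AE w in \<Omega>. \<forall>b\<in>Basis. (\<lambda>n. M (E n) w \<bullet> b) sums (M ?F w \<bullet> b)"
    using coord by (intro AE_finite_allI) auto
  then show ?thesis
  proof eventually_elim
    case (elim w)
    then show ?case
      unfolding sums_def by (subst tendsto_componentwise_iff) (simp add: inner_sum_left)
  qed
qed

end

section \<open>Powers of a symmetric matrix\<close>

lemma symmetric_matrix_inner:
  fixes A :: "real^'m^'m"
  assumes "transpose A = A"
  shows "(A *v x) \<bullet> y = x \<bullet> (A *v y)"
  using dot_lmul_matrix[of x A y] assms by (metis transpose_matrix_vector)

text \<open>A minimiser \<open>x\<close> of the Rayleigh quotient on the unit sphere of the subspace is an eigenvector: the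
quadratic form \<open>g\<close> is nonnegative on the subspace and vanishes at \<open>x\<close>, so its derivative at \<open>x\<close> in
the direction of \<open>y = A x - c x\<close>, which is \<open>2 \<langle>y, y\<rangle>\<close>, must vanish.\<close>

lemma symmetric_eigenvector_in_invariant_subspace:
  fixes A :: "real^'m^'m"
  assumes sym: "transpose A = A" and W: "subspace W" and inv: "\<And>x. x \<in> W \<Longrightarrow> A *v x \<in> W"
    and v: "v \<in> W" "v \<noteq> 0"
  shows "\<exists>x\<in>W. \<exists>c. norm x = 1 \<and> A *v x = c *\<^sub>R x"
proof -
  let ?K = "W \<inter> sphere 0 1"
  have "compact ?K" using closed_subspace[OF W] compact_sphere[of "0 :: real^'m" 1] by (metis closed_Int_compact)
  moreover have "v /\<^sub>R norm v \<in> ?K" using v W by (auto intro: subspace_scale)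
  then have "?K \<noteq> {}" by blast
  moreover have "continuous_on ?K (\<lambda>x. (A *v x) \<bullet> x)"
    by (intro continuous_intros linear_continuous_on matrix_vector_mul_bounded_linear)
  ultimately have "\<exists>x\<in>?K. \<forall>y\<in>?K. (A *v x) \<bullet> x \<le> (A *v y) \<bullet> y"
    by (rule continuous_attains_inf)
  then obtain x where x: "x \<in> ?K" and xmin: "\<And>y. y \<in> ?K \<Longrightarrow> (A *v x) \<bullet> x \<le> (A *v y) \<bullet> y"
    by blast
  define c where "c = (A *v x) \<bullet> x"
  define g where "g y = (A *v y) \<bullet> y - c * (y \<bullet> y)" for y
  have xx: "x \<bullet> x = 1" using x by (simp add: dot_square_norm)
  have g0: "0 \<le> g y" if "y \<in> W" for y
  proof (cases "y = 0")
    case False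
    then have "y /\<^sub>R norm y \<in> ?K" using that W by (auto intro: subspace_scale)
    from xmin[OF this] have "c \<le> (A *v y) \<bullet> y / (norm y)\<^sup>2"
      by (simp add: c_def scaleR_matrix_vector_assoc[symmetric] matrix_vector_mult_scaleR power2_eq_square divide_inverse mult_ac)
    then show ?thesis using False by (simp add: g_def dot_square_norm field_simps)
  qed (simp add: g_def)
  define y where "y = A *v x - c *\<^sub>R x"
  have y: "y \<in> W" unfolding y_def using x inv W by (auto intro!: subspace_diff subspace_scale)
  have gt: "g (x + t *\<^sub>R y) = 2 * t * (y \<bullet> y) + t\<^sup>2 * g y" for t
  proof -
    have "x \<bullet> (A *v y) = (A *v x) \<bullet> y" by (simp add: symmetric_matrix_inner[OF sym])
    then have "g (x + t *\<^sub>R y) = g x + 2 * t * ((A *v x) \<bullet> y - c * (x \<bullet> y)) + t\<^sup>2 * g y"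
      by (simp add: g_def matrix_vector_right_distrib matrix_vector_mult_scaleR inner_add_left inner_add_right
          inner_commute[of "A *v y" x] inner_commute[of y x] power2_eq_square algebra_simps)
    moreover have "g x = 0" by (simp add: g_def c_def xx)
    moreover have "(A *v x) \<bullet> y - c * (x \<bullet> y) = y \<bullet> y"
    proof -
      have "(A *v x) \<bullet> y - c * (x \<bullet> y) = (A *v x - c *\<^sub>R x) \<bullet> y" by (simp add: inner_diff_left)
      then show ?thesis unfolding y_def[symmetric] .
    qed
    ultimately show ?thesis by simp
  qed
  have "y \<bullet> y \<le> 0"
  proof (rule ccontr)
    assume "\<not> y \<bullet> y \<le> 0"
    then have pos: "0 < y \<bullet> y" by linarith
    \<comment> \<open>Adding one to the denominator covers the case \<open>g y = 0\<close>.\<close>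
    define t where "t = - (y \<bullet> y) / (g y + 1)"
    have gy: "0 \<le> g y" by (rule g0[OF y])
    have "0 \<le> g (x + t *\<^sub>R y)" using x y W by (intro g0 subspace_add subspace_scale) auto
    also have "\<dots> = (y \<bullet> y)\<^sup>2 / (g y + 1) * (g y / (g y + 1) - 2)"
      unfolding gt t_def
    proof -
      have "2 * (- q / d) * q + (- q / d)\<^sup>2 * e = q\<^sup>2 / d * (e / d - 2)" for q d e :: real
        by (simp add: power2_eq_square algebra_simps)
      then show "2 * (- (y \<bullet> y) / (g y + 1)) * (y \<bullet> y) + (- (y \<bullet> y) / (g y + 1))\<^sup>2 * g y =
        (y \<bullet> y)\<^sup>2 / (g y + 1) * (g y / (g y + 1) - 2)" .
    qed
    also have "\<dots> < 0"
      using gy pos by (intro mult_pos_neg) (auto simp: field_simps)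
    finally show False by simp
  qed
  then have "y = 0" by (metis inner_eq_zero_iff inner_ge_zero order_antisym)
  then show ?thesis using x by (intro bexI[of _ x] exI[of _ c]) (auto simp: y_def)
qed

text \<open>Take an orthonormal set of eigenvectors of maximal size. Its orthogonal complement is invariant, so
a nonzero vector in it would produce one more eigenvector.\<close>

lemma symmetric_orthonormal_eigenbasis:
  fixes A :: "real^'m^'m"
  assumes sym: "transpose A = A"
  obtains C :: "(real^'m) set" and l where "finite C" "pairwise orthogonal C" "\<And>c. c \<in> C \<Longrightarrow> norm c = 1"
    "\<And>c. c \<in> C \<Longrightarrow> A *v c = l c *\<^sub>R c" "span C = UNIV"
proof -
  let ?P = "\<lambda>C::(real^'m) set. pairwise orthogonal C \<and> (\<forall>c\<in>C. norm c = 1 \<and> (\<exists>l. A *v c = l *\<^sub>R c))"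
  have fin: "finite C \<and> card C \<le> DIM(real^'m)" if "?P C" for C
    by (rule independent_bound, rule pairwise_orthogonal_independent) (use that in auto)
  have "\<exists>C. ?P C \<and> (\<forall>D. ?P D \<longrightarrow> card D \<le> card C)"
    by (rule Lattices_Big.ex_has_greatest_nat[of ?P "{}" card "Suc DIM(real^'m)"]) (use fin in \<open>auto simp: less_Suc_eq_le\<close>)
  then obtain C where C: "?P C" and max: "\<And>D. ?P D \<Longrightarrow> card D \<le> card C" by blast
  have "v = 0" if v: "\<forall>c\<in>C. v \<bullet> c = 0" for v
  proof (rule ccontr)
    assume "v \<noteq> 0"
    let ?W = "{x. \<forall>c\<in>C. x \<bullet> c = 0}"
    have "subspace ?W" by (auto simp: subspace_def inner_add_left)
    moreover have "A *v x \<in> ?W" if "x \<in> ?W" for x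
    proof safe
      fix c assume c: "c \<in> C"
      then obtain l where "A *v c = l *\<^sub>R c" using C by blast
      then show "(A *v x) \<bullet> c = 0" using that c by (simp add: symmetric_matrix_inner[OF sym])
    qed
    ultimately obtain x c where x: "x \<in> ?W" "norm x = 1" "A *v x = c *\<^sub>R x"
      using symmetric_eigenvector_in_invariant_subspace[OF sym, of ?W v] v \<open>v \<noteq> 0\<close> by blast
    have "x \<notin> C" using x by (metis (mono_tags) dot_square_norm mem_Collect_eq one_neq_zero power_one)
    have "?P (insert x C)"
      using C x by (auto simp: pairwise_insert orthogonal_def inner_commute)
    then have "card (insert x C) \<le> card C" by (rule max)
    then show False using fin[OF C] \<open>x \<notin> C\<close> by simp
  qed
  then have orth: "\<And>v. (\<And>c. c \<in> C \<Longrightarrow> orthogonal v c) \<Longrightarrow> v = 0" by (auto simp: orthogonal_def)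
  have "span C = UNIV"
  proof (rule ccontr)
    assume "span C \<noteq> UNIV"
    then obtain a where "a \<noteq> 0" "\<And>x. x \<in> span C \<Longrightarrow> orthogonal a x"
      using orthogonal_to_subspace_exists_gen[of C UNIV] by (auto simp: psubset_eq)
    then show False using orth[of a] by (auto intro: span_base)
  qed
  moreover obtain l where "\<And>c. c \<in> C \<Longrightarrow> A *v c = l c *\<^sub>R c" using C by metis
  ultimately show thesis using C fin[OF C] by (intro that[of C l]) auto
qed

lemma sum_matrix_vector_mult:
  fixes f :: "'i \<Rightarrow> real^'n^'m"
  shows "(\<Sum>i\<in>I. f i) *v x = (\<Sum>i\<in>I. f i *v x)"
  by (induction I rule: infinite_finite_induct) (simp_all add: matrix_vector_mult_add_rdistrib)

locale matrix_eigenbasis =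
  fixes A :: "real^'m^'m" and C :: "(real^'m) set" and l :: "real^'m \<Rightarrow> real"
  assumes fin: "finite C" and orth: "pairwise orthogonal C" and nrm: "\<And>c. c \<in> C \<Longrightarrow> norm c = 1"
    and eig: "\<And>c. c \<in> C \<Longrightarrow> A *v c = l c *\<^sub>R c" and sp: "span C = UNIV"
begin

lemma expand: "(\<Sum>c\<in>C. (x \<bullet> c) *\<^sub>R c) = x"
  by (rule orthonormal_basis_expand) (use orth nrm sp fin in auto)

lemma norm_combination: "(norm (\<Sum>c\<in>C. a c *\<^sub>R c))\<^sup>2 = (\<Sum>c\<in>C. (a c)\<^sup>2)"
proof -
  have "(norm (\<Sum>c\<in>C. a c *\<^sub>R c))\<^sup>2 = (\<Sum>c\<in>C. (norm (a c *\<^sub>R c))\<^sup>2)"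
    using orth by (intro norm_sum_Pythagorean fin) (auto simp: pairwise_def orthogonal_clauses)
  then show ?thesis using nrm by simp
qed

lemma mat_power_eigen: "mat_power n A *v x = (\<Sum>c\<in>C. l c ^ n *\<^sub>R ((x \<bullet> c) *\<^sub>R c))"
proof (induction n)
  case 0
  then show ?case by (simp add: mat_power_def expand)
next
  case (Suc n)
  have "mat_power (Suc n) A *v x = A *v (mat_power n A *v x)"
    by (simp add: mat_power_def matrix_vector_mul_assoc)
  also have "\<dots> = (\<Sum>c\<in>C. A *v (l c ^ n *\<^sub>R ((x \<bullet> c) *\<^sub>R c)))"
    unfolding Suc by (rule linear_sum[OF matrix_vector_mul_linear])
  also have "\<dots> = (\<Sum>c\<in>C. l c ^ Suc n *\<^sub>R ((x \<bullet> c) *\<^sub>R c))"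
    by (rule sum.cong) (simp_all add: matrix_vector_mult_scaleR eig mult_ac)
  finally show ?case .
qed

text \<open>The matrix is a combination of the projections \<open>R c\<close> onto the eigenvectors, with which the
exponential series is summed term by term.\<close>

lemma mat_exp_eigen: "mat_exp A *v x = (\<Sum>c\<in>C. (exp (l c) * (x \<bullet> c)) *\<^sub>R c)"
proof -
  define R :: "real^'m \<Rightarrow> real^'m^'m" where "R c = (\<chi> i j. c $ i * c $ j)" for c
  have R: "R c *v x = (x \<bullet> c) *\<^sub>R c" for c x
    by (simp add: R_def vec_eq_iff matrix_vector_mult_def inner_vec_def sum_distrib_left sum_distrib_right mult_ac)
  have P: "mat_power n A = (\<Sum>c\<in>C. l c ^ n *\<^sub>R R c)" for n
    unfolding matrix_eq
    by (simp add: mat_power_eigen R sum_matrix_vector_mult scaleR_matrix_vector_assoc[symmetric])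
  have "(\<lambda>n. mat_power n A /\<^sub>R fact n) sums (\<Sum>c\<in>C. exp (l c) *\<^sub>R R c)"
  proof -
    have "(\<lambda>n. \<Sum>c\<in>C. (l c ^ n /\<^sub>R fact n) *\<^sub>R R c) sums (\<Sum>c\<in>C. exp (l c) *\<^sub>R R c)"
      by (intro sums_sum sums_scaleR_left exp_converges)
    then show ?thesis by (simp add: P scaleR_sum_right)
  qed
  then have "mat_exp A = (\<Sum>c\<in>C. exp (l c) *\<^sub>R R c)" unfolding mat_exp_def by (rule sums_unique[symmetric])
  then show ?thesis by (simp add: R sum_matrix_vector_mult scaleR_matrix_vector_assoc[symmetric])
qed

text \<open>Pairing a complex eigenvector with the real basis vectors shows that its eigenvalue is one of the
\<open>l c\<close>. Besides realness this provides the finiteness without which the minimum in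
\<^const>\<open>min_eig_Re\<close> would be meaningless.\<close>

lemma eigenvalues_subset: 
  assumes sym: "transpose A = A"
  shows "eigenvalues A \<subseteq> (\<lambda>c. complex_of_real (l c)) ` C"
proof
  fix z assume "z \<in> eigenvalues A"
  then obtain v :: "complex^'m" where v: "v \<noteq> 0" "(\<chi> i j. complex_of_real (A $ i $ j)) *v v = z *s v"
    unfolding eigenvalues_def by blast
  define f where "f c = (\<Sum>i\<in>UNIV. v $ i * complex_of_real (c $ i))" for c :: "real^'m"
  have zf: "z * f c = complex_of_real (l c) * f c" if c: "c \<in> C" for c
  proof -
    have "z * f c = (\<Sum>i\<in>UNIV. (z *s v) $ i * complex_of_real (c $ i))"
      by (simp add: f_def sum_distrib_left mult_ac)
    also have "\<dots> = (\<Sum>i\<in>UNIV. (\<Sum>j\<in>UNIV. complex_of_real (A $ i $ j) * v $ j) * complex_of_real (c $ i))"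
      unfolding v(2)[symmetric] by (simp add: matrix_vector_mult_def)
    also have "\<dots> = (\<Sum>j\<in>UNIV. v $ j * (\<Sum>i\<in>UNIV. complex_of_real (A $ i $ j * c $ i)))"
      unfolding sum_distrib_left sum_distrib_right by (subst sum.swap) (simp add: mult_ac)
    also have "\<dots> = (\<Sum>j\<in>UNIV. v $ j * complex_of_real ((A *v c) $ j))"
    proof -
      have "A $ i $ j = A $ j $ i" for i j using sym by (metis transpose_def vec_lambda_beta)
      then show ?thesis by (simp add: matrix_vector_mult_def)
    qed
    also have "\<dots> = complex_of_real (l c) * f c"
      by (simp add: eig[OF c] f_def sum_distrib_left mult_ac)
    finally show ?thesis .
  qed
  have "\<exists>c\<in>C. f c \<noteq> 0"
  proof (rule ccontr)
    assume "\<not> (\<exists>c\<in>C. f c \<noteq> 0)"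
    then have f0: "f c = 0" if "c \<in> C" for c using that by blast
    have "(\<chi> i. Re (v $ i)) \<bullet> c = Re (f c)" "(\<chi> i. Im (v $ i)) \<bullet> c = Im (f c)" for c
      by (simp_all add: f_def inner_vec_def)
    then have "(\<chi> i. Re (v $ i)) \<bullet> c = 0" "(\<chi> i. Im (v $ i)) \<bullet> c = 0" if "c \<in> C" for c
      using f0[OF that] by simp_all
    then have "(\<chi> i. Re (v $ i)) = 0" "(\<chi> i. Im (v $ i)) = 0"
      using expand[of "\<chi> i. Re (v $ i)"] expand[of "\<chi> i. Im (v $ i)"] by simp_all
    then have "v = 0" by (simp add: vec_eq_iff complex_eq_iff)
    with v show False by simp
  qed
  then show "z \<in> (\<lambda>c. complex_of_real (l c)) ` C" using zf by auto
qed

lemma min_eig_Re_le: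
  assumes sym: "transpose A = A" and c: "c \<in> C"
  shows "min_eig_Re A \<le> l c"
proof -
  have "complex_of_real (l c) \<in> eigenvalues A"
    unfolding eigenvalues_def
  proof (intro CollectI exI conjI)
    have "c \<noteq> 0" using nrm[OF c] by auto
    then show "(\<chi> i. complex_of_real (c $ i)) \<noteq> 0" by (auto simp: vec_eq_iff)
    have "(A *v c) $ i = l c * c $ i" for i using eig[OF c] by simp
    then have "(\<Sum>j\<in>UNIV. A $ i $ j * c $ j) = l c * c $ i" for i by (simp add: matrix_vector_mult_def)
    then have "(\<Sum>j\<in>UNIV. complex_of_real (A $ i $ j * c $ j)) = complex_of_real (l c * c $ i)" for i
      by (metis of_real_sum)
    then show "(\<chi> i j. complex_of_real (A $ i $ j)) *v (\<chi> i. complex_of_real (c $ i)) =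
        complex_of_real (l c) *s (\<chi> i. complex_of_real (c $ i))"
      by (simp add: vec_eq_iff matrix_vector_mult_def)
  qed
  moreover have "finite (eigenvalues A)"
    by (rule finite_subset[OF eigenvalues_subset[OF sym]]) (use fin in simp)
  ultimately show ?thesis unfolding min_eig_Re_def by (intro Min_le) force+
qed

end

lemma op_powr_eigen:
  assumes "matrix_eigenbasis A C l"
  shows "op_powr r A *v x = (\<Sum>c\<in>C. (exp (ln r * l c) * (x \<bullet> c)) *\<^sub>R c)"
proof -
  interpret matrix_eigenbasis A C l by fact
  interpret S: matrix_eigenbasis "ln r *\<^sub>R A" C "\<lambda>c. ln r * l c"
    by unfold_locales (auto simp: fin orth nrm eig sp scaleR_matrix_vector_assoc[symmetric])
  show ?thesis unfolding op_powr_def by (rule S.mat_exp_eigen)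
qed

lemma op_powr_norm_le:
  assumes sym: "transpose A = A" and a: "a \<le> min_eig_Re A" and r: "0 < r" "r \<le> 1"
  shows "norm (op_powr r A *v x) \<le> r powr a * norm x"
proof -
  obtain C l where "matrix_eigenbasis A C l"
    using symmetric_orthonormal_eigenbasis[OF sym] unfolding matrix_eigenbasis_def by metis
  then interpret matrix_eigenbasis A C l .
  have "(norm (op_powr r A *v x))\<^sup>2 = (\<Sum>c\<in>C. (exp (ln r * l c) * (x \<bullet> c))\<^sup>2)"
    unfolding op_powr_eigen[OF \<open>matrix_eigenbasis A C l\<close>] by (rule norm_combination)
  also have "\<dots> \<le> (\<Sum>c\<in>C. (r powr a)\<^sup>2 * (x \<bullet> c)\<^sup>2)"
  proof (rule sum_mono)
    fix c assume "c \<in> C"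
    then have "a \<le> l c" using a min_eig_Re_le[OF sym] by fastforce
    then have "ln r * l c \<le> ln r * a" using r by (intro mult_left_mono_neg) auto
    then have "exp (ln r * l c) \<le> r powr a"
      using r by (simp add: powr_def mult.commute)
    then show "(exp (ln r * l c) * (x \<bullet> c))\<^sup>2 \<le> (r powr a)\<^sup>2 * (x \<bullet> c)\<^sup>2"
      unfolding power_mult_distrib by (intro mult_right_mono power_mono) auto
  qed
  also have "\<dots> = (r powr a * norm x)\<^sup>2"
    using norm_combination[of "\<lambda>c. x \<bullet> c"] by (simp add: expand power_mult_distrib sum_distrib_left)
  finally show ?thesis by (rule power2_le_imp_le) simp
qed

lemma op_powr_nonzero:
  assumes sym: "transpose A = A" and x: "x \<noteq> 0"
  shows "op_powr r A *v x \<noteq> 0"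
proof
  obtain C l where "matrix_eigenbasis A C l"
    using symmetric_orthonormal_eigenbasis[OF sym] unfolding matrix_eigenbasis_def by metis
  then interpret matrix_eigenbasis A C l .
  assume "op_powr r A *v x = 0"
  then have "(\<Sum>c\<in>C. (exp (ln r * l c) * (x \<bullet> c))\<^sup>2) = 0"
    using norm_combination[of "\<lambda>c. exp (ln r * l c) * (x \<bullet> c)"]
    unfolding op_powr_eigen[OF \<open>matrix_eigenbasis A C l\<close>] by simp
  then have "x \<bullet> c = 0" if "c \<in> C" for c using that fin by (simp add: sum_nonneg_eq_0_iff)
  then show False using expand[of x] x by simp
qed

section \<open>Levy-Khintchine form and infinite divisibility\<close>

lemma char_fun_convolution:
  fixes \<rho> \<tau> :: "(real^'m) measure"
  assumes \<rho>: "prob_space \<rho>" "sets \<rho> = sets borel" and \<tau>: "prob_space \<tau>" "sets \<tau> = sets borel"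
  shows "char_fun (\<rho> \<star> \<tau>) u = char_fun \<rho> u * char_fun \<tau> u"
proof -
  interpret \<rho>: prob_space \<rho> by fact
  interpret \<tau>: prob_space \<tau> by fact
  interpret P: pair_prob_space \<rho> \<tau> ..
  note [measurable_cong] = \<rho>(2) \<tau>(2)
  have [measurable]: "(\<lambda>x. x \<bullet> u) \<in> borel_measurable \<rho>" "(\<lambda>x. x \<bullet> u) \<in> borel_measurable \<tau>" by measurable
  have "char_fun (\<rho> \<star> \<tau>) u = (CLINT p|\<rho> \<Otimes>\<^sub>M \<tau>. iexp ((fst p + snd p) \<bullet> u))"
    unfolding char_fun_def convolution_def by (subst integral_distr) (auto simp: case_prod_beta)
  also have "\<dots> = (CLINT x|\<rho>. CLINT y|\<tau>. iexp ((x + y) \<bullet> u))"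
    by (subst P.integral_fst'[symmetric]) (auto intro!: P.integrable_iexp_real simp del: of_real_add of_real_mult)
  also have "\<dots> = (CLINT x|\<rho>. iexp (x \<bullet> u) * char_fun \<tau> u)"
    by (simp add: char_fun_def inner_add_left algebra_simps exp_add)
  also have "\<dots> = char_fun \<rho> u * char_fun \<tau> u" by (simp add: char_fun_def)
  finally show ?thesis .
qed

lemma convolution_power:
  fixes \<rho> :: "(real^'m) measure"
  assumes \<rho>: "prob_space \<rho>" "sets \<rho> = sets borel"
  defines "\<mu> n \<equiv> ((\<lambda>\<tau>. \<rho> \<star> \<tau>) ^^ n) (return borel 0)"
  shows "prob_space (\<mu> n)" "sets (\<mu> n) = sets borel" "char_fun (\<mu> n) u = char_fun \<rho> u ^ n"
proof -
  have "prob_space (\<mu> n) \<and> sets (\<mu> n) = sets borel \<and> char_fun (\<mu> n) u = char_fun \<rho> u ^ n"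
  proof (induction n)
    case 0
    have "char_fun (return borel (0 :: real^'m)) u = 1"
      unfolding char_fun_def by (subst integral_return) auto
    then show ?case by (simp add: \<mu>_def prob_space_return)
  next
    case (Suc n)
    have eq: "\<mu> (Suc n) = (\<rho> \<star> \<mu> n)" by (simp add: \<mu>_def)
    interpret \<rho>: prob_space \<rho> by fact
    interpret \<mu>: prob_space "\<mu> n" using Suc by blast
    interpret P: pair_prob_space \<rho> "\<mu> n" ..
    have [measurable_cong]: "sets \<rho> = sets borel" "sets (\<mu> n) = sets borel" using \<rho> Suc by auto
    have "prob_space (\<rho> \<star> \<mu> n)"
      unfolding convolution_def by (rule P.prob_space_distr) measurable
    then show ?case
      using char_fun_convolution[OF \<rho>, of "\<mu> n" u] Suc by (simp add: eq)
  qed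
  then show "prob_space (\<mu> n)" "sets (\<mu> n) = sets borel" "char_fun (\<mu> n) u = char_fun \<rho> u ^ n" by auto
qed

text \<open>The integrand is bounded by a multiple of \<open>min(1, \<bar>x\<bar>\<^sup>2)\<close>, hence integrable, and reflecting \<open>x\<close>
conjugates it. So the integral is real, and the centering term disappears.\<close>

lemma levy_integral_compensated:
  fixes \<phi> :: "(real^'m) measure"
  assumes L: "levy_measure \<phi>" and symm: "distr \<phi> borel uminus = \<phi>"
  shows "(CLINT x|\<phi>. iexp (x \<bullet> u) - 1 - \<i> * of_real ((x \<bullet> u) / (1 + (norm x)\<^sup>2))) =
    complex_of_real (LINT x|\<phi>. cos (x \<bullet> u) - 1)"
proof -
  have [measurable_cong]: "sets \<phi> = sets borel" using L by (simp add: levy_measure_def)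
  define g :: "real^'m \<Rightarrow> complex" where
    "g x = iexp (x \<bullet> u) - 1 - \<i> * of_real ((x \<bullet> u) / (1 + (norm x)\<^sup>2))" for x
  have gm: "g \<in> borel_measurable borel" unfolding g_def[abs_def] by measurable
  have im: "integrable \<phi> (\<lambda>x. min 1 ((norm x)\<^sup>2))"
    using L by (intro integrableI_bounded) (auto simp: levy_measure_def)
  have bound: "cmod (g x) \<le> (2 + norm u + (norm u)\<^sup>2) * min 1 ((norm x)\<^sup>2)" for x
  proof -
    define y where "y = x \<bullet> u"
    have y: "\<bar>y\<bar> \<le> norm x * norm u" unfolding y_def by (rule Cauchy_Schwarz_ineq2)
    show ?thesis
    proof (cases "norm x \<le> 1")
      case True
      have e: "g x = (iexp y - (\<Sum>k\<le>1. (\<i> * y)^k / fact k)) + \<i> * of_real (y * (norm x)\<^sup>2 / (1 + (norm x)\<^sup>2))"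
      proof -
        have "y / (1 + (norm x)\<^sup>2) = y - y * (norm x)\<^sup>2 / (1 + (norm x)\<^sup>2)"
        proof -
          have "1 + (norm x)\<^sup>2 \<noteq> 0" by (metis add_pos_nonneg less_numeral_extra(1,3) zero_le_power2)
          then show ?thesis by (simp add: field_simps)
        qed
        then show ?thesis
          unfolding g_def y_def[symmetric] by (simp only: of_real_diff) (simp add: algebra_simps)
      qed
      have "cmod (iexp y - (\<Sum>k\<le>1. (\<i> * y)^k / fact k)) \<le> \<bar>y\<bar>\<^sup>2 / 2"
        using iexp_approx1[of y 1] by (simp add: numeral_2_eq_2)
      also have "\<dots> \<le> (norm x * norm u)\<^sup>2" using power_mono[OF y, of 2] zero_le_power2[of "norm x * norm u"] by linarith
      finally have 1: "cmod (iexp y - (\<Sum>k\<le>1. (\<i> * y)^k / fact k)) \<le> (norm u)\<^sup>2 * (norm x)\<^sup>2"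
        by (simp add: power_mult_distrib mult.commute)
      have "cmod (\<i> * of_real (y * (norm x)\<^sup>2 / (1 + (norm x)\<^sup>2))) = \<bar>y\<bar> * (norm x)\<^sup>2 / (1 + (norm x)\<^sup>2)"
        by (simp add: norm_mult norm_divide abs_mult del: of_real_mult of_real_divide of_real_add)
      also have "\<dots> \<le> \<bar>y\<bar> * (norm x)\<^sup>2 / 1" by (intro divide_left_mono) (auto simp: add_pos_nonneg)
      also have "\<dots> \<le> norm u * (norm x)\<^sup>2"
      proof -
        have "norm x * norm u \<le> norm u" using True by (simp add: mult_left_le_one_le)
        with y have "\<bar>y\<bar> \<le> norm u" by linarith
        then show ?thesis by (simp add: mult_right_mono)
      qed
      finally have "cmod (g x) \<le> (norm u)\<^sup>2 * (norm x)\<^sup>2 + norm u * (norm x)\<^sup>2"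
        unfolding e using 1 by (intro norm_triangle_le add_mono)
      also have "\<dots> \<le> (2 + norm u + (norm u)\<^sup>2) * (norm x)\<^sup>2" by (simp add: algebra_simps)
      also have "(norm x)\<^sup>2 = min 1 ((norm x)\<^sup>2)" using True by (simp add: power_le_one min_absorb2)
      finally show ?thesis .
    next
      case False
      have "cmod (\<i> * of_real (y / (1 + (norm x)\<^sup>2))) = \<bar>y\<bar> / (1 + (norm x)\<^sup>2)"
        by (simp add: norm_mult norm_divide del: of_real_mult of_real_divide of_real_add)
      also have "\<dots> \<le> norm u"
      proof -
        have "norm x \<le> 1 + (norm x)\<^sup>2" using False by (simp add: power2_eq_square) (smt (verit) mult_le_cancel_right1)
        then have "norm x * norm u \<le> (1 + (norm x)\<^sup>2) * norm u" by (intro mult_right_mono) auto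
        with y have "\<bar>y\<bar> \<le> norm u * (1 + (norm x)\<^sup>2)" by (simp add: mult.commute)
        then show ?thesis by (subst pos_divide_le_eq) (auto simp: add_pos_nonneg)
      qed
      finally have 1: "cmod (\<i> * of_real (y / (1 + (norm x)\<^sup>2))) \<le> norm u" .
      have "cmod (g x) \<le> cmod (iexp y) + 1 + cmod (\<i> * of_real (y / (1 + (norm x)\<^sup>2)))"
        unfolding g_def y_def[symmetric] by (metis norm_triangle_ineq4 norm_one add_right_mono order_trans)
      also have "\<dots> \<le> 2 + norm u + (norm u)\<^sup>2"
        using 1 norm_exp_i_times[of y] zero_le_power2[of "norm u"] by linarith
      also have "\<dots> = (2 + norm u + (norm u)\<^sup>2) * min 1 ((norm x)\<^sup>2)" using False by (simp add: min_def)
      finally show ?thesis .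
    qed
  qed
  have ig: "integrable \<phi> g"
    by (rule Bochner_Integration.integrable_bound[OF integrable_mult_right[OF im, of "2 + norm u + (norm u)\<^sup>2"]])
      (use gm bound in \<open>auto intro: order_trans[OF bound]\<close>)
  have "(CLINT x|\<phi>. g x) = (CLINT x|distr \<phi> borel uminus. g x)" by (simp add: symm)
  also have "\<dots> = (CLINT x|\<phi>. g (- x))" using gm by (intro integral_distr) auto
  also have "\<dots> = (CLINT x|\<phi>. cnj (g x))"
    by (rule Bochner_Integration.integral_cong) (auto simp: g_def exp_cnj)
  also have "\<dots> = cnj (CLINT x|\<phi>. g x)" by (rule Bochner_Integration.integral_cnj)
  finally have "Im (CLINT x|\<phi>. g x) = 0" by (simp add: complex_eq_iff)
  moreover have "Re (CLINT x|\<phi>. g x) = (LINT x|\<phi>. cos (x \<bullet> u) - 1)"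
    unfolding integral_Re[OF ig, symmetric] by (simp add: g_def Re_exp)
  ultimately show ?thesis unfolding g_def[symmetric] by (simp add: complex_eq_iff)
qed

text \<open>The \<open>n\<close>-th convolution root is the law of the same jumps for the intensity divided by \<open>n\<close>.\<close>

lemma poisson_law_infinitely_divisible:
  fixes X :: "'z \<Rightarrow> real^'m"
  assumes pj: "poisson_jumps \<Omega> \<kappa> I X" and \<kappa>: "sigma_finite_measure \<kappa>" and E: "E \<in> poisson_jumps.small_sets \<kappa> X"
  shows "infinitely_divisible (distr \<Omega> borel (poisson_jumps.M I X E))"
proof -
  interpret poisson_jumps \<Omega> \<kappa> I X by fact
  note M_measurable[OF E, measurable]
  have cM: "char_fun (distr \<Omega> borel (M E)) u = exp (complex_of_real (LINT z|\<kappa>. indicator E z * (cos (X z \<bullet> u) - 1)))" for u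
    unfolding char_fun_def M_char[OF E, symmetric] by (subst integral_distr) auto
  show ?thesis
    unfolding infinitely_divisible_def
  proof (intro conjI allI impI)
    show P: "prob_space (distr \<Omega> borel (M E))" by (rule prob_space_distr) measurable
    show "sets (distr \<Omega> borel (M E)) = sets borel" by simp
    fix n :: nat assume n: "1 \<le> n"
    define \<kappa>' where "\<kappa>' = density \<kappa> (\<lambda>_. ennreal (1 / n))"
    have sf: "sigma_finite_measure \<kappa>'"
      unfolding \<kappa>'_def by (subst sigma_finite_measure.sigma_finite_iff_density_finite[OF \<kappa>]) auto
    obtain \<Omega>' :: "(nat \<Rightarrow> nat \<times> (nat \<Rightarrow> 'z \<times> real)) measure" and I' where "symmetric_poisson \<Omega>' \<kappa>' I'"
      using symmetric_poisson_exists[OF sf] by blast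
    moreover have "X \<in> borel_measurable \<kappa>'" by (simp add: \<kappa>'_def)
    ultimately interpret R: poisson_jumps \<Omega>' \<kappa>' I' X
      by (simp add: poisson_jumps_def poisson_jumps_axioms_def)
    have [measurable]: "E \<in> sets \<kappa>" by (rule small_setsD[OF E])
    have E': "E \<in> R.small_sets"
      using E unfolding R.small_sets_def small_sets_def by (auto simp: \<kappa>'_def integrable_density)
    note R.M_measurable[OF E', measurable]
    let ?\<rho> = "distr \<Omega>' borel (R.M E)"
    have \<rho>: "prob_space ?\<rho>" "sets ?\<rho> = sets borel" by (auto intro: R.prob_space_distr)
    have c\<rho>: "char_fun ?\<rho> u = exp (complex_of_real ((1 / n) * (LINT z|\<kappa>. indicator E z * (cos (X z \<bullet> u) - 1))))" for u
    proof -
      have "(LINT z|\<kappa>'. indicator E z * (cos (X z \<bullet> u) - 1)) = (LINT z|\<kappa>. (1 / n) * (indicator E z * (cos (X z \<bullet> u) - 1)))"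
        unfolding \<kappa>'_def by (subst integral_real_density) auto
      then have "(LINT z|\<kappa>'. indicator E z * (cos (X z \<bullet> u) - 1)) = (1 / n) * (LINT z|\<kappa>. indicator E z * (cos (X z \<bullet> u) - 1))"
        by (simp only: integral_mult_right_zero)
      moreover have "char_fun ?\<rho> u = exp (complex_of_real (LINT z|\<kappa>'. indicator E z * (cos (X z \<bullet> u) - 1)))"
        unfolding char_fun_def R.M_char[OF E', symmetric] by (subst integral_distr) auto
      ultimately show ?thesis by simp
    qed
    have "distr \<Omega> borel (M E) = ((\<lambda>\<tau>. ?\<rho> \<star> \<tau>) ^^ n) (return borel 0)"
    proof (rule char_fun_determines)
      fix u
      have "char_fun (((\<lambda>\<tau>. ?\<rho> \<star> \<tau>) ^^ n) (return borel 0)) u = char_fun ?\<rho> u ^ n"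
        by (rule convolution_power(3)[OF \<rho>])
      also have "\<dots> = char_fun (distr \<Omega> borel (M E)) u"
        unfolding c\<rho> cM exp_of_nat_mult[symmetric] using n by simp
      finally show "char_fun (distr \<Omega> borel (M E)) u = char_fun (((\<lambda>\<tau>. ?\<rho> \<star> \<tau>) ^^ n) (return borel 0)) u" ..
    qed (use P convolution_power(1,2)[OF \<rho>] in auto)
    then show "\<exists>\<rho>. prob_space \<rho> \<and> sets \<rho> = sets borel \<and> distr \<Omega> borel (M E) = ((\<lambda>\<tau>. \<rho> \<star> \<tau>) ^^ n) (return borel 0)"
      using \<rho> by blast
  qed
qed

section \<open>The intensity of the operator-stable jumps\<close>

text \<open>Transports independence to the image space, which is needed to realise the random measure on the
space of all set functions.\<close>

lemma indep_vars_distr: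
  assumes P: "prob_space P" and T: "T \<in> P \<rightarrow>\<^sub>M N" and X: "\<And>i. i \<in> J \<Longrightarrow> X i \<in> N \<rightarrow>\<^sub>M M' i"
    and ind: "prob_space.indep_vars P M' (\<lambda>i w. X i (T w)) J"
  shows "prob_space.indep_vars (distr P N T) M' X J"
proof -
  interpret P: prob_space P by fact
  interpret D: prob_space "distr P N T" using T by (rule P.prob_space_distr)
  show ?thesis
  proof (cases "J = {}")
    case True
    show ?thesis unfolding D.indep_vars_def2 D.indep_sets_def using True by auto
  next
    case False
    have XT: "(\<lambda>w. X i (T w)) \<in> P \<rightarrow>\<^sub>M M' i" if "i \<in> J" for i
      using measurable_compose[OF T X[OF that]] .
    have "distr (distr P N T) (PiM J M') (\<lambda>x. \<lambda>i\<in>J. X i x) = distr P (PiM J M') (\<lambda>w. \<lambda>i\<in>J. X i (T w))"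
      using X T by (subst distr_distr) (auto intro!: measurable_restrict simp: comp_def)
    also have "\<dots> = PiM J (\<lambda>i. distr P (M' i) (\<lambda>w. X i (T w)))"
      by (rule P.indep_vars_iff_distr_eq_PiM'[THEN iffD1, OF False _ ind]) (rule XT)
    also have "\<dots> = PiM J (\<lambda>i. distr (distr P N T) (M' i) (X i))"
      using X T by (intro PiM_cong) (auto simp: distr_distr comp_def)
    finally show ?thesis
      using X by (subst D.indep_vars_iff_distr_eq_PiM'[OF False]) auto
  qed
qed

text \<open>Almost sure statements pass to an image measure only for measurable events.\<close>

lemma pred_sums_measurable:
  fixes f :: "nat \<Rightarrow> 'a \<Rightarrow> 'b::{second_countable_topology, real_normed_vector}"
  assumes [measurable]: "\<And>n. f n \<in> borel_measurable N" "g \<in> borel_measurable N"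
  shows "{x \<in> space N. (\<lambda>n. f n x) sums g x} \<in> sets N"
proof -
  have eq: "(\<lambda>n. f n x) sums g x \<longleftrightarrow> (\<forall>m::nat. \<exists>K. \<forall>n\<ge>K. norm ((\<Sum>k<n. f k x) - g x) < 1 / Suc m)" for x
  proof
    assume "(\<lambda>n. f n x) sums g x"
    then show "\<forall>m::nat. \<exists>K. \<forall>n\<ge>K. norm ((\<Sum>k<n. f k x) - g x) < 1 / Suc m"
      unfolding sums_def LIMSEQ_iff by auto
  next
    assume R: "\<forall>m::nat. \<exists>K. \<forall>n\<ge>K. norm ((\<Sum>k<n. f k x) - g x) < 1 / Suc m"
    show "(\<lambda>n. f n x) sums g x"
      unfolding sums_def LIMSEQ_iff
    proof (intro allI impI)
      fix r :: real assume "0 < r"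
      then obtain m where m: "1 / real (Suc m) < r" by (rule nat_approx_posE)
      obtain K where "\<forall>n\<ge>K. norm ((\<Sum>k<n. f k x) - g x) < 1 / Suc m" using R by blast
      then show "\<exists>K. \<forall>n\<ge>K. norm ((\<Sum>k<n. f k x) - g x) < r" using m by (meson less_trans)
    qed
  qed
  show ?thesis unfolding eq by measurable
qed

lemma delta_ring_fin_sets: "delta_ring (space \<nu>) (fin_sets \<nu>)"
  unfolding delta_ring_def
proof (intro conjI allI impI)
  show "ring_of_sets (space \<nu>) (fin_sets \<nu>)"
  proof (rule ring_of_setsI)
    show "fin_sets \<nu> \<subseteq> Pow (space \<nu>)" by (auto simp: fin_sets_def dest: sets.sets_into_space)
    show "{} \<in> fin_sets \<nu>" by (simp add: fin_sets_def)
    fix a b assume ab: "a \<in> fin_sets \<nu>" "b \<in> fin_sets \<nu>"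
    have "emeasure \<nu> (a \<union> b) \<le> emeasure \<nu> a + emeasure \<nu> b"
      using ab by (intro emeasure_subadditive) (auto simp: fin_sets_def)
    also have "\<dots> < \<infinity>" using ab by (simp add: fin_sets_def)
    finally show "a \<union> b \<in> fin_sets \<nu>" using ab by (auto simp: fin_sets_def)
    have "emeasure \<nu> (a - b) \<le> emeasure \<nu> a" using ab by (intro emeasure_mono) (auto simp: fin_sets_def)
    then show "a - b \<in> fin_sets \<nu>" using ab by (auto simp: fin_sets_def)
  qed
  fix A :: "nat \<Rightarrow> 'a set" assume A: "range A \<subseteq> fin_sets \<nu>"
  then have s: "A n \<in> sets \<nu>" for n by (auto simp: fin_sets_def)
  have "emeasure \<nu> (\<Inter>n. A n) \<le> emeasure \<nu> (A 0)" using s by (intro emeasure_mono) auto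
  also have "\<dots> < \<infinity>" using A by (auto simp: fin_sets_def)
  finally show "(\<Inter>n. A n) \<in> fin_sets \<nu>" using s by (auto simp: fin_sets_def)
qed

definition radial_measure :: "real measure" where
  "radial_measure = density lborel (\<lambda>r. indicator {0<..} r * ennreal (1 / r\<^sup>2))"

lemma sets_radial [measurable_cong, simp]: "sets radial_measure = sets borel"
  by (simp add: radial_measure_def)

lemma sigma_finite_radial: "sigma_finite_measure radial_measure"
  unfolding radial_measure_def
  by (subst sigma_finite_measure.sigma_finite_iff_density_finite[OF sigma_finite_lborel]) (auto simp: indicator_def)

lemma nn_integral_radial:
  assumes [measurable]: "f \<in> borel_measurable borel"
  shows "(\<integral>\<^sup>+r. f r \<partial>radial_measure) = (\<integral>\<^sup>+r\<in>{0<..}. f r * ennreal (1 / r\<^sup>2) \<partial>lborel)"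
  unfolding radial_measure_def by (subst nn_integral_density) (auto simp: mult_ac)

text \<open>The condition \<open>a > 1/2\<close> is exactly the integrability of \<open>r\<^bsup>2a - 2\<^esup>\<close> at zero.\<close>

lemma radial_integral_finite:
  assumes a: "1/2 < a"
  shows "(\<integral>\<^sup>+r. ennreal (if r \<le> 1 then r powr (2 * a) else 1) \<partial>radial_measure) < \<infinity>"
proof -
  have "(\<integral>\<^sup>+r. ennreal (if r \<le> 1 then r powr (2 * a) else 1) \<partial>radial_measure) =
      (\<integral>\<^sup>+r\<in>{0<..}. ennreal (if r \<le> 1 then r powr (2 * a) else 1) * ennreal (1 / r\<^sup>2) \<partial>lborel)"
    by (rule nn_integral_radial) measurable
  also have "\<dots> \<le> (\<integral>\<^sup>+r. ennreal (r powr (2 * a - 2)) * indicator {0..1} r + ennreal (1 / r ^ 2) * indicator {1..} r \<partial>lborel)"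
  proof (rule nn_integral_mono)
    fix r :: real
    show "ennreal (if r \<le> 1 then r powr (2 * a) else 1) * ennreal (1 / r\<^sup>2) * indicator {0<..} r \<le>
      ennreal (r powr (2 * a - 2)) * indicator {0..1} r + ennreal (1 / r ^ 2) * indicator {1..} r"
    proof (cases "0 < r \<and> r \<le> 1")
      case True
      then have "r powr (2 * a) * (1 / r\<^sup>2) = r powr (2 * a - 2)"
        by (simp add: powr_diff)
      then have "ennreal (r powr (2 * a)) * ennreal (1 / r\<^sup>2) = ennreal (r powr (2 * a - 2))"
        by (metis ennreal_mult' powr_ge_zero)
      then show ?thesis using True by (simp add: add_increasing2)
    qed (auto simp: indicator_def)
  qed
  also have "\<dots> = (\<integral>\<^sup>+r. ennreal (r powr (2 * a - 2)) * indicator {0..1} r \<partial>lborel) + (\<integral>\<^sup>+r. ennreal (1 / r ^ 2) * indicator {1..} r \<partial>lborel)"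
    by (rule nn_integral_add) measurable
  also have "\<dots> = ennreal (1 powr (2 * a - 2 + 1) / (2 * a - 2 + 1)) + ennreal (1 / (real (2 - 1) * 1 ^ (2 - 1)))"
  proof -
    have "(\<integral>\<^sup>+r. ennreal (r powr (2 * a - 2)) * indicator {0..1} r \<partial>lborel) = ennreal (1 powr (2 * a - 2 + 1) / (2 * a - 2 + 1))"
      by (rule nn_integral_has_integral_lebesgue'[OF _ has_integral_powr_from_0]) (use a in auto)
    moreover have "(\<integral>\<^sup>+r. ennreal (1 / r ^ 2) * indicator {1::real..} r \<partial>lborel) = ennreal (1 / (real (2 - 1) * 1 ^ (2 - 1)))"
      by (rule nn_integral_has_integral_lebesgue'[OF _ has_integral_inverse_power_to_inf]) auto
    ultimately show ?thesis by simp
  qed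
  also have "\<dots> < \<infinity>" by simp
  finally show ?thesis .
qed

text \<open>The number \<open>a\<close> bounds the spectra of all exponents from below, uniformly away from \<open>1/2\<close>.\<close>

locale operator_stable_kernel =
  fixes \<nu> :: "'s measure" and B :: "'s \<Rightarrow> real^'m^'m" and \<sigma> :: "(real^'m) measure" and a :: real
  assumes nu: "sigma_finite_measure \<nu>" and B[measurable]: "B \<in> borel_measurable \<nu>"
    and B_sym: "\<And>s. s \<in> space \<nu> \<Longrightarrow> transpose (B s) = B s"
    and a: "1/2 < a" "\<And>s. s \<in> space \<nu> \<Longrightarrow> a \<le> min_eig_Re (B s)"
    and sigma_finite_mass: "finite_measure \<sigma>" and sigma_sphere: "sets \<sigma> = sets (restrict_space borel (sphere 0 1))"
    and sigma_symmetric: "symmetric_measure \<sigma>"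
begin

definition polar :: "(real \<times> (real^'m)) measure" where "polar = radial_measure \<Otimes>\<^sub>M \<sigma>"
definition intensity :: "('s \<times> real \<times> (real^'m)) measure" where "intensity = \<nu> \<Otimes>\<^sub>M polar"
definition jump :: "'s \<times> real \<times> (real^'m) \<Rightarrow> real^'m" where
  "jump z = op_powr (fst (snd z)) (B (fst z)) *v snd (snd z)"
definition slab :: "'s set \<Rightarrow> ('s \<times> real \<times> (real^'m)) set" where "slab A = A \<times> space polar"

lemma sigma_id [measurable]: "(\<lambda>x. x) \<in> borel_measurable \<sigma>"
  unfolding measurable_cong_sets[OF sigma_sphere refl] by (rule measurable_restrict_space1) simp

lemma space_sigma: "space \<sigma> = sphere 0 1"
  using sets_eq_imp_space_eq[OF sigma_sphere] by (simp add: space_restrict_space)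

lemma sigma_finite_polar: "sigma_finite_measure polar"
proof -
  interpret \<sigma>: finite_measure \<sigma> by (rule sigma_finite_mass)
  interpret pair_sigma_finite radial_measure \<sigma>
    by (simp add: pair_sigma_finite_def sigma_finite_radial \<sigma>.sigma_finite_measure)
  show ?thesis unfolding polar_def ..
qed

lemma pair_nu_polar: "pair_sigma_finite \<nu> polar"
  by (simp add: pair_sigma_finite_def nu sigma_finite_polar)

lemma sigma_finite_intensity: "sigma_finite_measure intensity"
proof -
  interpret pair_sigma_finite \<nu> polar by (rule pair_nu_polar)
  show ?thesis unfolding intensity_def ..
qed

lemma jump_measurable [measurable]: "jump \<in> borel_measurable intensity"
proof -
  have "(\<lambda>z. fst (snd z)) \<in> intensity \<rightarrow>\<^sub>M radial_measure" unfolding intensity_def polar_def by measurable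
  then have 1: "(\<lambda>z. fst (snd z)) \<in> borel_measurable intensity" by (simp cong: measurable_cong_sets)
  have "(\<lambda>z. snd (snd z)) \<in> intensity \<rightarrow>\<^sub>M \<sigma>" unfolding intensity_def polar_def by measurable
  then have 2: "(\<lambda>z. snd (snd z)) \<in> borel_measurable intensity" by (rule measurable_compose[OF _ sigma_id])
  have "fst \<in> intensity \<rightarrow>\<^sub>M \<nu>" unfolding intensity_def by measurable
  then have 3: "(\<lambda>z. B (fst z)) \<in> borel_measurable intensity" by (rule measurable_compose[OF _ B])
  show ?thesis unfolding jump_def[abs_def]
    by (intro matrix_vector_mult_measurable op_powr_measurable 1 2 3)
qed

lemma jump_section_measurable [measurable]: "(\<lambda>p. jump (s, p)) \<in> borel_measurable polar"
proof -
  have "(\<lambda>p. fst p) \<in> polar \<rightarrow>\<^sub>M radial_measure" unfolding polar_def by measurable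
  then have 1: "(\<lambda>p. fst p) \<in> borel_measurable polar" by (simp cong: measurable_cong_sets)
  have "(\<lambda>p. snd p) \<in> polar \<rightarrow>\<^sub>M \<sigma>" unfolding polar_def by measurable
  then have 2: "(\<lambda>p. snd p) \<in> borel_measurable polar" by (rule measurable_compose[OF _ sigma_id])
  show ?thesis unfolding jump_def fst_conv snd_conv
    by (intro matrix_vector_mult_measurable op_powr_measurable 1 2 borel_measurable_const)
qed

lemma slab_sets [measurable]: "A \<in> sets \<nu> \<Longrightarrow> slab A \<in> sets intensity"
  unfolding slab_def intensity_def by auto

lemma nn_integral_polar:
  assumes "f \<in> borel_measurable polar"
  shows "(\<integral>\<^sup>+p. f p \<partial>polar) = (\<integral>\<^sup>+r. \<integral>\<^sup>+\<theta>. f (r, \<theta>) \<partial>\<sigma> \<partial>radial_measure)"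
proof -
  interpret \<sigma>: finite_measure \<sigma> by (rule sigma_finite_mass)
  show ?thesis using assms unfolding polar_def by (subst \<sigma>.nn_integral_fst) auto
qed

lemma phi_eq: "phi \<sigma> B s = distr polar borel (\<lambda>p. jump (s, p))"
proof (rule measure_eqI)
  fix C assume "C \<in> sets (phi \<sigma> B s)"
  then have C[measurable]: "C \<in> sets borel" by simp
  interpret \<sigma>: finite_measure \<sigma> by (rule sigma_finite_mass)
  have m[measurable]: "(\<lambda>p. indicator C (jump (s, p)) :: ennreal) \<in> borel_measurable polar" by measurable
  have [measurable]: "(\<lambda>\<theta>. op_powr r (B s) *v \<theta>) \<in> borel_measurable \<sigma>" for r by measurable
  have "emeasure (distr polar borel (\<lambda>p. jump (s, p))) C = (\<integral>\<^sup>+x. indicator C x \<partial>distr polar borel (\<lambda>p. jump (s, p)))"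
    by simp
  also have "\<dots> = (\<integral>\<^sup>+p. indicator C (jump (s, p)) \<partial>polar)" by (rule nn_integral_distr[OF jump_section_measurable]) simp
  also have "\<dots> = (\<integral>\<^sup>+r. \<integral>\<^sup>+\<theta>. indicator C (op_powr r (B s) *v \<theta>) \<partial>\<sigma> \<partial>radial_measure)"
    by (subst nn_integral_polar[OF m]) (simp add: jump_def)
  also have "\<dots> = (\<integral>\<^sup>+r\<in>{0<..}. (\<integral>\<^sup>+\<theta>. indicator C (op_powr r (B s) *v \<theta>) \<partial>\<sigma>) * ennreal (1 / r\<^sup>2) \<partial>lborel)"
    by (rule nn_integral_radial) measurable
  also have "\<dots> = emeasure (phi \<sigma> B s) C"
    unfolding emeasure_phi[OF sigma_finite_mass sigma_sphere C] by (simp add: nn_integral_multc)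
  finally show "emeasure (phi \<sigma> B s) C = emeasure (distr polar borel (\<lambda>p. jump (s, p))) C" ..
qed simp

lemma phi_int_eq:
  assumes A[measurable]: "A \<in> sets \<nu>"
  shows "phi_int \<nu> \<sigma> B A = distr (density intensity (indicator (slab A))) borel jump"
proof (rule measure_eqI)
  fix C assume "C \<in> sets (phi_int \<nu> \<sigma> B A)"
  then have C[measurable]: "C \<in> sets borel" by simp
  interpret pair_sigma_finite \<nu> polar by (rule pair_nu_polar)
  have "emeasure (distr (density intensity (indicator (slab A))) borel jump) C =
      (\<integral>\<^sup>+x. indicator C x \<partial>distr (density intensity (indicator (slab A))) borel jump)" by simp
  also have "\<dots> = (\<integral>\<^sup>+z. indicator (slab A) z * indicator C (jump z) \<partial>intensity)"
    by (subst nn_integral_distr, simp, simp, subst nn_integral_density) auto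
  also have "\<dots> = (\<integral>\<^sup>+s. \<integral>\<^sup>+p. indicator (slab A) (s, p) * indicator C (jump (s, p)) \<partial>polar \<partial>\<nu>)"
  proof -
    have "(\<lambda>z. indicator (slab A) z * indicator C (jump z) :: ennreal) \<in> borel_measurable intensity" by measurable
    then show ?thesis unfolding intensity_def by (subst M2.nn_integral_fst) auto
  qed
  also have "\<dots> = (\<integral>\<^sup>+s\<in>A. emeasure (phi \<sigma> B s) C \<partial>\<nu>)"
  proof (rule nn_integral_cong)
    fix s
    have "(\<integral>\<^sup>+p. indicator (slab A) (s, p) * indicator C (jump (s, p)) \<partial>polar) = (\<integral>\<^sup>+p. indicator A s * indicator C (jump (s, p)) \<partial>polar)"
      by (rule nn_integral_cong) (simp add: slab_def indicator_def)
    also have "\<dots> = indicator A s * (\<integral>\<^sup>+p. indicator C (jump (s, p)) \<partial>polar)" by (rule nn_integral_cmult) measurable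
    also have "(\<integral>\<^sup>+p. indicator C (jump (s, p)) \<partial>polar) = (\<integral>\<^sup>+x. indicator C x \<partial>phi \<sigma> B s)"
      unfolding phi_eq by (rule nn_integral_distr[OF jump_section_measurable, symmetric]) simp
    also have "\<dots> = emeasure (phi \<sigma> B s) C" by simp
    finally show "(\<integral>\<^sup>+p. indicator (slab A) (s, p) * indicator C (jump (s, p)) \<partial>polar) = emeasure (phi \<sigma> B s) C * indicator A s"
      by (simp add: mult.commute)
  qed
  also have "\<dots> = emeasure (phi_int \<nu> \<sigma> B A) C" by (rule emeasure_phi_int[OF sigma_finite_mass sigma_sphere B A C, symmetric])
  finally show "emeasure (phi_int \<nu> \<sigma> B A) C = emeasure (distr (density intensity (indicator (slab A))) borel jump) C" ..
qed simp

text \<open>For \<open>r \<le> 1\<close> the jump has norm at most \<open>r\<^sup>a\<close>, and for \<open>r > 1\<close> the truncation at \<open>1\<close> suffices; the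
resulting bound no longer depends on \<open>s\<close>.\<close>

lemma section_bound:
  obtains K where "K < \<infinity>" "\<And>s. s \<in> space \<nu> \<Longrightarrow> (\<integral>\<^sup>+p. ennreal (min 1 ((norm (jump (s, p)))\<^sup>2)) \<partial>polar) \<le> K"
proof -
  interpret \<sigma>: finite_measure \<sigma> by (rule sigma_finite_mass)
  define g where "g r = ennreal (if r \<le> 1 then r powr (2 * a) else 1)" for r
  have [measurable]: "g \<in> borel_measurable borel" unfolding g_def[abs_def] by measurable
  define K where "K = (\<integral>\<^sup>+r. g r \<partial>radial_measure) * emeasure \<sigma> (space \<sigma>)"
  have "K < \<infinity>"
    unfolding K_def g_def using radial_integral_finite[OF a(1)] \<sigma>.emeasure_finite
    by (auto simp: ennreal_mult_eq_top_iff less_top[symmetric])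
  moreover have "(\<integral>\<^sup>+p. ennreal (min 1 ((norm (jump (s, p)))\<^sup>2)) \<partial>polar) \<le> K" if s: "s \<in> space \<nu>" for s
  proof -
    have "(\<integral>\<^sup>+p. ennreal (min 1 ((norm (jump (s, p)))\<^sup>2)) \<partial>polar) =
       (\<integral>\<^sup>+r. \<integral>\<^sup>+\<theta>. ennreal (min 1 ((norm (jump (s, r, \<theta>)))\<^sup>2)) \<partial>\<sigma> \<partial>radial_measure)"
      by (rule nn_integral_polar) measurable
    also have "\<dots> \<le> (\<integral>\<^sup>+r. g r * emeasure \<sigma> (space \<sigma>) \<partial>radial_measure)"
    proof (rule nn_integral_mono_AE)
      have pos: "AE r in radial_measure. 0 < r"
        unfolding radial_measure_def by (subst AE_density) (auto simp: indicator_def)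
      then show "AE r in radial_measure. (\<integral>\<^sup>+\<theta>. ennreal (min 1 ((norm (jump (s, r, \<theta>)))\<^sup>2)) \<partial>\<sigma>) \<le> g r * emeasure \<sigma> (space \<sigma>)"
      proof eventually_elim
        case (elim r)
        have "(\<integral>\<^sup>+\<theta>. ennreal (min 1 ((norm (jump (s, r, \<theta>)))\<^sup>2)) \<partial>\<sigma>) \<le> (\<integral>\<^sup>+\<theta>. g r \<partial>\<sigma>)"
        proof (rule nn_integral_mono)
          fix \<theta> assume "\<theta> \<in> space \<sigma>"
          then have \<theta>: "norm \<theta> = 1" by (simp add: space_sigma)
          show "ennreal (min 1 ((norm (jump (s, r, \<theta>)))\<^sup>2)) \<le> g r"
          proof (cases "r \<le> 1")
            case True
            have "norm (jump (s, r, \<theta>)) \<le> r powr a"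
              using op_powr_norm_le[OF B_sym[OF s] a(2)[OF s] elim True, of \<theta>] \<theta> by (simp add: jump_def)
            then have "(norm (jump (s, r, \<theta>)))\<^sup>2 \<le> (r powr a)\<^sup>2" by (rule power_mono) simp
            also have "\<dots> = r powr (2 * a)" using elim by (simp add: power2_eq_square powr_add[symmetric])
            finally show ?thesis using True by (auto simp: g_def intro!: ennreal_leI)
          qed (auto simp: g_def)
        qed
        then show ?case by simp
      qed
    qed
    also have "\<dots> = K" unfolding K_def by (rule nn_integral_multc) measurable
    finally show ?thesis .
  qed
  ultimately show thesis by (rule that)
qed

lemma slab_integral_finite:
  assumes A: "A \<in> fin_sets \<nu>"
  shows "(\<integral>\<^sup>+z. ennreal (indicator (slab A) z * min 1 ((norm (jump z))\<^sup>2)) \<partial>intensity) < \<infinity>"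
proof -
  interpret pair_sigma_finite \<nu> polar by (rule pair_nu_polar)
  have [measurable]: "A \<in> sets \<nu>" using A by (simp add: fin_sets_def)
  obtain K where K: "K < \<infinity>" "\<And>s. s \<in> space \<nu> \<Longrightarrow> (\<integral>\<^sup>+p. ennreal (min 1 ((norm (jump (s, p)))\<^sup>2)) \<partial>polar) \<le> K"
    by (rule section_bound) blast
  have "(\<lambda>z. ennreal (indicator (slab A) z * min 1 ((norm (jump z))\<^sup>2))) \<in> borel_measurable intensity" by measurable
  then have "(\<integral>\<^sup>+z. ennreal (indicator (slab A) z * min 1 ((norm (jump z))\<^sup>2)) \<partial>intensity) =
      (\<integral>\<^sup>+s. \<integral>\<^sup>+p. ennreal (indicator (slab A) (s, p) * min 1 ((norm (jump (s, p)))\<^sup>2)) \<partial>polar \<partial>\<nu>)"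
    unfolding intensity_def by (subst M2.nn_integral_fst) auto
  also have "\<dots> \<le> (\<integral>\<^sup>+s. K * indicator A s \<partial>\<nu>)"
  proof (rule nn_integral_mono)
    fix s assume s: "s \<in> space \<nu>"
    have "(\<integral>\<^sup>+p. ennreal (indicator (slab A) (s, p) * min 1 ((norm (jump (s, p)))\<^sup>2)) \<partial>polar) \<le>
        (\<integral>\<^sup>+p. ennreal (min 1 ((norm (jump (s, p)))\<^sup>2)) * indicator A s \<partial>polar)"
      by (rule nn_integral_mono) (auto simp: slab_def indicator_def)
    also have "\<dots> = (\<integral>\<^sup>+p. ennreal (min 1 ((norm (jump (s, p)))\<^sup>2)) \<partial>polar) * indicator A s"
      by (rule nn_integral_multc) measurable
    also have "\<dots> \<le> K * indicator A s" using K(2)[OF s] by (rule mult_right_mono) simp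
    finally show "(\<integral>\<^sup>+p. ennreal (indicator (slab A) (s, p) * min 1 ((norm (jump (s, p)))\<^sup>2)) \<partial>polar) \<le> K * indicator A s" .
  qed
  also have "\<dots> = K * emeasure \<nu> A" by (rule nn_integral_cmult_indicator) measurable
  also have "\<dots> < \<infinity>" using K(1) A by (auto simp: fin_sets_def ennreal_mult_less_top less_top)
  finally show ?thesis .
qed

lemma levy_measure_phi_int:
  assumes A: "A \<in> fin_sets \<nu>"
  shows "levy_measure (phi_int \<nu> \<sigma> B A)"
  unfolding levy_measure_def
proof (intro conjI)
  have A'[measurable]: "A \<in> sets \<nu>" using A by (simp add: fin_sets_def)
  show "sets (phi_int \<nu> \<sigma> B A) = sets borel" by simp
  have "emeasure (phi \<sigma> B s) {0} = 0" if s: "s \<in> space \<nu>" for s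
  proof -
    have "(\<integral>\<^sup>+\<theta>. indicator {0} (op_powr r (B s) *v \<theta>) * ennreal (1 / r\<^sup>2) \<partial>\<sigma>) = (\<integral>\<^sup>+\<theta>. 0 \<partial>\<sigma>)" for r
    proof (rule nn_integral_cong)
      fix \<theta> assume "\<theta> \<in> space \<sigma>"
      then have "\<theta> \<noteq> 0" by (auto simp: space_sigma)
      then show "indicator {0} (op_powr r (B s) *v \<theta>) * ennreal (1 / r\<^sup>2) = 0"
        using op_powr_nonzero[OF B_sym[OF s]] by simp
    qed
    then show ?thesis by (subst emeasure_phi[OF sigma_finite_mass sigma_sphere]) auto
  qed
  then have "(\<integral>\<^sup>+s\<in>A. emeasure (phi \<sigma> B s) {0} \<partial>\<nu>) = (\<integral>\<^sup>+s. 0 \<partial>\<nu>)" by (intro nn_integral_cong) simp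
  then show "emeasure (phi_int \<nu> \<sigma> B A) {0} = 0" by (subst emeasure_phi_int[OF sigma_finite_mass sigma_sphere B A']) auto
  have "(\<integral>\<^sup>+x. ennreal (min 1 ((norm x)\<^sup>2)) \<partial>phi_int \<nu> \<sigma> B A) =
      (\<integral>\<^sup>+z. indicator (slab A) z * ennreal (min 1 ((norm (jump z))\<^sup>2)) \<partial>intensity)"
    unfolding phi_int_eq[OF A'] by (subst nn_integral_distr, simp, simp, subst nn_integral_density) auto
  also have "\<dots> = (\<integral>\<^sup>+z. ennreal (indicator (slab A) z * min 1 ((norm (jump z))\<^sup>2)) \<partial>intensity)"
    by (rule nn_integral_cong) (simp add: indicator_def)
  also have "\<dots> < \<infinity>" by (rule slab_integral_finite[OF A])
  finally show "(\<integral>\<^sup>+x. ennreal (min 1 ((norm x)\<^sup>2)) \<partial>phi_int \<nu> \<sigma> B A) < \<infinity>" .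
qed

lemma sigma_uminus: "uminus \<in> \<sigma> \<rightarrow>\<^sub>M \<sigma>" "distr \<sigma> \<sigma> uminus = \<sigma>"
proof -
  show m: "uminus \<in> \<sigma> \<rightarrow>\<^sub>M \<sigma>"
    unfolding measurable_cong_sets[OF sigma_sphere sigma_sphere] by (rule measurable_restrict_space3) auto
  show "distr \<sigma> \<sigma> uminus = \<sigma>"
  proof (rule measure_eqI)
    fix C assume "C \<in> sets (distr \<sigma> \<sigma> uminus)"
    then have C: "C \<in> sets \<sigma>" by simp
    then have "C \<subseteq> sphere 0 1" using sets.sets_into_space space_sigma by blast
    then have "uminus -` C \<inter> space \<sigma> = uminus ` C" by (force simp: space_sigma image_iff)
    then show "emeasure (distr \<sigma> \<sigma> uminus) C = emeasure \<sigma> C"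
      using sigma_symmetric C by (simp add: emeasure_distr[OF m C] symmetric_measure_def)
  qed simp
qed

text \<open>The power \<open>r\<^bsup>B(s)\<^esup>\<close> is linear, so the symmetry of the measure on the sphere is inherited.\<close>

lemma phi_int_uminus:
  assumes A: "A \<in> sets \<nu>"
  shows "distr (phi_int \<nu> \<sigma> B A) borel uminus = phi_int \<nu> \<sigma> B A"
proof (rule measure_eqI)
  fix C assume "C \<in> sets (distr (phi_int \<nu> \<sigma> B A) borel uminus)"
  then have C[measurable]: "C \<in> sets borel" by simp
  have C'[measurable]: "uminus -` C \<in> sets borel"
    using measurable_sets[OF borel_measurable_uminus[OF measurable_ident] C] by simp
  have phi: "emeasure (phi \<sigma> B s) (uminus -` C) = emeasure (phi \<sigma> B s) C" for s
  proof -
    have "(\<integral>\<^sup>+\<theta>. indicator (uminus -` C) (op_powr r (B s) *v \<theta>) * ennreal (1 / r\<^sup>2) \<partial>\<sigma>) =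
        (\<integral>\<^sup>+\<theta>. indicator C (op_powr r (B s) *v \<theta>) * ennreal (1 / r\<^sup>2) \<partial>\<sigma>)" for r
    proof -
      have "(\<integral>\<^sup>+\<theta>. indicator C (op_powr r (B s) *v \<theta>) * ennreal (1 / r\<^sup>2) \<partial>\<sigma>) =
          (\<integral>\<^sup>+\<theta>. indicator C (op_powr r (B s) *v \<theta>) * ennreal (1 / r\<^sup>2) \<partial>distr \<sigma> \<sigma> uminus)"
        by (simp add: sigma_uminus(2))
      also have "\<dots> = (\<integral>\<^sup>+\<theta>. indicator C (op_powr r (B s) *v (- \<theta>)) * ennreal (1 / r\<^sup>2) \<partial>\<sigma>)"
        by (rule nn_integral_distr[OF sigma_uminus(1)]) measurable
      also have "\<dots> = (\<integral>\<^sup>+\<theta>. indicator (uminus -` C) (op_powr r (B s) *v \<theta>) * ennreal (1 / r\<^sup>2) \<partial>\<sigma>)"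
        by (simp add: indicator_def linear_neg[OF matrix_vector_mul_linear])
      finally show ?thesis ..
    qed
    then show ?thesis unfolding emeasure_phi[OF sigma_finite_mass sigma_sphere C] emeasure_phi[OF sigma_finite_mass sigma_sphere C'] by simp
  qed
  have um: "uminus \<in> borel_measurable (phi_int \<nu> \<sigma> B A)"
    by (subst measurable_cong_sets[OF sets_phi_int refl]) measurable
  have "emeasure (distr (phi_int \<nu> \<sigma> B A) borel uminus) C = emeasure (phi_int \<nu> \<sigma> B A) (uminus -` C)"
    by (simp add: emeasure_distr[OF um C])
  then show "emeasure (distr (phi_int \<nu> \<sigma> B A) borel uminus) C = emeasure (phi_int \<nu> \<sigma> B A) C"
    unfolding emeasure_phi_int[OF sigma_finite_mass sigma_sphere B A C] emeasure_phi_int[OF sigma_finite_mass sigma_sphere B A C'] phi .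
qed simp

lemma exponent_phi_int:
  assumes A[measurable]: "A \<in> sets \<nu>"
  shows "(LINT x|phi_int \<nu> \<sigma> B A. cos (x \<bullet> u) - 1) = (LINT z|intensity. indicator (slab A) z * (cos (jump z \<bullet> u) - 1))"
proof -
  have "phi_int \<nu> \<sigma> B A = distr (density intensity (\<lambda>z. ennreal (indicator (slab A) z))) borel jump"
    by (simp add: phi_int_eq[OF A] ennreal_indicator)
  then show ?thesis
    by (simp only:) (subst integral_distr, simp, simp, subst integral_real_density, auto)
qed

lemma exponent_psi:
  assumes A[measurable]: "A \<in> sets \<nu>" and int: "integrable intensity (\<lambda>z. indicator (slab A) z * (cos (jump z \<bullet> u) - 1))"
  shows "(LINT z|intensity. indicator (slab A) z * (cos (jump z \<bullet> u) - 1)) = (LINT s:A|\<nu>. psi \<sigma> B s u)"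
proof -
  interpret pair_sigma_finite \<nu> polar by (rule pair_nu_polar)
  have psi: "psi \<sigma> B s u = (LINT p|polar. cos (jump (s, p) \<bullet> u) - 1)" for s
    unfolding psi_def phi_eq by (rule integral_distr[OF jump_section_measurable]) measurable
  have "(LINT z|intensity. indicator (slab A) z * (cos (jump z \<bullet> u) - 1)) =
      (LINT s|\<nu>. LINT p|polar. indicator (slab A) (s, p) * (cos (jump (s, p) \<bullet> u) - 1))"
    using integral_fst'[OF int[unfolded intensity_def]] by (simp add: intensity_def)
  also have "\<dots> = (LINT s|\<nu>. indicator A s * psi \<sigma> B s u)"
  proof (rule Bochner_Integration.integral_cong)
    fix s
    have "(LINT p|polar. indicator (slab A) (s, p) * (cos (jump (s, p) \<bullet> u) - 1)) =
        (LINT p|polar. indicator A s * (cos (jump (s, p) \<bullet> u) - 1))"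
      by (rule Bochner_Integration.integral_cong) (auto simp: slab_def indicator_def)
    then show "(LINT p|polar. indicator (slab A) (s, p) * (cos (jump (s, p) \<bullet> u) - 1)) = indicator A s * psi \<sigma> B s u"
      unfolding psi by simp
  qed simp
  finally show ?thesis by (simp add: set_lebesgue_integral_def)
qed

end

section \<open>The multi operator-stable random measure\<close>

theorem mainTheorem1:
  fixes \<nu> :: "'s measure"
    and B :: "'s \<Rightarrow> real^'m^'m"
    and \<sigma> :: "(real^'m) measure"
  assumes nu: "sigma_finite_measure \<nu>"
    and B_measurable: "B \<in> borel_measurable \<nu>"
    and B_Q: "\<And>s. s \<in> space \<nu> \<Longrightarrow> B s \<in> Q_ops"
    and B_symmetric: "\<And>s. s \<in> space \<nu> \<Longrightarrow> transpose (B s) = B s"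
    and B_lower: "(1/2 :: ereal) < (INF s\<in>space \<nu>. ereal (min_eig_Re (B s)))"
    and B_order: "(INF s\<in>space \<nu>. ereal (min_eig_Re (B s))) \<le> (SUP s\<in>space \<nu>. ereal (max_eig_Re (B s)))"
    and B_upper: "(SUP s\<in>space \<nu>. ereal (max_eig_Re (B s))) < \<infinity>"
    and sigma_fin: "finite_measure \<sigma>"
    and sigma_sphere: "sets \<sigma> = sets (restrict_space borel (sphere 0 1))"
    and sigma_symmetric: "symmetric_measure \<sigma>"
    and sigma_full: "span (measure_support \<sigma>) = UNIV"
  shows "\<exists>(P :: ('s set \<Rightarrow> real^'m) measure) M.
    isrm P (space \<nu>) (fin_sets \<nu>) M \<and>
    (\<forall>A\<in>fin_sets \<nu>.
       levy_khintchine (distr P borel (M A)) 0 0 (phi_int \<nu> \<sigma> B A) \<and>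
       (\<forall>\<mu>. levy_khintchine \<mu> 0 0 (phi_int \<nu> \<sigma> B A) \<longrightarrow> \<mu> = distr P borel (M A)) \<and>
       (\<forall>u. char_fun (distr P borel (M A)) u =
              exp (complex_of_real (\<integral>x. (cos (x \<bullet> u) - 1) \<partial>phi_int \<nu> \<sigma> B A)) \<and>
            char_fun (distr P borel (M A)) u =
              exp (complex_of_real (\<integral>s\<in>A. psi \<sigma> B s u \<partial>\<nu>))))"
proof -
  have "(1/2 :: ereal) = ereal (1/2)"
    unfolding one_ereal_def numeral_eq_ereal ereal_divide by simp
  then have "ereal (1/2) < (INF s\<in>space \<nu>. ereal (min_eig_Re (B s)))" using B_lower by simp
  then obtain a where "ereal (1/2) < ereal a" and a2: "ereal a < (INF s\<in>space \<nu>. ereal (min_eig_Re (B s)))"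
    using ereal_dense2 by blast
  then have a1: "1/2 < a" by simp
  have a_le: "a \<le> min_eig_Re (B s)" if "s \<in> space \<nu>" for s
  proof -
    have "ereal a < ereal (min_eig_Re (B s))" by (rule less_le_trans[OF a2 INF_lower[OF that]])
    then show ?thesis by simp
  qed
  interpret K: operator_stable_kernel \<nu> B \<sigma> a
    by (rule operator_stable_kernel.intro)
      (fact nu B_measurable B_symmetric a1 a_le sigma_fin sigma_sphere sigma_symmetric)+
  obtain \<Omega> :: "(nat \<Rightarrow> nat \<times> (nat \<Rightarrow> ('s \<times> real \<times> (real^'m)) \<times> real)) measure" and I
    where \<Omega>: "symmetric_poisson \<Omega> K.intensity I"
    using symmetric_poisson_exists[OF K.sigma_finite_intensity] by blast
  have pj: "poisson_jumps \<Omega> K.intensity I K.jump"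
    using \<Omega> by (simp add: poisson_jumps_def poisson_jumps_axioms_def K.jump_measurable)
  interpret poisson_jumps \<Omega> K.intensity I K.jump by (rule pj)
  have fin_sets: "A \<in> sets \<nu>" if "A \<in> fin_sets \<nu>" for A using that by (simp add: fin_sets_def)
  have small: "K.slab A \<in> small_sets" if A: "A \<in> fin_sets \<nu>" for A
    unfolding small_sets_def
  proof (intro CollectI conjI)
    show [measurable]: "K.slab A \<in> sets K.intensity" by (rule K.slab_sets[OF fin_sets[OF A]])
    show "integrable K.intensity (\<lambda>z. indicator (K.slab A) z * min 1 ((norm (K.jump z))\<^sup>2))"
    proof (rule integrableI_bounded)
      have "(\<integral>\<^sup>+z. ennreal (norm (indicator (K.slab A) z * min 1 ((norm (K.jump z))\<^sup>2))) \<partial>K.intensity) =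
          (\<integral>\<^sup>+z. ennreal (indicator (K.slab A) z * min 1 ((norm (K.jump z))\<^sup>2)) \<partial>K.intensity)"
        by (rule nn_integral_cong) (simp add: abs_mult)
      then show "(\<integral>\<^sup>+z. ennreal (norm (indicator (K.slab A) z * min 1 ((norm (K.jump z))\<^sup>2))) \<partial>K.intensity) < \<infinity>"
        using K.slab_integral_finite[OF A] by simp
    qed measurable
  qed
  \<comment> \<open>The random measure is moved to the space of all set functions, where \<open>N A\<close> evaluates at \<open>A\<close>; zero is the default outside the \<open>\<delta>\<close>-ring.\<close>
  define T where "T w A = (if A \<in> fin_sets \<nu> then M (K.slab A) w else 0)" for w A
  have T: "T \<in> \<Omega> \<rightarrow>\<^sub>M PiM UNIV (\<lambda>_. borel)"
    unfolding T_def[abs_def]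
  proof (rule measurable_abs_UNIV)
    show "(\<lambda>w. if A \<in> fin_sets \<nu> then M (K.slab A) w else 0) \<in> borel_measurable \<Omega>" for A
      by (cases "A \<in> fin_sets \<nu>") (simp_all add: M_measurable small)
  qed
  define P where "P = distr \<Omega> (PiM UNIV (\<lambda>_. borel :: (real^'m) measure)) T"
  define N where "N A w = w A" for A :: "'s set" and w :: "'s set \<Rightarrow> real^'m"
  have NP: "N A \<in> borel_measurable (PiM UNIV (\<lambda>_. borel))" for A
    unfolding N_def[abs_def] by (rule measurable_component_singleton) simp
  have NT: "N A (T w) = M (K.slab A) w" if "A \<in> fin_sets \<nu>" for A w using that by (simp add: N_def T_def)
  have law: "distr P borel (N A) = distr \<Omega> borel (M (K.slab A))" if A: "A \<in> fin_sets \<nu>" for A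
    unfolding P_def using NT[OF A] by (subst distr_distr[OF NP T]) (simp add: comp_def)
  have char_law: "char_fun (distr P borel (N A)) u =
      exp (complex_of_real (LINT z|K.intensity. indicator (K.slab A) z * (cos (K.jump z \<bullet> u) - 1)))" if A: "A \<in> fin_sets \<nu>" for A u
    unfolding law[OF A] char_fun_def M_char[OF small[OF A], symmetric]
    using M_measurable[OF small[OF A]] by (subst integral_distr) auto
  have char_phi: "char_fun (distr P borel (N A)) u = exp (complex_of_real (\<integral>x. (cos (x \<bullet> u) - 1) \<partial>phi_int \<nu> \<sigma> B A))"
    if A: "A \<in> fin_sets \<nu>" for A u
    unfolding char_law[OF A] K.exponent_phi_int[OF fin_sets[OF A]] ..
  have char_psi: "char_fun (distr P borel (N A)) u = exp (complex_of_real (\<integral>s\<in>A. psi \<sigma> B s u \<partial>\<nu>))"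
    if A: "A \<in> fin_sets \<nu>" for A u
  proof -
    have "(\<lambda>z. cos (indicator (K.slab A) z * (K.jump z \<bullet> u)) - 1) = (\<lambda>z. indicator (K.slab A) z * (cos (K.jump z \<bullet> u) - 1))"
      by (auto simp: indicator_def)
    then have "integrable K.intensity (\<lambda>z. indicator (K.slab A) z * (cos (K.jump z \<bullet> u) - 1))"
      using integrable_cos_levy[OF inner_levy_integrand[OF small[OF A]], of u] by simp
    then show ?thesis unfolding char_law[OF A] by (subst K.exponent_psi[OF fin_sets[OF A]]) auto
  qed
  have LK_exponent: "exp (\<i> * of_real (0 \<bullet> u) - of_real ((0 *v u) \<bullet> u / 2) +
      (CLINT x|phi_int \<nu> \<sigma> B A. iexp (x \<bullet> u) - 1 - \<i> * of_real ((x \<bullet> u) / (1 + (norm x)\<^sup>2)))) =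
      char_fun (distr P borel (N A)) u" if A: "A \<in> fin_sets \<nu>" for A and u :: "real^'m"
    unfolding levy_integral_compensated[OF K.levy_measure_phi_int[OF A] K.phi_int_uminus[OF fin_sets[OF A]]]
      char_phi[OF A] by simp
  have LK: "levy_khintchine (distr P borel (N A)) 0 0 (phi_int \<nu> \<sigma> B A)" if A: "A \<in> fin_sets \<nu>" for A
    unfolding levy_khintchine_def
  proof (intro conjI allI)
    show "infinitely_divisible (distr P borel (N A))"
      unfolding law[OF A] by (rule poisson_law_infinitely_divisible[OF pj K.sigma_finite_intensity small[OF A]])
    show "levy_measure (phi_int \<nu> \<sigma> B A)" by (rule K.levy_measure_phi_int[OF A])
    show "transpose (0 :: real^'m^'m) = 0" by (simp add: transpose_def vec_eq_iff)
    show "0 \<le> ((0 :: real^'m^'m) *v u) \<bullet> u" for u by simp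
  qed (simp only: LK_exponent[OF A])
  have unique: "\<mu> = distr P borel (N A)" if A: "A \<in> fin_sets \<nu>" and \<mu>: "levy_khintchine \<mu> 0 0 (phi_int \<nu> \<sigma> B A)" for A \<mu>
  proof (rule char_fun_determines)
    show "prob_space \<mu>" "sets \<mu> = sets borel" using \<mu> by (auto simp: levy_khintchine_def infinitely_divisible_def)
    show "prob_space (distr P borel (N A))" "sets (distr P borel (N A)) = sets borel"
      using LK[OF A] by (auto simp: levy_khintchine_def infinitely_divisible_def)
    show "char_fun \<mu> u = char_fun (distr P borel (N A)) u" for u
      using \<mu> LK_exponent[OF A, of u] unfolding levy_khintchine_def by metis
  qed
  have "isrm P (space \<nu>) (fin_sets \<nu>) N"
    unfolding isrm_def
  proof (intro conjI ballI allI impI)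
    show "prob_space P" unfolding P_def by (rule prob_space_distr[OF T])
    show "delta_ring (space \<nu>) (fin_sets \<nu>)" by (rule delta_ring_fin_sets)
    show "N A \<in> borel_measurable P" for A unfolding P_def using NP by simp
  next
    fix L :: "nat set" and A :: "nat \<Rightarrow> 's set"
    assume A: "A ` L \<subseteq> fin_sets \<nu>" and d: "disjoint_family_on A L"
    show "prob_space.indep_vars P (\<lambda>_. borel) (\<lambda>n. N (A n)) L"
      unfolding P_def
    proof (rule indep_vars_distr[OF prob_space_axioms T NP])
      have "indep_vars (\<lambda>_. borel) (\<lambda>n. M (K.slab (A n))) L"
      proof (rule M_indep)
        show "K.slab (A n) \<in> small_sets" if "n \<in> L" for n using A that by (intro small) auto
        show "disjoint_family_on (\<lambda>n. K.slab (A n)) L" using d by (auto simp: disjoint_family_on_def K.slab_def)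
      qed
      then show "indep_vars (\<lambda>_. borel) (\<lambda>n w. N (A n) (T w)) L"
        using A by (subst indep_vars_cong[OF refl _ refl, where Y="\<lambda>n. M (K.slab (A n))"]) (auto simp: NT)
    qed
  next
    fix A :: "nat \<Rightarrow> 's set"
    assume A: "range A \<subseteq> fin_sets \<nu>" and d: "disjoint_family A" and U: "(\<Union>n. A n) \<in> fin_sets \<nu>"
    have slabU: "K.slab (\<Union>n. A n) = (\<Union>n. K.slab (A n))" by (auto simp: K.slab_def)
    have An: "A n \<in> fin_sets \<nu>" for n using A by auto
    have "AE w in \<Omega>. (\<lambda>n. M (K.slab (A n)) w) sums M (\<Union>n. K.slab (A n)) w"
    proof (rule M_countably_additive)
      show "disjoint_family (\<lambda>n. K.slab (A n))" using d by (auto simp: disjoint_family_on_def K.slab_def)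
    qed (use small[OF An] small[OF U] slabU in auto)
    then have "AE w in \<Omega>. (\<lambda>n. N (A n) (T w)) sums N (\<Union>n. A n) (T w)"
      by (simp add: NT[OF An] NT[OF U] slabU)
    then show "AE w in P. (\<lambda>n. N (A n) w) sums N (\<Union>n. A n) w"
      unfolding P_def by (subst AE_distr_iff[OF T pred_sums_measurable[OF NP NP]])
  qed
  then show ?thesis
    using LK unique char_phi char_psi by (intro exI[of _ P] exI[of _ N]) blast
qed

end
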